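(* Let $n\ge 1$. There exists an isomorphism of superalgebras $$\Phi: \mathcal{H}c_n \stackrel{\simeq}{\longrightarrow} \mathcal{C}_n \otimes \mathcal{H}_n^-$$ which extends the identity map on $\mathcal{C}_n$ and sends $$T_i \mapsto -\tfrac12 R_i (c_i -c_{i+1}) +\tfrac{\varepsilon}{2} (1 -c_ic_{i+1}), \qquad 1\le i \le n-1.$$ Its inverse map $\Psi$ extends the identity map on $\mathcal{C}_n$ and sends $$R_i \mapsto (c_i -c_{i+1}) T_i +\varepsilon c_{i+1}, \qquad 1\le i \le n-1.$$
   Context: Let $q$ be a formal parameter and $\varepsilon=q-q^{-1}$. Algebras are unital and associative; superalgebra means $\mathbb{Z}_2$-graded algebra. The Clifford algebra $\mathcal{C}_n$ is the $\mathbb{C}$-superalgebra generated by odd elements $c_1,\dots,c_n$ with $c_i^2=1$ and $c_ic_j=-c_jc_i$ $(i\ne j)$. The Hecke-Clifford algebra $\mathcal{H}c_n$ is the $\mathbb{C}(q)$-algebra generated by $T_i$ $(1\le i\le n-1)$ and $c_i$ $(1\le i\le n)$ subject to: $(T_i-q)(T_i+q^{-1})=0$; $T_iT_{i+1}T_i=T_{i+1}T_iT_{i+1}$; $T_iT_j=T_jT_i$ for $|i-j|>1$; $T_ic_i=c_{i+1}T_i$; $T_ic_j=c_jT_i$ for $j\ne i,i+1$; $c_i^2=1$; $c_ic_j=-c_jc_i$ for $i\neq j$. It is a superalgebra with $T_i$ even and $c_i$ odd. The spin Hecke algebra $\mathcal{H}_n^-$ is the $\mathbb{C}(q)$-algebra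 generated by $R_i$ $(1\le i\le n-1)$ subject to: $R_i^2=-\varepsilon^2-2$; $R_iR_j=-R_jR_i$ for $|i-j|>1$; $R_iR_{i+1}R_i-R_{i+1}R_iR_{i+1}=\varepsilon^2(R_{i+1}-R_i)$. It is a superalgebra with every $R_i$ odd. The tensor product of superalgebras has multiplication $(c'\otimes b')(c\otimes b)=(-1)^{|b'||c|}c'c\otimes b'b$. One writes $c=c\otimes1$, $b=1\otimes b$, and $cb=c\otimes b$, so $R_i c_j=-c_jR_i$ in $\mathcal{C}_n\otimes\mathcal{H}_n^-$. Here $\mathcal{C}_n$ is a $\mathbb{C}$-algebra and the tensor product is over $\mathbb{C}$ (equivalently, extend $\mathcal{C}_n$ to $\mathbb{C}(q)$ and tensor over $\mathbb{C}(q)$). *)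

theory Defs
  imports
    Complex_Main
    "HOL-Algebra.QuotRing"
    "HOL-Algebra.Module"
    "HOL-Computational_Algebra.Polynomial"
    "HOL-Computational_Algebra.Fraction_Field"
    "HOL-Library.Poly_Mapping"
    "HOL-Library.Z2"
begin

section \<open>Superalgebras over a field\<close>

text \<open>A superalgebra over the field type \<open>'k\<close> is a HOL-Algebra ring with scalar multiplication and
  with components indexed by \<open>bit\<close>, the field of two elements.\<close>

record ('k, 'a) superalgebra = "('k, 'a) module" +
  homog :: "bit \<Rightarrow> 'a set"

definition scalar_ring :: "'k::field ring" where
  "scalar_ring = \<lparr>carrier = UNIV, monoid.mult = (*), one = 1, zero = 0, add = (+)\<rparr>"

locale superalgebra = ring A for A :: "('k::field, 'a) superalgebra" (structure) +
  assumes module: "Module.module scalar_ring A"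
    and smult_mult_left:
      "\<And>k x y. \<lbrakk>x \<in> carrier A; y \<in> carrier A\<rbrakk> \<Longrightarrow> (k \<odot> x) \<otimes> y = k \<odot> (x \<otimes> y)"
    and smult_mult_right:
      "\<And>k x y. \<lbrakk>x \<in> carrier A; y \<in> carrier A\<rbrakk> \<Longrightarrow> x \<otimes> (k \<odot> y) = k \<odot> (x \<otimes> y)"
    and homog_carrier: "\<And>s. homog A s \<subseteq> carrier A"
    and homog_zero: "\<And>s. \<zero> \<in> homog A s"
    and homog_add: "\<And>s x y. \<lbrakk>x \<in> homog A s; y \<in> homog A s\<rbrakk> \<Longrightarrow> x \<oplus> y \<in> homog A s"
    and homog_smult: "\<And>s k x. x \<in> homog A s \<Longrightarrow> k \<odot> x \<in> homog A s"
    and homog_direct_sum: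
      "\<And>x. x \<in> carrier A \<Longrightarrow> \<exists>!(x0, x1). x0 \<in> homog A 0 \<and> x1 \<in> homog A 1 \<and> x = x0 \<oplus> x1"
    and homog_one: "\<one> \<in> homog A 0"
    and homog_mult:
      "\<And>s t x y. \<lbrakk>x \<in> homog A s; y \<in> homog A t\<rbrakk> \<Longrightarrow> x \<otimes> y \<in> homog A (s + t)"

definition superalgebra_iso ::
    "('k::field, 'a) superalgebra \<Rightarrow> ('k, 'b) superalgebra \<Rightarrow> ('a \<Rightarrow> 'b) \<Rightarrow> bool" where
  "superalgebra_iso A B h \<longleftrightarrow>
     superalgebra A \<and> superalgebra B \<and>
     h \<in> ring_hom A B \<and>
     (\<forall>k. \<forall>x\<in>carrier A. h (k \<odot>\<^bsub>A\<^esub> x) = k \<odot>\<^bsub>B\<^esub> h x) \<and>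
     (\<forall>s. h ` homog A s \<subseteq> homog B s) \<and>
     bij_betw h (carrier A) (carrier B)"

definition hcomp :: "('k, 'a) superalgebra \<Rightarrow> bit \<Rightarrow> 'a \<Rightarrow> 'a" where
  "hcomp A s x = (THE y. y \<in> homog A s \<and> (\<exists>z\<in>homog A (s + 1). x = y \<oplus>\<^bsub>A\<^esub> z))"

text \<open>The quotient by \<open>I\<close> extends \<^const>\<open>FactRing\<close>: elements are cosets, all operations are computed
  on representatives, and the components are the images of the components.\<close>

definition superquot :: "('k, 'a) superalgebra \<Rightarrow> 'a set \<Rightarrow> ('k, 'a set) superalgebra" where
  "superquot A I = ring.extend (A Quot I)
     \<lparr>module.smult = (\<lambda>k X. \<Union>x\<in>X. I +>\<^bsub>A\<^esub> (k \<odot>\<^bsub>A\<^esub> x)),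
      homog = (\<lambda>s. (\<lambda>x. I +>\<^bsub>A\<^esub> x) ` homog A s)\<rparr>"


section \<open>Superalgebras given by generators and relations\<close>

text \<open>Words form a monoid under concatenation; the product on \<open>_ \<Rightarrow>\<^sub>0 _\<close> from
  \<^theory>\<open>HOL-Library.Poly_Mapping\<close> is then that of the free algebra.\<close>

instantiation list :: (type) monoid_add
begin
definition zero_list :: "'a list" where "zero_list = []"
definition plus_list :: "'a list \<Rightarrow> 'a list \<Rightarrow> 'a list" where "plus_list = (@)"
instance by standard (simp_all add: zero_list_def plus_list_def)
end

definition gen :: "'x \<Rightarrow> 'x list \<Rightarrow>\<^sub>0 'k::field" where
  "gen x = Poly_Mapping.single [x] 1"

definition const :: "'k \<Rightarrow> 'x list \<Rightarrow>\<^sub>0 'k::field" where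
  "const k = Poly_Mapping.single [] k"

text \<open>The free algebra on \<open>X\<close>, the letter \<open>x\<close> having parity \<open>p x\<close>.\<close>

definition free_superalgebra ::
    "'x set \<Rightarrow> ('x \<Rightarrow> bit) \<Rightarrow> ('k::field, 'x list \<Rightarrow>\<^sub>0 'k) superalgebra" where
  "free_superalgebra X p =
     \<lparr>carrier = {f. \<forall>w\<in>Poly_Mapping.keys f. set w \<subseteq> X},
      monoid.mult = (*), one = 1, zero = 0, add = (+),
      module.smult = (\<lambda>k f. const k * f),
      homog = (\<lambda>s. {f. \<forall>w\<in>Poly_Mapping.keys f. set w \<subseteq> X \<and> sum_list (map p w) = s})\<rparr>"

definition relation_ideal ::
    "'x set \<Rightarrow> ('x \<Rightarrow> bit) \<Rightarrow> ('x list \<Rightarrow>\<^sub>0 'k::field) set \<Rightarrow> ('x list \<Rightarrow>\<^sub>0 'k) set" where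
  "relation_ideal X p S = Idl\<^bsub>free_superalgebra X p\<^esub> S"

definition presented ::
    "'x set \<Rightarrow> ('x \<Rightarrow> bit) \<Rightarrow> ('x list \<Rightarrow>\<^sub>0 'k::field) set \<Rightarrow>
      ('k, ('x list \<Rightarrow>\<^sub>0 'k) set) superalgebra" where
  "presented X p S = superquot (free_superalgebra X p) (relation_ideal X p S)"

definition presented_class ::
    "'x set \<Rightarrow> ('x \<Rightarrow> bit) \<Rightarrow> ('x list \<Rightarrow>\<^sub>0 'k::field) set \<Rightarrow>
      ('x list \<Rightarrow>\<^sub>0 'k) \<Rightarrow> ('x list \<Rightarrow>\<^sub>0 'k) set" where
  "presented_class X p S f = relation_ideal X p S +>\<^bsub>free_superalgebra X p\<^esub> f"


section \<open>Tensor product of superalgebras\<close>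

text \<open>Let \<open>A\<close> be a superalgebra over \<open>'k\<close>, \<open>B\<close> one over \<open>'l\<close>, and \<open>j :: 'k \<Rightarrow> 'l\<close> a field embedding.
  The tensor product of \<open>A\<close> and \<open>B\<close> over \<open>'k\<close>, as an \<open>'l\<close>-superalgebra with \<open>'l\<close> acting on the
  second factor, is the free \<open>'l\<close>-vector space on \<open>carrier A \<times> carrier B\<close> modulo the relations below.
  The relation \<open>k a \<otimes> b = j k (a \<otimes> b)\<close>, together with the last one, makes the tensors balanced
  over \<open>'k\<close>.\<close>

definition lscale :: "'l::field \<Rightarrow> ('c \<Rightarrow>\<^sub>0 'l) \<Rightarrow> 'c \<Rightarrow>\<^sub>0 'l" where
  "lscale l = Poly_Mapping.map ((*) l)"

abbreviation formal_tensor :: "'a \<Rightarrow> 'b \<Rightarrow> ('a \<times> 'b) \<Rightarrow>\<^sub>0 'l::field" where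
  "formal_tensor a b \<equiv> Poly_Mapping.single (a, b) 1"

definition tensor_relations ::
    "('k::field \<Rightarrow> 'l::field) \<Rightarrow> ('k, 'a) superalgebra \<Rightarrow> ('l, 'b) superalgebra \<Rightarrow>
      (('a \<times> 'b) \<Rightarrow>\<^sub>0 'l) set" where
  "tensor_relations j A B =
     {formal_tensor (a \<oplus>\<^bsub>A\<^esub> a') b - formal_tensor a b - formal_tensor a' b |
        a a' b. a \<in> carrier A \<and> a' \<in> carrier A \<and> b \<in> carrier B} \<union>
     {formal_tensor a (b \<oplus>\<^bsub>B\<^esub> b') - formal_tensor a b - formal_tensor a b' |
        a b b'. a \<in> carrier A \<and> b \<in> carrier B \<and> b' \<in> carrier B} \<union>
     {formal_tensor (k \<odot>\<^bsub>A\<^esub> a) b - lscale (j k) (formal_tensor a b) |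
        k a b. a \<in> carrier A \<and> b \<in> carrier B} \<union>
     {formal_tensor a (l \<odot>\<^bsub>B\<^esub> b) - lscale l (formal_tensor a b) |
        l a b. a \<in> carrier A \<and> b \<in> carrier B}"

definition tensor_null ::
    "('k::field \<Rightarrow> 'l::field) \<Rightarrow> ('k, 'a) superalgebra \<Rightarrow> ('l, 'b) superalgebra \<Rightarrow>
      (('a \<times> 'b) \<Rightarrow>\<^sub>0 'l) set" where
  "tensor_null j A B = Modules.module.span lscale (tensor_relations j A B)"

definition bit_sign :: "bit \<Rightarrow> 'l::field" where
  "bit_sign s = (if s = 1 then - 1 else 1)"

text \<open>The bilinear extension of
  \<open>(a' \<otimes> b') (a \<otimes> b) = (\<Sum>s t. (-1)\<^bsup>st\<^esup> a' a\<^sub>t \<otimes> b'\<^sub>s b)\<close>, where the subscripts denote homogeneous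
  components. This product need not be associative before passing to the quotient.\<close>

definition formal_tensor_mult ::
    "('k, 'a) superalgebra \<Rightarrow> ('l, 'b) superalgebra \<Rightarrow>
      (('a \<times> 'b) \<Rightarrow>\<^sub>0 'l::field) \<Rightarrow> (('a \<times> 'b) \<Rightarrow>\<^sub>0 'l) \<Rightarrow> (('a \<times> 'b) \<Rightarrow>\<^sub>0 'l)" where
  "formal_tensor_mult A B x y =
     (\<Sum>(a', b')\<in>Poly_Mapping.keys x. \<Sum>(a, b)\<in>Poly_Mapping.keys y. \<Sum>s\<in>{0, 1}. \<Sum>t\<in>{0, 1}.
        lscale (bit_sign (s * t) * Poly_Mapping.lookup x (a', b') * Poly_Mapping.lookup y (a, b))
          (formal_tensor (a' \<otimes>\<^bsub>A\<^esub> hcomp A t a) (hcomp B s b' \<otimes>\<^bsub>B\<^esub> b)))"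

definition formal_tensors ::
    "('k, 'a) superalgebra \<Rightarrow> ('l::field, 'b) superalgebra \<Rightarrow>
      ('l, ('a \<times> 'b) \<Rightarrow>\<^sub>0 'l) superalgebra" where
  "formal_tensors A B =
     \<lparr>carrier = {f. Poly_Mapping.keys f \<subseteq> carrier A \<times> carrier B},
      monoid.mult = formal_tensor_mult A B, one = formal_tensor \<one>\<^bsub>A\<^esub> \<one>\<^bsub>B\<^esub>, zero = 0, add = (+),
      module.smult = lscale,
      homog = (\<lambda>u. {f. Poly_Mapping.keys f \<subseteq> (\<Union>s. homog A s \<times> homog B (u - s))})\<rparr>"

definition super_tensor ::
    "('k::field \<Rightarrow> 'l::field) \<Rightarrow> ('k, 'a) superalgebra \<Rightarrow> ('l, 'b) superalgebra \<Rightarrow>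
      ('l, (('a \<times> 'b) \<Rightarrow>\<^sub>0 'l) set) superalgebra" where
  "super_tensor j A B = superquot (formal_tensors A B) (tensor_null j A B)"

definition pure_tensor ::
    "('k::field \<Rightarrow> 'l::field) \<Rightarrow> ('k, 'a) superalgebra \<Rightarrow> ('l, 'b) superalgebra \<Rightarrow>
      'a \<Rightarrow> 'b \<Rightarrow> (('a \<times> 'b) \<Rightarrow>\<^sub>0 'l) set" where
  "pure_tensor j A B a b = tensor_null j A B +>\<^bsub>formal_tensors A B\<^esub> formal_tensor a b"


section \<open>The Clifford, Hecke-Clifford and spin Hecke algebras\<close>

type_synonym cq = "complex poly fract"

definition cq_of_complex :: "complex \<Rightarrow> cq" where
  "cq_of_complex z = Fract [:z:] 1"

definition q :: cq where
  "q = Fract [:0, 1:] 1"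

definition \<epsilon> :: cq where
  "\<epsilon> = q - inverse q"

definition clifford_gens :: "nat \<Rightarrow> nat set" where
  "clifford_gens n = {1..n}"

definition clifford_rels :: "nat \<Rightarrow> (nat list \<Rightarrow>\<^sub>0 complex) set" where
  "clifford_rels n =
     {gen i * gen i - 1 | i. i \<in> {1..n}} \<union>
     {gen i * gen j + gen j * gen i | i j. i \<in> {1..n} \<and> j \<in> {1..n} \<and> i \<noteq> j}"

definition clifford :: "nat \<Rightarrow> (complex, (nat list \<Rightarrow>\<^sub>0 complex) set) superalgebra" where
  "clifford n = presented (clifford_gens n) (\<lambda>_. 1) (clifford_rels n)"

definition clifford_c :: "nat \<Rightarrow> nat \<Rightarrow> (nat list \<Rightarrow>\<^sub>0 complex) set" where
  "clifford_c n i = presented_class (clifford_gens n) (\<lambda>_. 1) (clifford_rels n) (gen i)"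

datatype hc_letter = HT nat | HC nat

definition hc_gens :: "nat \<Rightarrow> hc_letter set" where
  "hc_gens n = HT ` {1..<n} \<union> HC ` {1..n}"

fun hc_parity :: "hc_letter \<Rightarrow> bit" where
  "hc_parity (HT i) = 0"
| "hc_parity (HC i) = 1"

definition hc_rels :: "nat \<Rightarrow> (hc_letter list \<Rightarrow>\<^sub>0 cq) set" where
  "hc_rels n = (let T = (\<lambda>i. gen (HT i)); c = (\<lambda>i. gen (HC i)) in
     {(T i - const q) * (T i + const (inverse q)) | i. i \<in> {1..<n}} \<union>
     {T i * T (i+1) * T i - T (i+1) * T i * T (i+1) | i. i \<in> {1..<n} \<and> i + 1 \<in> {1..<n}} \<union>
     {T i * T j - T j * T i | i j. i \<in> {1..<n} \<and> j \<in> {1..<n} \<and> \<bar>int i - int j\<bar> > 1} \<union>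
     {T i * c i - c (i+1) * T i | i. i \<in> {1..<n}} \<union>
     {T i * c j - c j * T i | i j. i \<in> {1..<n} \<and> j \<in> {1..n} \<and> j \<noteq> i \<and> j \<noteq> i + 1} \<union>
     {c i * c i - 1 | i. i \<in> {1..n}} \<union>
     {c i * c j + c j * c i | i j. i \<in> {1..n} \<and> j \<in> {1..n} \<and> i \<noteq> j})"

definition hecke_clifford :: "nat \<Rightarrow> (cq, (hc_letter list \<Rightarrow>\<^sub>0 cq) set) superalgebra" where
  "hecke_clifford n = presented (hc_gens n) hc_parity (hc_rels n)"

definition hc_class :: "nat \<Rightarrow> (hc_letter list \<Rightarrow>\<^sub>0 cq) \<Rightarrow> (hc_letter list \<Rightarrow>\<^sub>0 cq) set" where
  "hc_class n f = presented_class (hc_gens n) hc_parity (hc_rels n) f"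

definition hc_T :: "nat \<Rightarrow> nat \<Rightarrow> (hc_letter list \<Rightarrow>\<^sub>0 cq) set" where
  "hc_T n i = hc_class n (gen (HT i))"

definition hc_c :: "nat \<Rightarrow> nat \<Rightarrow> (hc_letter list \<Rightarrow>\<^sub>0 cq) set" where
  "hc_c n i = hc_class n (gen (HC i))"

text \<open>The canonical map from the Clifford algebra to the Hecke-Clifford algebra: it is induced by
  substituting \<open>HC i\<close> for the letter \<open>i\<close> and extending coefficients.\<close>

definition clifford_poly_to_hc :: "(nat list \<Rightarrow>\<^sub>0 complex) \<Rightarrow> (hc_letter list \<Rightarrow>\<^sub>0 cq)" where
  "clifford_poly_to_hc f = (\<Sum>w\<in>Poly_Mapping.keys f.
     Poly_Mapping.single (map HC w) (cq_of_complex (Poly_Mapping.lookup f w)))"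

definition clifford_to_hc ::
    "nat \<Rightarrow> (nat list \<Rightarrow>\<^sub>0 complex) set \<Rightarrow> (hc_letter list \<Rightarrow>\<^sub>0 cq) set" where
  "clifford_to_hc n x = the_elem ((\<lambda>f. hc_class n (clifford_poly_to_hc f)) ` x)"

definition spin_hecke_gens :: "nat \<Rightarrow> nat set" where
  "spin_hecke_gens n = {1..<n}"

definition spin_hecke_rels :: "nat \<Rightarrow> (nat list \<Rightarrow>\<^sub>0 cq) set" where
  "spin_hecke_rels n = (let R = gen in
     {R i * R i - const (- \<epsilon>\<^sup>2 - 2) | i. i \<in> {1..<n}} \<union>
     {R i * R j + R j * R i | i j. i \<in> {1..<n} \<and> j \<in> {1..<n} \<and> \<bar>int i - int j\<bar> > 1} \<union>
     {R i * R (i+1) * R i - R (i+1) * R i * R (i+1) - const (\<epsilon>\<^sup>2) * (R (i+1) - R i) |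
        i. i \<in> {1..<n} \<and> i + 1 \<in> {1..<n}})"

definition spin_hecke :: "nat \<Rightarrow> (cq, (nat list \<Rightarrow>\<^sub>0 cq) set) superalgebra" where
  "spin_hecke n = presented (spin_hecke_gens n) (\<lambda>_. 1) (spin_hecke_rels n)"

definition spin_hecke_R :: "nat \<Rightarrow> nat \<Rightarrow> (nat list \<Rightarrow>\<^sub>0 cq) set" where
  "spin_hecke_R n i = presented_class (spin_hecke_gens n) (\<lambda>_. 1) (spin_hecke_rels n) (gen i)"

type_synonym cliff_spin_elem =
  "(((nat list \<Rightarrow>\<^sub>0 complex) set \<times> (nat list \<Rightarrow>\<^sub>0 cq) set) \<Rightarrow>\<^sub>0 cq) set"

definition cliff_spin :: "nat \<Rightarrow> (cq, cliff_spin_elem) superalgebra" where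
  "cliff_spin n = super_tensor cq_of_complex (clifford n) (spin_hecke n)"

definition in_left :: "nat \<Rightarrow> (nat list \<Rightarrow>\<^sub>0 complex) set \<Rightarrow> cliff_spin_elem" where
  "in_left n x = pure_tensor cq_of_complex (clifford n) (spin_hecke n) x \<one>\<^bsub>spin_hecke n\<^esub>"

definition in_right :: "nat \<Rightarrow> (nat list \<Rightarrow>\<^sub>0 cq) set \<Rightarrow> cliff_spin_elem" where
  "in_right n y = pure_tensor cq_of_complex (clifford n) (spin_hecke n) \<one>\<^bsub>clifford n\<^esub> y"

definition cs_c :: "nat \<Rightarrow> nat \<Rightarrow> cliff_spin_elem" where
  "cs_c n i = in_left n (clifford_c n i)"

definition cs_R :: "nat \<Rightarrow> nat \<Rightarrow> cliff_spin_elem" where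
  "cs_R n i = in_right n (spin_hecke_R n i)"

end

theory Submission
  imports Defs
begin

text \<open>
Write \<open>c\<^sub>i\<close>, \<open>T\<^sub>i\<close> for the generators of the Hecke-Clifford algebra and \<open>c\<^sub>i\<close>,
\<open>R\<^sub>i\<close> for those of the tensor product. The two algebras are the same because, over the Clifford
algebra, a family \<open>T\<^sub>i\<close> with the Hecke relations and a family \<open>R\<^sub>i\<close> with the spin relations
determine each other. Put \<open>u\<^sub>i = c\<^sub>i - c\<^bsub>i+1\<^esub>\<close>. Then \<open>u\<^sub>i\<^sup>2 = 2\<close>, so the equation
\<open>R\<^sub>i = u\<^sub>i T\<^sub>i + \<epsilon> c\<^bsub>i+1\<^esub>\<close> can be solved for \<open>T\<^sub>i = (1/2) u\<^sub>i (R\<^sub>i - \<epsilon> c\<^bsub>i+1\<^esub>)\<close>, and if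
\<open>R\<^sub>i\<close> anticommutes with the \<open>c\<^sub>j\<close> this is the expression in the theorem. The defining relations
match one by one:

  \<^item> \<open>T\<^sub>i\<^sup>2 = \<epsilon> T\<^sub>i + 1\<close> and \<open>T\<^sub>i c\<^sub>i = c\<^bsub>i+1\<^esub> T\<^sub>i\<close> together say that
    \<open>R\<^sub>i\<^sup>2 = -\<epsilon>\<^sup>2 - 2\<close> and that \<open>R\<^sub>i\<close> anticommutes with \<open>c\<^sub>i\<close> and \<open>c\<^bsub>i+1\<^esub>\<close>
    (lemmas \<open>spin_of_Hecke\<close> and \<open>Hecke_of_spin\<close>);
  \<^item> commutation of \<open>T\<^sub>i\<close> with distant generators becomes anticommutation of \<open>R\<^sub>i\<close>, since
    \<open>u\<^sub>i\<close> is odd;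
  \<^item> up to powers of \<open>2\<close>, the defects of the two braid relations differ by the factor
    \<open>c\<^sub>i - c\<^bsub>i+2\<^esub>\<close>, whose square is \<open>2\<close>, so one vanishes iff the other does (lemma
    \<open>braid_defect\<close>). The computation is short in the shifted elements
    \<open>S\<^sub>i = R\<^sub>i - \<epsilon> c\<^bsub>i+1\<^esub> = u\<^sub>i T\<^sub>i\<close>.

These are statements about elements of an arbitrary superalgebra. They yield the maps \<open>\<Phi>\<close> and
\<open>\<Psi>\<close> through universal properties: of superalgebras given by generators and relations
(\<open>presented_hom_exists\<close>) and of tensor products, whose homomorphisms are pairs of homomorphisms
with supercommuting images (\<open>super_tensor_hom_exists\<close>). Both composites fix the generators, hence
are the identity.

Both kinds of algebra are quotients of a graded vector space with a bilinear product by a subspace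
\<open>N\<close>; for formal tensors the product is associative and unital only modulo \<open>N\<close>. The locale
\<open>superalgebra_modulo\<close> treats the two cases together.
\<close>

section \<open>Vector spaces and superalgebras\<close>

text \<open>The simplifier would otherwise turn sums and products of parities into bit operations, on
  which the grading axioms do not match.\<close>

declare add_bit_eq_xor [simp del] mult_bit_eq_and [simp del]

lemma scalar_ring_simps [simp]:
  "carrier scalar_ring = UNIV" "x \<otimes>\<^bsub>scalar_ring\<^esub> y = x * y" "\<one>\<^bsub>scalar_ring\<^esub> = 1"
  "\<zero>\<^bsub>scalar_ring\<^esub> = 0" "x \<oplus>\<^bsub>scalar_ring\<^esub> y = x + y"
  by (simp_all add: scalar_ring_def)

lemma cring_scalar_ring: "cring (scalar_ring :: 'k::field ring)"
proof (rule cringI)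
  show "abelian_group (scalar_ring :: 'k ring)"
    by (rule abelian_groupI) (auto simp: algebra_simps intro: exI[of _ "- x" for x])
  show "comm_monoid (scalar_ring :: 'k ring)"
    by (rule comm_monoidI) (auto simp: algebra_simps)
qed (simp add: algebra_simps)

lemma scalar_ring_uminus [simp]: "\<ominus>\<^bsub>scalar_ring\<^esub> (k :: 'k::field) = - k"
proof -
  interpret cring "scalar_ring :: 'k ring" by (rule cring_scalar_ring)
  show ?thesis by (rule minus_equality) simp_all
qed

text \<open>The lemmas of this locale restate the module axioms with the operations of the field
itself in place of those of \<^const>\<open>scalar_ring\<close>.\<close>

locale vspace = Module.module "scalar_ring :: 'k::field ring" M
  for M :: "('k::field, 'a, 'm) module_scheme" (structure)

lemma vspaceI:
  fixes M :: "('k::field, 'a, 'm) module_scheme" (structure)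
  assumes "abelian_group M"
    and "\<And>k x. x \<in> carrier M \<Longrightarrow> k \<odot> x \<in> carrier M"
    and "\<And>k l x. x \<in> carrier M \<Longrightarrow> (k + l) \<odot> x = k \<odot> x \<oplus> l \<odot> x"
    and "\<And>k x y. \<lbrakk>x \<in> carrier M; y \<in> carrier M\<rbrakk> \<Longrightarrow> k \<odot> (x \<oplus> y) = k \<odot> x \<oplus> k \<odot> y"
    and "\<And>k l x. x \<in> carrier M \<Longrightarrow> (k * l) \<odot> x = k \<odot> (l \<odot> x)"
    and "\<And>x. x \<in> carrier M \<Longrightarrow> 1 \<odot> x = x"
  shows "vspace M"
  unfolding vspace_def by (rule Module.moduleI) (use assms cring_scalar_ring in simp_all)

context vspace
begin

lemma scale_closed [simp, intro]: "x \<in> carrier M \<Longrightarrow> k \<odot> x \<in> carrier M"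
  by simp

lemma scale_left_add: "x \<in> carrier M \<Longrightarrow> (k + l) \<odot> x = k \<odot> x \<oplus> l \<odot> x"
  using smult_l_distr[of k l x] by simp

lemma scale_right_add:
  "\<lbrakk>x \<in> carrier M; y \<in> carrier M\<rbrakk> \<Longrightarrow> k \<odot> (x \<oplus> y) = k \<odot> x \<oplus> k \<odot> y"
  using smult_r_distr[of k x y] by simp

lemma scale_scale [simp]: "x \<in> carrier M \<Longrightarrow> k \<odot> (l \<odot> x) = (k * l) \<odot> x"
  using smult_assoc1[of k l x] by simp

lemma scale_one [simp]: "x \<in> carrier M \<Longrightarrow> 1 \<odot> x = x"
  using smult_one[of x] by simp

lemma scale_zero_left [simp]: "x \<in> carrier M \<Longrightarrow> 0 \<odot> x = \<zero>"
  using smult_l_null[of x] by simp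

lemma scale_zero_right [simp]: "k \<odot> \<zero> = \<zero>"
  using smult_r_null[of k] by simp

lemma scale_minus_left [simp]: "x \<in> carrier M \<Longrightarrow> (- k) \<odot> x = \<ominus> (k \<odot> x)"
  using smult_l_minus[of k x] by simp

lemma scale_minus_right [simp]: "x \<in> carrier M \<Longrightarrow> k \<odot> (\<ominus> x) = \<ominus> (k \<odot> x)"
  using smult_r_minus[of k x] by simp

end

sublocale superalgebra \<subseteq> vsp: vspace A
  by (simp add: vspace_def module)

lemma (in superalgebra) homog_in_carrier [simp]: "x \<in> homog A s \<Longrightarrow> x \<in> carrier A"
  using homog_carrier by auto

lemma (in superalgebra) scale_one_mult: "x \<in> carrier A \<Longrightarrow> (k \<odot> \<one>) \<otimes> x = k \<odot> x"
  by (simp add: smult_mult_left)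

lemma (in superalgebra) scale_one_central:
  "x \<in> carrier A \<Longrightarrow> x \<otimes> (k \<odot> \<one>) = (k \<odot> \<one>) \<otimes> x"
  by (simp add: smult_mult_left smult_mult_right)

lemma (in superalgebra) homog_uminus: "x \<in> homog A s \<Longrightarrow> \<ominus> x \<in> homog A s"
  using homog_smult[of x s "-1"] by simp

lemma (in superalgebra) homog_minus:
  "\<lbrakk>x \<in> homog A s; y \<in> homog A s\<rbrakk> \<Longrightarrow> x \<ominus> y \<in> homog A s"
  by (simp add: a_minus_def homog_add homog_uminus)

lemma bit_add_self_cancel [simp]: "(s::bit) + (s + t) = t"
  by (cases s; cases t) simp_all

lemma bit_sign_simps [simp]: "bit_sign 0 = 1" "bit_sign 1 = - 1"
  by (simp_all add: bit_sign_def)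

lemma bit_sign_add: "bit_sign (s + t) = bit_sign s * (bit_sign t :: 'l::field)"
  by (cases s; cases t) simp_all

context superalgebra
begin

lemma hcomp_unique:
  assumes "y \<in> homog A s" "z \<in> homog A (s + 1)"
  shows "hcomp A s (y \<oplus> z) = y"
  unfolding hcomp_def
proof (rule the_equality)
  show "y \<in> homog A s \<and> (\<exists>z'\<in>homog A (s + 1). y \<oplus> z = y \<oplus> z')"
    using assms by blast
next
  fix y' assume "y' \<in> homog A s \<and> (\<exists>z'\<in>homog A (s + 1). y \<oplus> z = y' \<oplus> z')"
  then obtain z' where *: "y' \<in> homog A s" "z' \<in> homog A (s + 1)" "y \<oplus> z = y' \<oplus> z'" by auto
  from homog_direct_sum[of "y \<oplus> z"] assms
  have ex1: "\<exists>!(x0, x1). x0 \<in> homog A 0 \<and> x1 \<in> homog A 1 \<and> y \<oplus> z = x0 \<oplus> x1" by auto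
  consider "s = 0" | "s = 1" by (cases s) auto
  then show "y' = y"
  proof cases
    case 1
    from ex1 have "(y', z') = (y, z)"
      by (rule ex1E[where P = "\<lambda>(x0, x1). x0 \<in> homog A 0 \<and> x1 \<in> homog A 1 \<and> y \<oplus> z = x0 \<oplus> x1"])
        (use assms * 1 in \<open>auto dest!: spec\<close>)
    then show ?thesis by simp
  next
    case 2
    have "y \<oplus> z = z \<oplus> y" "y \<oplus> z = z' \<oplus> y'"
      using assms * by (auto simp: a_comm)
    with ex1 have "(z', y') = (z, y)"
      by (elim ex1E[where P = "\<lambda>(x0, x1). x0 \<in> homog A 0 \<and> x1 \<in> homog A 1 \<and> y \<oplus> z = x0 \<oplus> x1"])
        (use assms * 2 in \<open>auto dest!: spec\<close>)
    then show ?thesis by simp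
  qed
qed

lemma hcomp_decomp:
  assumes "x \<in> carrier A"
  shows "hcomp A s x \<in> homog A s" "x = hcomp A s x \<oplus> hcomp A (s + 1) x"
proof -
  from homog_direct_sum[OF assms] obtain x0 x1
    where x: "x0 \<in> homog A 0" "x1 \<in> homog A 1" "x = x0 \<oplus> x1" by auto
  then have "hcomp A 0 x = x0" "hcomp A 1 x = x1"
    using hcomp_unique[of x0 0 x1] hcomp_unique[of x1 1 x0] by (auto simp: a_comm)
  then show "hcomp A s x \<in> homog A s" "x = hcomp A s x \<oplus> hcomp A (s + 1) x"
    using x by (cases s; simp add: a_comm)+
qed

lemma hcomp_closed [simp]: "x \<in> carrier A \<Longrightarrow> hcomp A s x \<in> carrier A"
  by (rule homog_in_carrier, erule hcomp_decomp(1))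

lemma hcomp_homog:
  assumes "x \<in> homog A t"
  shows "hcomp A s x = (if s = t then x else \<zero>)"
proof (cases "s = t")
  case True
  then show ?thesis using hcomp_unique[of x s \<zero>] assms homog_zero by simp
next
  case False
  then have "t = s + 1" by (cases s; cases t) auto
  then show ?thesis using hcomp_unique[of \<zero> s x] assms homog_zero False by simp
qed

lemma hcomp_add:
  assumes "x \<in> carrier A" "y \<in> carrier A"
  shows "hcomp A s (x \<oplus> y) = hcomp A s x \<oplus> hcomp A s y"
proof -
  have "x \<oplus> y = (hcomp A s x \<oplus> hcomp A (s+1) x) \<oplus> (hcomp A s y \<oplus> hcomp A (s+1) y)"
    using hcomp_decomp(2)[of x s] hcomp_decomp(2)[of y s] assms by simp
  also have "\<dots> = (hcomp A s x \<oplus> hcomp A s y) \<oplus> (hcomp A (s+1) x \<oplus> hcomp A (s+1) y)"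
    using assms by (simp add: a_ac)
  finally show ?thesis
    using hcomp_unique[of "hcomp A s x \<oplus> hcomp A s y" s "hcomp A (s+1) x \<oplus> hcomp A (s+1) y"]
      hcomp_decomp(1) assms homog_add by simp
qed

lemma hcomp_scale:
  assumes "x \<in> carrier A"
  shows "hcomp A s (k \<odot> x) = k \<odot> hcomp A s x"
proof -
  have "k \<odot> x = k \<odot> hcomp A s x \<oplus> k \<odot> hcomp A (s+1) x"
    using hcomp_decomp(2)[of x s] assms vsp.scale_right_add by (metis hcomp_closed)
  then show ?thesis
    using hcomp_unique[of "k \<odot> hcomp A s x" s "k \<odot> hcomp A (s+1) x"]
      hcomp_decomp(1) assms homog_smult by simp
qed

end

definition superalgebra_hom ::
    "('k::field, 'a) superalgebra \<Rightarrow> ('k, 'b) superalgebra \<Rightarrow> ('a \<Rightarrow> 'b) \<Rightarrow> bool" where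
  "superalgebra_hom A B h \<longleftrightarrow>
     superalgebra A \<and> superalgebra B \<and> h \<in> ring_hom A B \<and>
     (\<forall>k. \<forall>x\<in>carrier A. h (k \<odot>\<^bsub>A\<^esub> x) = k \<odot>\<^bsub>B\<^esub> h x) \<and>
     (\<forall>s. h ` homog A s \<subseteq> homog B s)"

locale superalgebra_homomorphism =
  A: superalgebra A + B: superalgebra B
  for A :: "('k::field, 'a) superalgebra" and B :: "('k, 'b) superalgebra" and h +
  assumes hom: "superalgebra_hom A B h"
begin

lemma closed [simp]: "x \<in> carrier A \<Longrightarrow> h x \<in> carrier B"
  using hom by (auto simp: superalgebra_hom_def ring_hom_def)

lemma mult: "\<lbrakk>x \<in> carrier A; y \<in> carrier A\<rbrakk> \<Longrightarrow> h (x \<otimes>\<^bsub>A\<^esub> y) = h x \<otimes>\<^bsub>B\<^esub> h y"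
  using hom by (auto simp: superalgebra_hom_def ring_hom_def)

lemma add: "\<lbrakk>x \<in> carrier A; y \<in> carrier A\<rbrakk> \<Longrightarrow> h (x \<oplus>\<^bsub>A\<^esub> y) = h x \<oplus>\<^bsub>B\<^esub> h y"
  using hom by (auto simp: superalgebra_hom_def ring_hom_def)

lemma one: "h \<one>\<^bsub>A\<^esub> = \<one>\<^bsub>B\<^esub>"
  using hom by (auto simp: superalgebra_hom_def ring_hom_def)

lemma scale: "x \<in> carrier A \<Longrightarrow> h (k \<odot>\<^bsub>A\<^esub> x) = k \<odot>\<^bsub>B\<^esub> h x"
  using hom by (auto simp: superalgebra_hom_def)

lemma homog: "x \<in> homog A s \<Longrightarrow> h x \<in> homog B s"
  using hom unfolding superalgebra_hom_def by blast

lemma zero: "h \<zero>\<^bsub>A\<^esub> = \<zero>\<^bsub>B\<^esub>"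
  using scale[of "\<zero>\<^bsub>A\<^esub>" 0] by simp

lemma uminus: "x \<in> carrier A \<Longrightarrow> h (\<ominus>\<^bsub>A\<^esub> x) = \<ominus>\<^bsub>B\<^esub> h x"
  using scale[of x "-1"] by simp

lemma minus: "\<lbrakk>x \<in> carrier A; y \<in> carrier A\<rbrakk> \<Longrightarrow> h (x \<ominus>\<^bsub>A\<^esub> y) = h x \<ominus>\<^bsub>B\<^esub> h y"
  by (simp add: a_minus_def add uminus)

end

lemma superalgebra_homI:
  fixes A :: "('k::field, 'a) superalgebra" and B :: "('k, 'b) superalgebra"
  assumes "superalgebra A" "superalgebra B"
    and "\<And>x. x \<in> carrier A \<Longrightarrow> h x \<in> carrier B"
    and "\<And>x y. \<lbrakk>x \<in> carrier A; y \<in> carrier A\<rbrakk> \<Longrightarrow> h (x \<otimes>\<^bsub>A\<^esub> y) = h x \<otimes>\<^bsub>B\<^esub> h y"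
    and "\<And>x y. \<lbrakk>x \<in> carrier A; y \<in> carrier A\<rbrakk> \<Longrightarrow> h (x \<oplus>\<^bsub>A\<^esub> y) = h x \<oplus>\<^bsub>B\<^esub> h y"
    and "h \<one>\<^bsub>A\<^esub> = \<one>\<^bsub>B\<^esub>"
    and "\<And>k x. x \<in> carrier A \<Longrightarrow> h (k \<odot>\<^bsub>A\<^esub> x) = k \<odot>\<^bsub>B\<^esub> h x"
    and "\<And>s x. x \<in> homog A s \<Longrightarrow> h x \<in> homog B s"
  shows "superalgebra_hom A B h"
  using assms by (auto simp: superalgebra_hom_def ring_hom_def)

lemma superalgebra_homomorphismI [intro]:
  "superalgebra_hom A B h \<Longrightarrow> superalgebra_homomorphism A B h"
  by (simp add: superalgebra_homomorphism_def superalgebra_homomorphism_axioms_def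
      superalgebra_hom_def)

lemma superalgebra_hom_comp:
  assumes "superalgebra_hom A B f" "superalgebra_hom B C g"
  shows "superalgebra_hom A C (\<lambda>x. g (f x))"
proof -
  interpret f: superalgebra_homomorphism A B f using assms by auto
  interpret g: superalgebra_homomorphism B C g using assms by auto
  show ?thesis
    by (rule superalgebra_homI)
      (simp_all add: f.A.superalgebra_axioms g.B.superalgebra_axioms f.mult g.mult f.add g.add f.one g.one
        f.scale g.scale f.homog g.homog)
qed

lemma superalgebra_hom_id: "superalgebra A \<Longrightarrow> superalgebra_hom A A (\<lambda>x. x)"
  by (rule superalgebra_homI) (simp_all add: superalgebra_def)

lemma superalgebra_isoI:
  assumes h: "superalgebra_hom A B h" and g: "superalgebra_hom B A g"
    and "\<And>x. x \<in> carrier A \<Longrightarrow> g (h x) = x" "\<And>y. y \<in> carrier B \<Longrightarrow> h (g y) = y"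
  shows "superalgebra_iso A B h"
proof -
  interpret h: superalgebra_homomorphism A B h using h by auto
  interpret g: superalgebra_homomorphism B A g using g by auto
  have "bij_betw h (carrier A) (carrier B)"
    by (rule bij_betw_byWitness[where f' = g]) (use assms in auto)
  then show ?thesis using h by (simp add: superalgebra_iso_def superalgebra_hom_def)
qed

subsection \<open>Restriction of scalars\<close>

text \<open>The Clifford algebra has complex scalars, the algebras that it maps to have scalars in
\<open>\<complex>(q)\<close>. Homomorphisms out of it are homomorphisms into the target with scalars restricted to
the complex numbers.\<close>

definition restrict_scalars ::
    "('k::field \<Rightarrow> 'l::field) \<Rightarrow> ('l, 'a) superalgebra \<Rightarrow> ('k, 'a) superalgebra" where
  "restrict_scalars j A =
     \<lparr>carrier = carrier A, monoid.mult = monoid.mult A, one = one A, zero = zero A, add = add A,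
      module.smult = (\<lambda>k x. j k \<odot>\<^bsub>A\<^esub> x), homog = homog A\<rparr>"

lemma restrict_scalars_simps [simp]:
  "carrier (restrict_scalars j A) = carrier A" "x \<otimes>\<^bsub>restrict_scalars j A\<^esub> y = x \<otimes>\<^bsub>A\<^esub> y"
  "\<one>\<^bsub>restrict_scalars j A\<^esub> = \<one>\<^bsub>A\<^esub>" "\<zero>\<^bsub>restrict_scalars j A\<^esub> = \<zero>\<^bsub>A\<^esub>"
  "x \<oplus>\<^bsub>restrict_scalars j A\<^esub> y = x \<oplus>\<^bsub>A\<^esub> y" "k \<odot>\<^bsub>restrict_scalars j A\<^esub> x = j k \<odot>\<^bsub>A\<^esub> x"
  "homog (restrict_scalars j A) = homog A"
  by (simp_all add: restrict_scalars_def)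

definition field_embedding :: "('k::field \<Rightarrow> 'l::field) \<Rightarrow> bool" where
  "field_embedding j \<longleftrightarrow> j 1 = 1 \<and> (\<forall>x y. j (x + y) = j x + j y) \<and> (\<forall>x y. j (x * y) = j x * j y)"

lemma ring_cong_record:
  assumes "ring A" "carrier B = carrier A" "monoid.mult B = monoid.mult A" "one B = one A"
    "zero B = zero A" "add B = add A"
  shows "ring B"
proof -
  interpret ring A by fact
  show ?thesis
    by (rule ringI; (rule abelian_groupI monoidI)?)
      (use assms in \<open>auto simp: a_ac m_assoc l_distr r_distr intro: bexI[of _ "\<ominus>\<^bsub>A\<^esub> x" for x]\<close>)
qed

lemma superalgebra_restrict_scalars:
  assumes "superalgebra A" and j: "field_embedding j"
  shows "superalgebra (restrict_scalars j A)"
proof -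
  interpret superalgebra A by fact
  have ring: "ring (restrict_scalars j A)"
    by (rule ring_cong_record[of A]) (simp_all add: restrict_scalars_def ring_axioms)
  interpret r: ring "restrict_scalars j A" by fact
  have "vspace (restrict_scalars j A)"
    by (rule vspaceI)
      (use j in \<open>auto simp: field_embedding_def r.abelian_group_axioms vsp.scale_left_add vsp.scale_right_add\<close>)
  then show ?thesis
    by (intro superalgebra.intro superalgebra_axioms.intro ring)
      (simp_all add: vspace_def smult_mult_left smult_mult_right homog_zero homog_add
        homog_smult homog_one homog_mult homog_direct_sum homog_carrier)
qed

section \<open>Quotients of superalgebras\<close>

text \<open>A graded vector space \<open>F\<close> with a bilinear product that satisfies the axioms of a
superalgebra up to a subspace \<open>N\<close>. Elements of \<open>F\<close> live in a type with an abelian group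
structure, so that all congruences can be written \<open>x - y \<in> N\<close>.\<close>

locale superalgebra_modulo =
  fixes F :: "('k::field, 'v::ab_group_add) superalgebra" (structure) and N :: "'v set"
  assumes add_eq [simp]: "x \<oplus> y = x + y"
    and zero_eq [simp]: "\<zero> = 0"
    and vspace: "vspace F"
    and N_carrier: "x \<in> N \<Longrightarrow> x \<in> carrier F"
    and N_zero: "0 \<in> N"
    and N_add: "\<lbrakk>x \<in> N; y \<in> N\<rbrakk> \<Longrightarrow> x + y \<in> N"
    and N_scale: "x \<in> N \<Longrightarrow> k \<odot> x \<in> N"
    and one_closed: "\<one> \<in> carrier F"
    and mult_closed: "\<lbrakk>x \<in> carrier F; y \<in> carrier F\<rbrakk> \<Longrightarrow> x \<otimes> y \<in> carrier F"
    and mult_add_left: "\<lbrakk>x \<in> carrier F; y \<in> carrier F; z \<in> carrier F\<rbrakk> \<Longrightarrow> (x + y) \<otimes> z = x \<otimes> z + y \<otimes> z"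
    and mult_add_right: "\<lbrakk>x \<in> carrier F; y \<in> carrier F; z \<in> carrier F\<rbrakk> \<Longrightarrow> z \<otimes> (x + y) = z \<otimes> x + z \<otimes> y"
    and mult_scale_left: "\<lbrakk>x \<in> carrier F; y \<in> carrier F\<rbrakk> \<Longrightarrow> (k \<odot> x) \<otimes> y = k \<odot> (x \<otimes> y)"
    and mult_scale_right: "\<lbrakk>x \<in> carrier F; y \<in> carrier F\<rbrakk> \<Longrightarrow> x \<otimes> (k \<odot> y) = k \<odot> (x \<otimes> y)"
    and N_mult_left: "\<lbrakk>x \<in> carrier F; y \<in> N\<rbrakk> \<Longrightarrow> x \<otimes> y \<in> N"
    and N_mult_right: "\<lbrakk>x \<in> carrier F; y \<in> N\<rbrakk> \<Longrightarrow> y \<otimes> x \<in> N"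
    and mult_assoc_mod: "\<lbrakk>x \<in> carrier F; y \<in> carrier F; z \<in> carrier F\<rbrakk> \<Longrightarrow> (x \<otimes> y) \<otimes> z - x \<otimes> (y \<otimes> z) \<in> N"
    and one_mult_mod: "x \<in> carrier F \<Longrightarrow> \<one> \<otimes> x - x \<in> N"
    and mult_one_mod: "x \<in> carrier F \<Longrightarrow> x \<otimes> \<one> - x \<in> N"
    and homog_closed: "x \<in> homog F s \<Longrightarrow> x \<in> carrier F"
    and homog_zero: "0 \<in> homog F s"
    and homog_add: "\<lbrakk>x \<in> homog F s; y \<in> homog F s\<rbrakk> \<Longrightarrow> x + y \<in> homog F s"
    and homog_scale: "x \<in> homog F s \<Longrightarrow> k \<odot> x \<in> homog F s"
    and homog_one: "\<one> \<in> homog F 0"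
    and homog_mult_mod: "\<lbrakk>x \<in> homog F s; y \<in> homog F t\<rbrakk> \<Longrightarrow> \<exists>z\<in>homog F (s + t). x \<otimes> y - z \<in> N"
    and homog_decomp_mod: "x \<in> carrier F \<Longrightarrow> \<exists>x0\<in>homog F 0. \<exists>x1\<in>homog F 1. x - (x0 + x1) \<in> N"
    and homog_indep_mod: "\<lbrakk>x0 \<in> homog F 0; x1 \<in> homog F 1; x0 + x1 \<in> N\<rbrakk> \<Longrightarrow> x0 \<in> N"
begin

interpretation v: vspace F by (rule vspace)

lemma add_closed: "\<lbrakk>x \<in> carrier F; y \<in> carrier F\<rbrakk> \<Longrightarrow> x + y \<in> carrier F"
  using v.M.a_closed[of x y] by simp

lemma zero_closed: "0 \<in> carrier F"
  using v.M.zero_closed by simp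

lemma a_inv_eq: "x \<in> carrier F \<Longrightarrow> \<ominus> x = - x"
  using v.M.l_neg[of x] by (simp add: eq_neg_iff_add_eq_0)

lemma uminus_eq_scale: "x \<in> carrier F \<Longrightarrow> - x = (- 1) \<odot> x"
  by (simp add: a_inv_eq)

lemma uminus_closed: "x \<in> carrier F \<Longrightarrow> - x \<in> carrier F"
  using v.M.a_inv_closed[of x] by (simp add: a_inv_eq)

lemma minus_closed: "\<lbrakk>x \<in> carrier F; y \<in> carrier F\<rbrakk> \<Longrightarrow> x - y \<in> carrier F"
  using add_closed uminus_closed by (metis add_uminus_conv_diff)

lemma N_uminus: "x \<in> N \<Longrightarrow> - x \<in> N"
  using N_scale[of x "- 1"] uminus_eq_scale N_carrier by metis

lemma N_minus: "\<lbrakk>x \<in> N; y \<in> N\<rbrakk> \<Longrightarrow> x - y \<in> N"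
  using N_add N_uminus by (metis add_uminus_conv_diff)

lemma homog_minus: "\<lbrakk>x \<in> homog F s; y \<in> homog F s\<rbrakk> \<Longrightarrow> x - y \<in> homog F s"
  using homog_add homog_scale[of y s "- 1"] uminus_eq_scale homog_closed
  by (metis add_uminus_conv_diff)

lemma mult_minus_left: "\<lbrakk>x \<in> carrier F; y \<in> carrier F; z \<in> carrier F\<rbrakk> \<Longrightarrow> (x - y) \<otimes> z = x \<otimes> z - y \<otimes> z"
  using mult_add_left[of "x - y" y z] minus_closed by (simp add: algebra_simps)

lemma mult_minus_right: "\<lbrakk>x \<in> carrier F; y \<in> carrier F; z \<in> carrier F\<rbrakk> \<Longrightarrow> z \<otimes> (x - y) = z \<otimes> x - z \<otimes> y"
  using mult_add_right[of "x - y" y z] minus_closed by (simp add: algebra_simps)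

lemma scale_minus: "\<lbrakk>x \<in> carrier F; y \<in> carrier F\<rbrakk> \<Longrightarrow> k \<odot> (x - y) = k \<odot> x - k \<odot> y"
  using v.scale_right_add[of "x - y" y k] minus_closed by (simp add: algebra_simps)

definition cls :: "'v \<Rightarrow> 'v set" where "cls x = N +> x"

lemma mem_cls: "y \<in> cls x \<longleftrightarrow> y - x \<in> N"
  by (auto simp: cls_def a_r_coset_def' intro: bexI[of _ "y - x"])

lemma cls_eq: "cls x = cls y \<longleftrightarrow> x - y \<in> N"
proof
  assume "cls x = cls y"
  moreover have "x \<in> cls x" by (simp add: mem_cls N_zero)
  ultimately show "x - y \<in> N" by (simp add: mem_cls)
next
  assume xy: "x - y \<in> N"
  have "z - x \<in> N \<longleftrightarrow> z - y \<in> N" for z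
    using N_add[OF _ xy, of "z - x"] N_minus[OF _ xy, of "z - y"] by auto
  then show "cls x = cls y" by (auto simp: mem_cls)
qed

lemma cls_self: "x \<in> cls x"
  by (simp add: mem_cls N_zero)

lemma cls_mem_carrier: "\<lbrakk>y \<in> cls x; x \<in> carrier F\<rbrakk> \<Longrightarrow> y \<in> carrier F"
  using add_closed[of "y - x" x] N_carrier by (auto simp: mem_cls)

lemma UN_cls_const: "X \<noteq> {} \<Longrightarrow> (\<And>x. x \<in> X \<Longrightarrow> f x = c) \<Longrightarrow> (\<Union>x\<in>X. f x) = c"
  by auto

abbreviation Q where "Q \<equiv> superquot F N"

lemma Q_carrier: "carrier Q = cls ` carrier F"
  by (auto simp: superquot_def ring.extend_def ring.defs FactRing_def A_RCOSETS_def' cls_def)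

lemma Q_zero: "\<zero>\<^bsub>Q\<^esub> = cls 0"
  using mem_cls[of _ 0] by (auto simp: superquot_def ring.extend_def ring.defs FactRing_def)

lemma Q_one: "\<one>\<^bsub>Q\<^esub> = cls \<one>"
  by (simp add: superquot_def ring.extend_def ring.defs FactRing_def cls_def)

lemma Q_add: "cls x \<oplus>\<^bsub>Q\<^esub> cls y = cls (x + y)"
proof -
  have "cls x \<oplus>\<^bsub>Q\<^esub> cls y = (\<Union>h\<in>cls x. \<Union>k\<in>cls y. {h + k})"
    by (simp add: superquot_def ring.extend_def ring.defs FactRing_def set_add_def')
  also have "\<dots> = cls (x + y)"
  proof (rule equalityI; rule subsetI)
    fix z assume "z \<in> (\<Union>h\<in>cls x. \<Union>k\<in>cls y. {h + k})"
    then obtain h k where "h - x \<in> N" "k - y \<in> N" "z = h + k" by (auto simp: mem_cls)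
    then show "z \<in> cls (x + y)"
      using N_add[of "h - x" "k - y"] by (simp add: mem_cls algebra_simps)
  next
    fix z assume "z \<in> cls (x + y)"
    then have "z - y \<in> cls x" "y \<in> cls y" "z = (z - y) + y"
      by (auto simp: mem_cls algebra_simps N_zero)
    then show "z \<in> (\<Union>h\<in>cls x. \<Union>k\<in>cls y. {h + k})" by blast
  qed
  finally show ?thesis .
qed

lemma Q_mult:
  assumes "x \<in> carrier F" "y \<in> carrier F"
  shows "cls x \<otimes>\<^bsub>Q\<^esub> cls y = cls (x \<otimes> y)"
proof -
  have "cls x \<otimes>\<^bsub>Q\<^esub> cls y = (\<Union>a\<in>cls x. \<Union>b\<in>cls y. cls (a \<otimes> b))"
    by (simp add: superquot_def ring.extend_def ring.defs FactRing_def rcoset_mult_def cls_def)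
  also have "\<dots> = cls (x \<otimes> y)"
  proof (intro UN_cls_const)
    fix a b assume ab: "a \<in> cls x" "b \<in> cls y"
    then have c: "a \<in> carrier F" "b \<in> carrier F" using assms cls_mem_carrier by auto
    have "(a - x) \<otimes> b \<in> N" "x \<otimes> (b - y) \<in> N"
      using ab c assms by (auto simp: mem_cls intro: N_mult_left N_mult_right)
    from N_add[OF this] show "cls (a \<otimes> b) = cls (x \<otimes> y)"
      using c assms by (simp add: cls_eq mult_minus_left mult_minus_right)
  qed (use cls_self in auto)
  finally show ?thesis .
qed

lemma Q_scale:
  assumes "x \<in> carrier F"
  shows "k \<odot>\<^bsub>Q\<^esub> cls x = cls (k \<odot> x)"
proof -
  have "k \<odot>\<^bsub>Q\<^esub> cls x = (\<Union>a\<in>cls x. cls (k \<odot> a))"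
    by (simp add: superquot_def ring.extend_def ring.defs cls_def)
  also have "\<dots> = cls (k \<odot> x)"
  proof (rule UN_cls_const)
    fix a assume a: "a \<in> cls x"
    then have "k \<odot> (a - x) \<in> N" by (simp add: mem_cls N_scale)
    then show "cls (k \<odot> a) = cls (k \<odot> x)"
      using a assms cls_mem_carrier by (simp add: cls_eq scale_minus)
  qed (use cls_self in auto)
  finally show ?thesis .
qed

lemma Q_homog: "homog Q s = cls ` homog F s"
  by (simp add: superquot_def ring.extend_def ring.defs cls_def)

lemmas Q_simps = Q_carrier Q_zero Q_one Q_add Q_mult Q_scale Q_homog

text \<open>The sum of the two components of the quotient is direct because \<open>N\<close> contains the components of
its elements: two decompositions of \<open>x\<close> differ by a pair whose sum lies in \<open>N\<close>.\<close>

lemma superalgebra_superquot: "superalgebra Q"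
proof -
  have cls_mult_assoc: "cls ((x \<otimes> y) \<otimes> z) = cls (x \<otimes> (y \<otimes> z))"
    if "x \<in> carrier F" "y \<in> carrier F" "z \<in> carrier F" for x y z
    using that by (simp add: cls_eq mult_assoc_mod)
  have cls_one_mult: "cls (\<one> \<otimes> x) = cls x" and cls_mult_one: "cls (x \<otimes> \<one>) = cls x"
    if "x \<in> carrier F" for x
    using that by (simp_all add: cls_eq one_mult_mod mult_one_mod)
  have ab: "abelian_group Q"
  proof (rule abelian_groupI)
    fix X assume "X \<in> carrier Q"
    then obtain x where "X = cls x" "x \<in> carrier F" by (auto simp: Q_carrier)
    then have "cls (- x) \<oplus>\<^bsub>Q\<^esub> X = \<zero>\<^bsub>Q\<^esub>" "cls (- x) \<in> carrier Q"
      using uminus_closed by (simp_all add: Q_add Q_zero Q_carrier)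
    then show "\<exists>Y\<in>carrier Q. Y \<oplus>\<^bsub>Q\<^esub> X = \<zero>\<^bsub>Q\<^esub>"
      by (rule rev_bexI[rotated])
  qed (auto simp: Q_simps add_closed zero_closed algebra_simps)
  have ring: "ring Q"
  proof (rule ringI[OF ab])
    show "Group.monoid Q"
      by (rule monoidI)
        (auto simp: Q_simps mult_closed one_closed cls_mult_assoc cls_one_mult cls_mult_one)
  qed (auto simp: Q_simps add_closed mult_closed mult_add_left mult_add_right)
  have vs: "vspace Q"
    by (rule vspaceI[OF ab])
      (auto simp: Q_simps add_closed v.scale_left_add[simplified] v.scale_right_add[simplified])
  have homog_mult: "X \<otimes>\<^bsub>Q\<^esub> Y \<in> homog Q (s + t)" if "X \<in> homog Q s" "Y \<in> homog Q t" for X Y s t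
  proof -
    from that obtain x y where xy: "x \<in> homog F s" "X = cls x" "y \<in> homog F t" "Y = cls y"
      by (auto simp: Q_homog)
    obtain z where "z \<in> homog F (s + t)" "cls (x \<otimes> y) = cls z"
      using homog_mult_mod[OF xy(1,3)] by (auto simp: cls_eq)
    then show ?thesis using xy by (auto simp: Q_mult Q_homog homog_closed)
  qed
  show ?thesis
  proof (intro superalgebra.intro superalgebra_axioms.intro ring)
    show "X \<otimes>\<^bsub>Q\<^esub> Y \<in> homog Q (s + t)" if "X \<in> homog Q s" "Y \<in> homog Q t" for X Y s t
      using homog_mult[OF that] .
    show "Module.module scalar_ring Q" using vs by (simp add: vspace_def)
    show "\<exists>!(X0, X1). X0 \<in> homog Q 0 \<and> X1 \<in> homog Q 1 \<and> X = X0 \<oplus>\<^bsub>Q\<^esub> X1" if "X \<in> carrier Q" for X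
    proof -
      from that obtain x where x: "X = cls x" "x \<in> carrier F" by (auto simp: Q_carrier)
      obtain x0 x1 where x01: "x0 \<in> homog F 0" "x1 \<in> homog F 1" "x - (x0 + x1) \<in> N"
        using homog_decomp_mod[OF x(2)] by auto
      have uniq: "y0 - x0 \<in> N \<and> y1 - x1 \<in> N"
        if y: "y0 \<in> homog F 0" "y1 \<in> homog F 1" "x - (y0 + y1) \<in> N" for y0 y1
      proof -
        have sum: "(y0 - x0) + (y1 - x1) \<in> N"
          using N_minus[OF x01(3) y(3)] by (simp add: algebra_simps)
        have "y0 - x0 \<in> N"
          using homog_indep_mod[OF _ _ sum] homog_minus x01 y by blast
        then show ?thesis using N_minus[OF sum] by fastforce
      qed
      show ?thesis
      proof (rule ex1I[of _ "(cls x0, cls x1)"])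
        have "cls x = cls (x0 + x1)" using x01 by (simp add: cls_eq)
        then show "case (cls x0, cls x1) of (X0, X1) \<Rightarrow> X0 \<in> homog Q 0 \<and> X1 \<in> homog Q 1 \<and> X = X0 \<oplus>\<^bsub>Q\<^esub> X1"
          using x x01 by (simp add: Q_simps)
      next
        fix Y assume "case Y of (X0, X1) \<Rightarrow> X0 \<in> homog Q 0 \<and> X1 \<in> homog Q 1 \<and> X = X0 \<oplus>\<^bsub>Q\<^esub> X1"
        then obtain y0 y1 where y: "Y = (cls y0, cls y1)" "y0 \<in> homog F 0" "y1 \<in> homog F 1"
          "X = cls (y0 + y1)"
          by (auto simp: Q_simps)
        then have "x - (y0 + y1) \<in> N" using x by (simp add: cls_eq)
        from uniq[OF y(2,3) this] have "cls y0 = cls x0" "cls y1 = cls x1"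
          by (simp_all add: cls_eq)
        then show "Y = (cls x0, cls x1)" using y by simp
      qed
    qed
  qed (auto simp: Q_simps mult_closed one_closed mult_scale_left mult_scale_right homog_closed
      homog_zero homog_scale homog_one intro!: imageI homog_add)
qed

text \<open>Two representatives of a class differ by an element of \<open>N\<close>, on which \<open>e\<close> vanishes, so \<open>e\<close>
  takes the same value on both.\<close>

lemma superquot_hom_exists:
  assumes D: "superalgebra D"
    and closed: "\<And>x. x \<in> carrier F \<Longrightarrow> e x \<in> carrier D"
    and add: "\<And>x y. \<lbrakk>x \<in> carrier F; y \<in> carrier F\<rbrakk> \<Longrightarrow> e (x + y) = e x \<oplus>\<^bsub>D\<^esub> e y"
    and scale: "\<And>k x. x \<in> carrier F \<Longrightarrow> e (k \<odot> x) = k \<odot>\<^bsub>D\<^esub> e x"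
    and mult: "\<And>x y. \<lbrakk>x \<in> carrier F; y \<in> carrier F\<rbrakk> \<Longrightarrow> e (x \<otimes> y) = e x \<otimes>\<^bsub>D\<^esub> e y"
    and one: "e \<one> = \<one>\<^bsub>D\<^esub>"
    and homog: "\<And>x s. x \<in> homog F s \<Longrightarrow> e x \<in> homog D s"
    and kills: "\<And>x. x \<in> N \<Longrightarrow> e x = \<zero>\<^bsub>D\<^esub>"
  obtains h where "superalgebra_hom Q D h" "\<And>x. x \<in> carrier F \<Longrightarrow> h (cls x) = e x"
proof -
  interpret D: superalgebra D by (rule D)
  have well_def: "e x = e y" if "x - y \<in> N" "x \<in> carrier F" "y \<in> carrier F" for x y
    using add[of "x - y" y] kills[OF that(1)] that minus_closed closed by simp
  define h where "h X = e (SOME x. x \<in> carrier F \<and> X = cls x)" for X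
  have h: "h (cls x) = e x" if "x \<in> carrier F" for x
  proof -
    let ?x = "SOME y. y \<in> carrier F \<and> cls x = cls y"
    have "?x \<in> carrier F \<and> cls x = cls ?x" by (rule someI) (use that in simp)
    then show ?thesis using well_def[of x ?x] that by (simp add: h_def cls_eq)
  qed
  have "superalgebra_hom Q D h"
  proof (rule superalgebra_homI[OF superalgebra_superquot D])
    show "h \<one>\<^bsub>Q\<^esub> = \<one>\<^bsub>D\<^esub>" by (simp add: Q_one h one_closed one)
    show "h X \<in> carrier D" if "X \<in> carrier Q" for X
      using that by (auto simp: Q_carrier h closed)
    show "h (X \<otimes>\<^bsub>Q\<^esub> Y) = h X \<otimes>\<^bsub>D\<^esub> h Y" "h (X \<oplus>\<^bsub>Q\<^esub> Y) = h X \<oplus>\<^bsub>D\<^esub> h Y"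
      if "X \<in> carrier Q" "Y \<in> carrier Q" for X Y
      using that by (auto simp: Q_simps h mult add mult_closed add_closed)
    show "h (k \<odot>\<^bsub>Q\<^esub> X) = k \<odot>\<^bsub>D\<^esub> h X" if "X \<in> carrier Q" for k X
      using that by (auto simp: Q_simps h scale)
    show "h X \<in> homog D s" if "X \<in> homog Q s" for X s
      using that by (auto simp: Q_simps h homog homog_closed)
  qed
  with h that show ?thesis by blast
qed

end

section \<open>Linear extension\<close>

definition lin_ext ::
    "('k::field, 'a, 'm) module_scheme \<Rightarrow> ('c \<Rightarrow> 'a) \<Rightarrow> ('c \<Rightarrow>\<^sub>0 'k) \<Rightarrow> 'a" where
  "lin_ext M g f = (\<Oplus>\<^bsub>M\<^esub>c\<in>Poly_Mapping.keys f. Poly_Mapping.lookup f c \<odot>\<^bsub>M\<^esub> g c)"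

lemma lookup_lscale [simp]: "Poly_Mapping.lookup (lscale k f) c = k * Poly_Mapping.lookup f c"
  unfolding lscale_def by (simp add: map.rep_eq when_def)

lemma keys_lscale: "Poly_Mapping.keys (lscale k f) \<subseteq> Poly_Mapping.keys f"
  by (auto simp: in_keys_iff)

lemma lscale_single [simp]: "lscale k (Poly_Mapping.single c l) = Poly_Mapping.single c (k * l)"
  by (rule poly_mapping_eqI) (simp add: lookup_single when_def)

lemma lscale_add: "lscale k (f + g) = lscale k f + lscale k g"
  by (rule poly_mapping_eqI) (simp add: lookup_add algebra_simps)

interpretation lscale: Modules.module "lscale :: 'k::field \<Rightarrow> ('c \<Rightarrow>\<^sub>0 'k) \<Rightarrow> _"
  by standard (rule poly_mapping_eqI; simp add: lookup_add algebra_simps)+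

lemma lscale_zero [simp]: "lscale k 0 = 0"
  by (rule lscale.scale_zero_right)

lemma const_times: "const k * f = lscale k f"
  by (simp add: const_def lscale_def mult_map_scale_conv_mult zero_list_def)

text \<open>Every finitely supported function is a linear combination of basis vectors.\<close>

lemma poly_mapping_linear_induct [consumes 1, case_names zero single add]:
  assumes "Poly_Mapping.keys f \<subseteq> X"
    and "P 0"
    and "\<And>c k. c \<in> X \<Longrightarrow> P (Poly_Mapping.single c k)"
    and "\<And>f g. \<lbrakk>Poly_Mapping.keys f \<subseteq> X; Poly_Mapping.keys g \<subseteq> X; P f; P g\<rbrakk> \<Longrightarrow> P (f + g)"
  shows "P f"
  using assms(1)
proof (induction f rule: update_induct)
  case const
  show ?case by (rule assms(2))
next
  case (update f c k)
  have eq: "Poly_Mapping.update c k f = Poly_Mapping.single c k + f"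
    using update.hyps
    by (intro poly_mapping_eqI) (auto simp: lookup_update lookup_add lookup_single in_keys_iff when_def)
  have keys: "Poly_Mapping.keys (Poly_Mapping.update c k f) = insert c (Poly_Mapping.keys f)"
    using update.hyps by (auto simp: in_keys_iff lookup_update split: if_splits)
  show ?case
    unfolding eq
    by (rule assms(4)) (use update keys assms(3) in auto)
qed

context vspace
begin

lemma lin_ext_superset:
  assumes "finite K" "Poly_Mapping.keys f \<subseteq> K" "g \<in> K \<rightarrow> carrier M"
  shows "lin_ext M g f = (\<Oplus>c\<in>K. Poly_Mapping.lookup f c \<odot> g c)"
  unfolding lin_ext_def
  by (rule M.add.finprod_mono_neutral_cong_left)
    (use assms in \<open>auto simp: in_keys_iff Pi_iff\<close>)

lemma lin_ext_closed [simp]: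
  assumes "Poly_Mapping.keys f \<subseteq> X" "g \<in> X \<rightarrow> carrier M"
  shows "lin_ext M g f \<in> carrier M"
  unfolding lin_ext_def by (rule M.finsum_closed) (use assms in auto)

lemma lin_ext_zero [simp]: "lin_ext M g 0 = \<zero>"
  by (simp add: lin_ext_def)

lemma lin_ext_single:
  assumes "g c \<in> carrier M"
  shows "lin_ext M g (Poly_Mapping.single c k) = k \<odot> g c"
  using assms lin_ext_superset[of "{c}" "Poly_Mapping.single c k" g] by (simp add: keys_single)

lemma lin_ext_add:
  assumes "Poly_Mapping.keys f \<subseteq> X" "Poly_Mapping.keys f' \<subseteq> X" "g \<in> X \<rightarrow> carrier M"
  shows "lin_ext M g (f + f') = lin_ext M g f \<oplus> lin_ext M g f'"
proof -
  let ?K = "Poly_Mapping.keys f \<union> Poly_Mapping.keys f'"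
  have g: "g \<in> ?K \<rightarrow> carrier M" using assms by auto
  have "lin_ext M g (f + f') = (\<Oplus>c\<in>?K. Poly_Mapping.lookup (f + f') c \<odot> g c)"
    by (rule lin_ext_superset) (use g Poly_Mapping.keys_add[of f f'] in auto)
  also have "\<dots> = (\<Oplus>c\<in>?K. Poly_Mapping.lookup f c \<odot> g c \<oplus> Poly_Mapping.lookup f' c \<odot> g c)"
    by (rule M.finsum_cong') (use g in \<open>auto simp: lookup_add scale_left_add Pi_iff\<close>)
  also have "\<dots> = (\<Oplus>c\<in>?K. Poly_Mapping.lookup f c \<odot> g c) \<oplus> (\<Oplus>c\<in>?K. Poly_Mapping.lookup f' c \<odot> g c)"
    by (rule M.finsum_addf) (use g in auto)
  also have "\<dots> = lin_ext M g f \<oplus> lin_ext M g f'"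
    using lin_ext_superset[of ?K f g] lin_ext_superset[of ?K f' g] g by simp
  finally show ?thesis .
qed

lemma lin_ext_scale:
  assumes "Poly_Mapping.keys f \<subseteq> X" "g \<in> X \<rightarrow> carrier M"
  shows "lin_ext M g (lscale k f) = k \<odot> lin_ext M g f"
  using assms(1)
proof (induction f rule: poly_mapping_linear_induct)
  case (add f f')
  have keys: "Poly_Mapping.keys (lscale k f) \<subseteq> X" "Poly_Mapping.keys (lscale k f') \<subseteq> X"
    by (rule subset_trans[OF keys_lscale add.hyps(1)], rule subset_trans[OF keys_lscale add.hyps(2)])
  have "lin_ext M g (lscale k (f + f')) = k \<odot> lin_ext M g f \<oplus> k \<odot> lin_ext M g f'"
    unfolding lscale_add lin_ext_add[OF keys assms(2)] add.IH ..
  also have "\<dots> = k \<odot> lin_ext M g (f + f')"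
    unfolding lin_ext_add[OF add.hyps(1,2) assms(2)]
    by (rule scale_right_add[symmetric]) (use add.hyps(1,2) assms(2) in simp_all)
  finally show ?case .
next
  case (single c l)
  then show ?case using assms(2) by (simp add: lin_ext_single Pi_iff)
qed simp

lemma lin_ext_uminus:
  assumes "Poly_Mapping.keys f \<subseteq> X" "g \<in> X \<rightarrow> carrier M"
  shows "lin_ext M g (- f) = \<ominus> lin_ext M g f"
  using lin_ext_scale[OF assms, of "-1"] lin_ext_closed[OF assms] by simp

lemma lin_ext_minus:
  assumes "Poly_Mapping.keys f \<subseteq> X" "Poly_Mapping.keys f' \<subseteq> X" "g \<in> X \<rightarrow> carrier M"
  shows "lin_ext M g (f - f') = lin_ext M g f \<ominus> lin_ext M g f'"
  using lin_ext_add[of f X "- f'" g] lin_ext_uminus[of f' X g] assms by (simp add: a_minus_def)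

end

section \<open>Free superalgebras\<close>

lemma free_superalgebra_simps [simp]:
  "x \<otimes>\<^bsub>free_superalgebra X p\<^esub> y = x * y" "\<one>\<^bsub>free_superalgebra X p\<^esub> = 1"
  "\<zero>\<^bsub>free_superalgebra X p\<^esub> = 0" "x \<oplus>\<^bsub>free_superalgebra X p\<^esub> y = x + y"
  "k \<odot>\<^bsub>free_superalgebra X p\<^esub> x = lscale k x"
  by (simp_all add: free_superalgebra_def const_times)

lemma carrier_free: "f \<in> carrier (free_superalgebra X p) \<longleftrightarrow> Poly_Mapping.keys f \<subseteq> {w. set w \<subseteq> X}"
  by (auto simp: free_superalgebra_def)

lemma homog_free:
  "f \<in> homog (free_superalgebra X p) s \<longleftrightarrow>
     Poly_Mapping.keys f \<subseteq> {w. set w \<subseteq> X \<and> sum_list (map p w) = s}"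
  by (auto simp: free_superalgebra_def)

lemma keys_times_words: "Poly_Mapping.keys (f * g) \<subseteq> {v @ w | v w. v \<in> Poly_Mapping.keys f \<and> w \<in> Poly_Mapping.keys g}"
  using keys_mult[of f g] by (simp add: plus_list_def)

lemma one_eq_single_Nil: "(1 :: 'x list \<Rightarrow>\<^sub>0 'k::field) = Poly_Mapping.single [] 1"
  by (simp flip: single_one add: zero_list_def)

lemma keys_minus_subset: "Poly_Mapping.keys (f - g) \<subseteq> Poly_Mapping.keys f \<union> Poly_Mapping.keys g"
  for f :: "'c \<Rightarrow>\<^sub>0 'k::ab_group_add"
  by (auto simp: in_keys_iff lookup_minus)

lemma lscale_mult_left: "lscale k (f :: 'x list \<Rightarrow>\<^sub>0 'k::field) * g = lscale k (f * g)"
  by (simp flip: const_times add: mult.assoc)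

text \<open>Both sides are linear in \<open>f\<close>, and on a word both put the coefficient in front of it.\<close>

lemma const_central: "const k * f = f * const (k :: 'k::field)"
proof (rule poly_mapping_linear_induct[of f UNIV])
  fix c l
  show "const k * Poly_Mapping.single c l = Poly_Mapping.single c l * const k"
    by (simp add: const_def mult_single plus_list_def mult.commute)
qed (simp_all add: algebra_simps)

lemma lscale_mult_right: "f * lscale k (g :: 'x list \<Rightarrow>\<^sub>0 'k::field) = lscale k (f * g)"
proof -
  have "f * (const k * g) = (const k * f) * g"
    by (simp only: const_central[of k f] mult.assoc)
  then show ?thesis by (simp add: const_times lscale_mult_left)
qed

text \<open>The parity of a word is additive under concatenation. A linear combination of words splits
uniquely into the combinations of its even and of its odd words.\<close>

lemma superalgebra_free: "superalgebra (free_superalgebra X p :: ('k::field, 'x list \<Rightarrow>\<^sub>0 'k) superalgebra)"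
  (is "superalgebra ?F")
proof -
  have add: "f + g \<in> carrier ?F" if "f \<in> carrier ?F" "g \<in> carrier ?F" for f g
    using that Poly_Mapping.keys_add[of f g] unfolding carrier_free by (meson Un_least subset_trans)
  have mult: "f * g \<in> carrier ?F" if "f \<in> carrier ?F" "g \<in> carrier ?F" for f g
    using that keys_times_words[of f g] by (fastforce simp: carrier_free)
  have zero: "0 \<in> carrier ?F" and one: "1 \<in> carrier ?F"
    by (simp_all add: carrier_free one_eq_single_Nil)
  have inv: "\<exists>g\<in>carrier ?F. f + g = 0" if "f \<in> carrier ?F" for f
    using that by (intro bexI[of _ "- f"]) (simp_all add: carrier_free)
  have ring: "ring ?F"
    by (rule ringI; (rule abelian_groupI monoidI)?)
      (simp_all add: add mult zero one inv algebra_simps)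
  have scale: "lscale k f \<in> carrier ?F" if "f \<in> carrier ?F" for k f
    using that subset_trans[OF keys_lscale] by (simp add: carrier_free)
  have vspace: "vspace ?F"
    by (rule vspaceI)
      (simp_all add: scale ring.is_abelian_group[OF ring] lscale_add lscale.scale_left_distrib)
  have homog_mult: "f * g \<in> homog ?F (s + t)" if "f \<in> homog ?F s" "g \<in> homog ?F t" for f g s t
    using that keys_times_words[of f g] by (fastforce simp: homog_free)
  have homog_add: "f + g \<in> homog ?F s" if "f \<in> homog ?F s" "g \<in> homog ?F s" for f g s
    using that Poly_Mapping.keys_add[of f g] unfolding homog_free by (meson Un_least subset_trans)
  have homog_scale: "lscale k f \<in> homog ?F s" if "f \<in> homog ?F s" for k f s
    using that subset_trans[OF keys_lscale] by (simp add: homog_free)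
  have direct_sum: "\<exists>!(f0, f1). f0 \<in> homog ?F 0 \<and> f1 \<in> homog ?F 1 \<and> f = f0 + f1" if "f \<in> carrier ?F" for f
  proof -
    have "\<exists>f0 f1. f0 \<in> homog ?F 0 \<and> f1 \<in> homog ?F 1 \<and> f = f0 + f1"
      using that unfolding carrier_free
    proof (induction f rule: poly_mapping_linear_induct)
      case zero
      show ?case by (intro exI[of _ 0]) (simp add: homog_free)
    next
      case (single w k)
      consider "sum_list (map p w) = 0" | "sum_list (map p w) = 1"
        using bit_not_zero_iff by blast
      then show ?case
      proof cases
        case 1
        with single show ?thesis
          by (intro exI[of _ "Poly_Mapping.single w k"] exI[of _ 0]) (auto simp: homog_free)
      next
        case 2
        with single show ?thesis
          by (intro exI[of _ 0] exI[of _ "Poly_Mapping.single w k"]) (auto simp: homog_free)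
      qed
    next
      case (add f g)
      then obtain f0 f1 g0 g1 where *: "f0 \<in> homog ?F 0" "f1 \<in> homog ?F 1" "f = f0 + f1"
        "g0 \<in> homog ?F 0" "g1 \<in> homog ?F 1" "g = g0 + g1" by auto
      then have "f + g = (f0 + g0) + (f1 + g1)" by simp
      with * show ?case
        by (intro exI[of _ "f0 + g0"] exI[of _ "f1 + g1"]) (simp add: homog_add)
    qed
    then obtain f0 f1 where f: "f0 \<in> homog ?F 0" "f1 \<in> homog ?F 1" "f = f0 + f1" by auto
    have uniq: "f0 = g0 \<and> f1 = g1"
      if fg: "f0 \<in> homog ?F 0" "f1 \<in> homog ?F 1" "g0 \<in> homog ?F 0" "g1 \<in> homog ?F 1" "f0 + f1 = g0 + g1"
      for f0 f1 g0 g1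
    proof -
      have eq: "f0 - g0 = g1 - f1" using fg(5) by (simp add: algebra_simps)
      have "Poly_Mapping.keys (f0 - g0) \<subseteq> {w. sum_list (map p w) = 0}"
        using fg keys_minus_subset[of f0 g0] by (auto simp: homog_free)
      moreover have "Poly_Mapping.keys (g1 - f1) \<subseteq> {w. sum_list (map p w) = 1}"
        using fg keys_minus_subset[of g1 f1] by (auto simp: homog_free)
      ultimately have "Poly_Mapping.keys (f0 - g0) = {}" using eq by fastforce
      then show ?thesis using eq by simp
    qed
    show ?thesis
    proof (rule ex1I[of _ "(f0, f1)"])
      fix y assume "case y of (g0, g1) \<Rightarrow> g0 \<in> homog ?F 0 \<and> g1 \<in> homog ?F 1 \<and> f = g0 + g1"
      then obtain g0 g1 where y: "y = (g0, g1)" "g0 \<in> homog ?F 0" "g1 \<in> homog ?F 1" "f = g0 + g1"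
        by auto
      show "y = (f0, f1)" using uniq[OF f(1,2) y(2,3)] f(3) y by simp
    qed (use f in simp)
  qed
  have homog_carrier: "homog ?F s \<subseteq> carrier ?F" for s
    by (rule subsetI) (simp add: homog_free carrier_free, blast)
  have homog_01: "0 \<in> homog ?F s" "1 \<in> homog ?F 0" for s
    by (simp_all add: homog_free one_eq_single_Nil)
  show ?thesis
    by (intro superalgebra.intro superalgebra_axioms.intro ring vspace[unfolded vspace_def])
      (simp_all add: lscale_mult_left lscale_mult_right homog_mult homog_add homog_scale
        homog_carrier homog_01 direct_sum)
qed

lemma gen_homog: "x \<in> X \<Longrightarrow> gen x \<in> homog (free_superalgebra X p) (p x)"
  by (simp add: gen_def homog_free)

lemma const_homog: "const k \<in> homog (free_superalgebra X p) 0"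
  by (simp add: const_def homog_free)

lemma gen_carrier [simp]: "x \<in> X \<Longrightarrow> gen x \<in> carrier (free_superalgebra X p)"
  by (simp add: gen_def carrier_free)

lemma const_carrier [simp]: "const k \<in> carrier (free_superalgebra X p)"
  by (simp add: const_def carrier_free)

lemma const_eq: "const k = lscale k 1"
  by (simp add: const_def one_eq_single_Nil)

lemma free_carrier_closed [simp]:
  assumes "f \<in> carrier (free_superalgebra X p)" "g \<in> carrier (free_superalgebra X p)"
  shows "f + g \<in> carrier (free_superalgebra X p)" "f * g \<in> carrier (free_superalgebra X p)"
    "f - g \<in> carrier (free_superalgebra X p)" "lscale k f \<in> carrier (free_superalgebra X p)"
proof -
  interpret superalgebra "free_superalgebra X p" by (rule superalgebra_free)
  show "f + g \<in> carrier (free_superalgebra X p)" "f * g \<in> carrier (free_superalgebra X p)"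
    "lscale k f \<in> carrier (free_superalgebra X p)"
    using assms a_closed[of f g] m_closed[of f g] vsp.scale_closed[of f k] by simp_all
  show "f - g \<in> carrier (free_superalgebra X p)"
    using keys_minus_subset[of f g] assms by (auto simp: carrier_free)
qed

lemma free_one_carrier [simp]: "1 \<in> carrier (free_superalgebra X p)"
  by (simp add: carrier_free one_eq_single_Nil)

lemma free_uminus: 
  fixes f :: "'x list \<Rightarrow>\<^sub>0 'k::field"
  assumes "f \<in> carrier (free_superalgebra X p)"
  shows "\<ominus>\<^bsub>free_superalgebra X p\<^esub> f = - f"
proof -
  interpret superalgebra "free_superalgebra X p :: ('k, 'x list \<Rightarrow>\<^sub>0 'k) superalgebra" by (rule superalgebra_free)
  show ?thesis using assms l_neg[of f] by (simp add: eq_neg_iff_add_eq_0)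
qed

subsection \<open>Evaluation\<close>

definition word_eval :: "('k, 'a) superalgebra \<Rightarrow> ('x \<Rightarrow> 'a) \<Rightarrow> 'x list \<Rightarrow> 'a" where
  "word_eval A g w = foldr (\<lambda>x y. g x \<otimes>\<^bsub>A\<^esub> y) w \<one>\<^bsub>A\<^esub>"

definition free_eval :: "('k::field, 'a) superalgebra \<Rightarrow> ('x \<Rightarrow> 'a) \<Rightarrow> ('x list \<Rightarrow>\<^sub>0 'k) \<Rightarrow> 'a" where
  "free_eval A g = lin_ext A (word_eval A g)"

context superalgebra
begin

lemma word_eval_simps [simp]:
  "word_eval A g [] = \<one>" "word_eval A g (x # w) = g x \<otimes> word_eval A g w"
  by (simp_all add: word_eval_def)

lemma word_eval_homog:
  assumes "\<And>x. x \<in> X \<Longrightarrow> g x \<in> homog A (p x)" "set w \<subseteq> X"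
  shows "word_eval A g w \<in> homog A (sum_list (map p w))"
  using assms(2) by (induction w) (auto simp: homog_one intro!: homog_mult assms(1))

lemma word_eval_closed:
  assumes "g \<in> X \<rightarrow> carrier A" "set w \<subseteq> X"
  shows "word_eval A g w \<in> carrier A"
  using assms(2) by (induction w) (use assms(1) in auto)

lemma word_eval_append:
  assumes "g \<in> X \<rightarrow> carrier A" "set v \<subseteq> X" "set w \<subseteq> X"
  shows "word_eval A g (v @ w) = word_eval A g v \<otimes> word_eval A g w"
  using assms(2) by (induction v) (use assms word_eval_closed[OF assms(1)] in \<open>auto simp: m_assoc Pi_iff\<close>)

text \<open>The universal property of the free superalgebra. Multiplicativity is checked on words and extends
  by bilinearity.\<close>

lemma superalgebra_hom_free_eval:
  assumes g: "\<And>x. x \<in> X \<Longrightarrow> g x \<in> homog A (p x)"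
  shows "superalgebra_hom (free_superalgebra X p) A (free_eval A g)"
proof -
  let ?W = "{w. set w \<subseteq> X}" and ?F = "free_superalgebra X p"
  have g': "g \<in> X \<rightarrow> carrier A" using g homog_in_carrier by blast
  have we: "word_eval A g \<in> ?W \<rightarrow> carrier A" using word_eval_closed[OF g'] by auto
  have ev_closed: "free_eval A g f \<in> carrier A" if "f \<in> carrier ?F" for f
    using vsp.lin_ext_closed[OF _ we] that by (simp add: carrier_free free_eval_def)
  have ev_add: "free_eval A g (f + f') = free_eval A g f \<oplus> free_eval A g f'"
    if "f \<in> carrier ?F" "f' \<in> carrier ?F" for f f'
    using vsp.lin_ext_add[OF _ _ we] that by (simp add: carrier_free free_eval_def)
  have ev_scale: "free_eval A g (lscale k f) = k \<odot> free_eval A g f" if "f \<in> carrier ?F" for f k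
    using vsp.lin_ext_scale[OF _ we] that by (simp add: carrier_free free_eval_def)
  have ev_single: "free_eval A g (Poly_Mapping.single w k) = k \<odot> word_eval A g w" if "w \<in> ?W" for w k
    using vsp.lin_ext_single[of "word_eval A g"] word_eval_closed[OF g'] that by (simp add: free_eval_def)
  have ev_zero: "free_eval A g 0 = \<zero>" by (simp add: free_eval_def)
  have mult_word: "free_eval A g (Poly_Mapping.single v k * f') =
      free_eval A g (Poly_Mapping.single v k) \<otimes> free_eval A g f'"
    if v: "v \<in> ?W" and "Poly_Mapping.keys f' \<subseteq> ?W" for v k f'
    using that(2)
  proof (induction f' rule: poly_mapping_linear_induct)
    case zero
    have "Poly_Mapping.single v k \<in> carrier ?F" using v by (simp add: carrier_free)
    then show ?case by (simp add: ev_zero ev_closed)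
  next
    case (single w l)
    have "word_eval A g v \<in> carrier A" "word_eval A g w \<in> carrier A"
      using word_eval_closed[OF g'] single v by auto
    moreover have "v @ w \<in> ?W" "word_eval A g (v @ w) = word_eval A g v \<otimes> word_eval A g w"
      using single v word_eval_append[OF g', of v w] by auto
    ultimately show ?case
      using single v by (simp add: ev_single mult_single plus_list_def smult_mult_left
          smult_mult_right mult.commute del: mem_Collect_eq)
  next
    case (add h h')
    have c: "Poly_Mapping.single v k \<in> carrier ?F" "h \<in> carrier ?F" "h' \<in> carrier ?F"
      using v add.hyps(1,2) by (simp_all add: carrier_free)
    have "free_eval A g (Poly_Mapping.single v k * h + Poly_Mapping.single v k * h') =
        free_eval A g (Poly_Mapping.single v k * h) \<oplus> free_eval A g (Poly_Mapping.single v k * h')"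
      using c by (intro ev_add free_carrier_closed)
    then show ?case
      using c by (simp add: distrib_left add.IH ev_add ev_closed r_distr)
  qed
  have mult: "free_eval A g (f * f') = free_eval A g f \<otimes> free_eval A g f'"
    if "Poly_Mapping.keys f \<subseteq> ?W" and f': "Poly_Mapping.keys f' \<subseteq> ?W" for f f'
    using that(1)
  proof (induction f rule: poly_mapping_linear_induct)
    case zero
    have "f' \<in> carrier ?F" using f' by (simp add: carrier_free)
    then show ?case by (simp add: ev_zero ev_closed)
  next
    case (single w k)
    then show ?case using mult_word f' by simp
  next
    case (add h h')
    have c: "f' \<in> carrier ?F" "h \<in> carrier ?F" "h' \<in> carrier ?F"
      using f' add.hyps(1,2) by (simp_all add: carrier_free)
    have "free_eval A g (h * f' + h' * f') = free_eval A g (h * f') \<oplus> free_eval A g (h' * f')"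
      using c by (intro ev_add free_carrier_closed)
    then show ?case
      using c by (simp add: distrib_right add.IH ev_add ev_closed l_distr)
  qed
  have homog: "free_eval A g f \<in> homog A s" if "f \<in> homog ?F s" for f s
    using that unfolding homog_free
  proof (induction f rule: poly_mapping_linear_induct)
    case zero
    then show ?case using homog_zero by (simp add: ev_zero)
  next
    case (single w k)
    then show ?case using word_eval_homog[of X g p w] g by (auto simp: ev_single intro: homog_smult)
  next
    case (add f h)
    then have "f \<in> carrier ?F" "h \<in> carrier ?F" by (auto simp: carrier_free)
    with add show ?case by (simp add: ev_add homog_add)
  qed
  show ?thesis
  proof (rule superalgebra_homI[OF superalgebra_free superalgebra_axioms])
    show "free_eval A g \<one>\<^bsub>?F\<^esub> = \<one>" using ev_single[of "[]" 1] by (simp add: one_eq_single_Nil)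
  qed (simp_all add: ev_closed ev_add ev_scale mult homog carrier_free)
qed

lemma free_eval_gen:
  assumes "g x \<in> carrier A"
  shows "free_eval A g (gen x) = g x"
  using assms by (simp add: free_eval_def gen_def vsp.lin_ext_single)

text \<open>Evaluation is a homomorphism; in this form the facts rewrite the value of a noncommutative
polynomial to the polynomial in the values.\<close>

lemma free_eval_rules:
  assumes g: "\<And>x. x \<in> X \<Longrightarrow> g x \<in> homog A (p x)"
  defines "F \<equiv> free_superalgebra X p"
  shows "\<lbrakk>f \<in> carrier F; f' \<in> carrier F\<rbrakk> \<Longrightarrow> free_eval A g (f * f') = free_eval A g f \<otimes> free_eval A g f'"
    and "\<lbrakk>f \<in> carrier F; f' \<in> carrier F\<rbrakk> \<Longrightarrow> free_eval A g (f + f') = free_eval A g f \<oplus> free_eval A g f'"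
    and "\<lbrakk>f \<in> carrier F; f' \<in> carrier F\<rbrakk> \<Longrightarrow> free_eval A g (f - f') = free_eval A g f \<ominus> free_eval A g f'"
    and "free_eval A g (const k) = k \<odot> \<one>"
    and "free_eval A g 1 = \<one>"
    and "x \<in> X \<Longrightarrow> free_eval A g (gen x) = g x"
proof -
  interpret ev: superalgebra_homomorphism F A "free_eval A g"
    unfolding F_def using superalgebra_hom_free_eval[of X g p] g by auto
  have minus: "f \<ominus>\<^bsub>F\<^esub> f' = f - f'" if "f \<in> carrier F" "f' \<in> carrier F" for f f'
    using that by (simp add: F_def a_minus_def free_uminus)
  show "free_eval A g (f * f') = free_eval A g f \<otimes> free_eval A g f'"
    "free_eval A g (f + f') = free_eval A g f \<oplus> free_eval A g f'"
    "free_eval A g (f - f') = free_eval A g f \<ominus> free_eval A g f'"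
    if "f \<in> carrier F" "f' \<in> carrier F"
    using that ev.mult[of f f'] ev.add[of f f'] ev.minus[of f f'] minus[of f f'] by (simp_all add: F_def)
  show "free_eval A g 1 = \<one>" using ev.one by (simp add: F_def)
  then show "free_eval A g (const k) = k \<odot> \<one>"
    using ev.scale[of 1 k] by (simp add: F_def const_eq)
  show "x \<in> X \<Longrightarrow> free_eval A g (gen x) = g x"
    using free_eval_gen[of g x] g homog_in_carrier by blast
qed

end

text \<open>A homomorphism out of a free superalgebra is evaluation at the images of the letters.\<close>

lemma superalgebra_hom_free_unique:
  fixes A :: "('k::field, 'a) superalgebra"
  assumes h: "superalgebra_hom (free_superalgebra X p) A h" and h': "superalgebra_hom (free_superalgebra X p) A h'"
    and eq: "\<And>x. x \<in> X \<Longrightarrow> h (gen x) = h' (gen x)"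
    and f: "f \<in> carrier (free_superalgebra X p)"
  shows "h f = h' f"
proof -
  interpret h: superalgebra_homomorphism "free_superalgebra X p" A h using h by auto
  interpret h': superalgebra_homomorphism "free_superalgebra X p" A h' using h' by auto
  have word: "h (Poly_Mapping.single w 1) = h' (Poly_Mapping.single w 1)" if "set w \<subseteq> X" for w
    using that
  proof (induction w)
    case Nil
    then show ?case using h.one h'.one by (simp add: one_eq_single_Nil)
  next
    case (Cons x w)
    have "Poly_Mapping.single w 1 \<in> carrier (free_superalgebra X p :: ('k, _) superalgebra)"
      using Cons by (simp add: carrier_free)
    then have "h (gen x * Poly_Mapping.single w 1) = h' (gen x * Poly_Mapping.single w 1)"
      using Cons eq h.mult[of "gen x" "Poly_Mapping.single w 1"] h'.mult[of "gen x" "Poly_Mapping.single w 1"]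
      by simp
    then show ?case by (simp add: gen_def mult_single plus_list_def)
  qed
  show ?thesis
    using f unfolding carrier_free
  proof (induction f rule: poly_mapping_linear_induct)
    case zero
    then show ?case using h.zero h'.zero by simp
  next
    case (single w k)
    then show ?case
      using word[of w] h.scale[of "Poly_Mapping.single w 1" k] h'.scale[of "Poly_Mapping.single w 1" k]
      by (simp add: carrier_free)
  next
    case (add f g)
    then show ?case using h.add[of f g] h'.add[of f g] by (simp add: carrier_free)
  qed
qed

lemma free_homog_rules:
  fixes f g :: "'x list \<Rightarrow>\<^sub>0 'k::field" and X p
  defines "F \<equiv> free_superalgebra X p"
  shows "\<lbrakk>f \<in> homog F s; g \<in> homog F t\<rbrakk> \<Longrightarrow> f * g \<in> homog F (s + t)"
    and "\<lbrakk>f \<in> homog F s; g \<in> homog F s\<rbrakk> \<Longrightarrow> f + g \<in> homog F s"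
    and "\<lbrakk>f \<in> homog F s; g \<in> homog F s\<rbrakk> \<Longrightarrow> f - g \<in> homog F s"
    and "const k \<in> homog F 0" and "1 \<in> homog F 0"
proof -
  interpret F: superalgebra F unfolding F_def by (rule superalgebra_free)
  show "f * g \<in> homog F (s + t)" if "f \<in> homog F s" "g \<in> homog F t"
    using F.homog_mult[OF that] by (simp add: F_def)
  show "f + g \<in> homog F s" if "f \<in> homog F s" "g \<in> homog F s"
    using F.homog_add[OF that] by (simp add: F_def)
  show "f - g \<in> homog F s" if "f \<in> homog F s" "g \<in> homog F s"
    using F.homog_minus[OF that] F.homog_in_carrier[OF that(1)] F.homog_in_carrier[OF that(2)]
    by (simp add: F_def a_minus_def free_uminus)
  show "const k \<in> homog F 0" by (simp add: F_def const_homog)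
  show "1 \<in> homog F 0" using F.homog_one by (simp add: F_def)
qed

lemma free_homog_mult:
  fixes f g :: "'x list \<Rightarrow>\<^sub>0 'k::field" and X p
  defines "F \<equiv> free_superalgebra X p"
  shows "\<lbrakk>f \<in> homog F 0; g \<in> homog F 0\<rbrakk> \<Longrightarrow> f * g \<in> homog F 0"
    and "\<lbrakk>f \<in> homog F 0; g \<in> homog F 1\<rbrakk> \<Longrightarrow> f * g \<in> homog F 1"
    and "\<lbrakk>f \<in> homog F 1; g \<in> homog F 0\<rbrakk> \<Longrightarrow> f * g \<in> homog F 1"
    and "\<lbrakk>f \<in> homog F 1; g \<in> homog F 1\<rbrakk> \<Longrightarrow> f * g \<in> homog F 0"
  using free_homog_rules(1)[of f X p 0 g 0] free_homog_rules(1)[of f X p 0 g 1]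
    free_homog_rules(1)[of f X p 1 g 0] free_homog_rules(1)[of f X p 1 g 1]
  by (simp_all add: F_def)

section \<open>Presented superalgebras\<close>

locale presentation =
  fixes X :: "'x set" and p :: "'x \<Rightarrow> bit" and S :: "('x list \<Rightarrow>\<^sub>0 'k::field) set"
  assumes rels_homog: "\<And>r. r \<in> S \<Longrightarrow> \<exists>s. r \<in> homog (free_superalgebra X p) s"
begin

abbreviation F :: "('k, 'x list \<Rightarrow>\<^sub>0 'k) superalgebra" where "F \<equiv> free_superalgebra X p"
abbreviation I where "I \<equiv> relation_ideal X p S"
abbreviation P where "P \<equiv> presented X p S"
abbreviation cl where "cl \<equiv> presented_class X p S"

sublocale F: superalgebra F by (rule superalgebra_free)

lemma rels_carrier: "S \<subseteq> carrier F"
  using rels_homog F.homog_in_carrier by blast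

sublocale I: ideal I F
  unfolding relation_ideal_def by (rule F.genideal_ideal[OF rels_carrier])

lemma rels_in_ideal: "r \<in> S \<Longrightarrow> r \<in> I"
  using F.genideal_self[OF rels_carrier] by (auto simp: relation_ideal_def)

lemma ideal_least: "ideal J F \<Longrightarrow> S \<subseteq> J \<Longrightarrow> I \<subseteq> J"
  unfolding relation_ideal_def by (rule F.genideal_minimal)

text \<open>The elements whose two components lie in the ideal form an ideal themselves, and it contains
  the relations. So the relation ideal contains the components of each of its elements.\<close>

lemma ideal_homog:
  assumes "x \<in> I"
  shows "hcomp F s x \<in> I"
proof -
  let ?J = "{x \<in> carrier F. \<forall>s. hcomp F s x \<in> I}"
  have comp_mult: "hcomp F s (a * x) \<in> I" "hcomp F s (x * a) \<in> I"
    if "a \<in> carrier F" "x \<in> ?J" for a x s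
  proof -
    have fin: "hcomp F s (f + g) = hcomp F s f + hcomp F s g" if "f \<in> carrier F" "g \<in> carrier F" for f g
      using F.hcomp_add[OF that] by simp
    have homog: "hcomp F s f \<in> I" if "f \<in> I" "f \<in> homog F t" for f t
      using F.hcomp_homog[OF that(2), of s] that(1) I.zero_closed by auto
    have a: "a = hcomp F 0 a + hcomp F 1 a" and x: "x = hcomp F 0 x + hcomp F 1 x"
      using F.hcomp_decomp(2)[of a 0] F.hcomp_decomp(2)[of x 0] that by auto
    have hm: "hcomp F u a * hcomp F v x \<in> homog F (u + v)" "hcomp F v x * hcomp F u a \<in> homog F (v + u)" for u v
      using F.homog_mult[OF F.hcomp_decomp(1)[of a u] F.hcomp_decomp(1)[of x v]]
        F.homog_mult[OF F.hcomp_decomp(1)[of x v] F.hcomp_decomp(1)[of a u]] that by auto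
    have mem: "hcomp F u a * hcomp F v x \<in> I" "hcomp F v x * hcomp F u a \<in> I" for u v
      using I.I_l_closed[of "hcomp F v x" "hcomp F u a"] I.I_r_closed[of "hcomp F v x" "hcomp F u a"] that by auto
    have *: "hcomp F s (hcomp F u a * hcomp F v x) \<in> I" "hcomp F s (hcomp F v x * hcomp F u a) \<in> I" for u v
      by (rule homog[OF mem(1) hm(1)], rule homog[OF mem(2) hm(2)])
    have addI: "f + g \<in> I" if "f \<in> I" "g \<in> I" for f g
      using I.a_closed[OF that] by simp
    have c: "hcomp F u a * hcomp F v x \<in> carrier F" "hcomp F v x * hcomp F u a \<in> carrier F" for u v
      by (rule F.homog_in_carrier[OF hm(1)], rule F.homog_in_carrier[OF hm(2)])
    have "a * x = (hcomp F 0 a + hcomp F 1 a) * (hcomp F 0 x + hcomp F 1 x)"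
      using a x by simp
    also have "hcomp F s \<dots> \<in> I"
      by (simp add: algebra_simps fin c * addI)
    finally show "hcomp F s (a * x) \<in> I" .
    have "x * a = (hcomp F 0 x + hcomp F 1 x) * (hcomp F 0 a + hcomp F 1 a)"
      using a x by simp
    also have "hcomp F s \<dots> \<in> I"
      by (simp add: algebra_simps fin c * addI)
    finally show "hcomp F s (x * a) \<in> I" .
  qed
  have "ideal ?J F"
  proof (rule idealI[OF F.ring_axioms])
    show "subgroup ?J (add_monoid F)"
    proof (rule F.add.subgroupI)
      show "?J \<noteq> {}"
        using F.hcomp_homog[OF F.homog_zero] I.zero_closed by (auto intro!: exI[of _ 0] simp: carrier_free)
    next
      fix x assume x: "x \<in> ?J"
      then have "hcomp F s (\<ominus>\<^bsub>F\<^esub> x) = \<ominus>\<^bsub>F\<^esub> hcomp F s x" for s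
        using F.hcomp_scale[of x s "-1"] by (simp add: free_uminus)
      then show "\<ominus>\<^bsub>F\<^esub> x \<in> ?J" using x by simp
    next
      fix x y assume "x \<in> ?J" "y \<in> ?J"
      then show "x \<oplus>\<^bsub>F\<^esub> y \<in> ?J" using F.hcomp_add[of x y] I.a_closed by simp
    qed auto
  qed (use comp_mult in auto)
  moreover have "S \<subseteq> ?J"
    using rels_carrier rels_homog F.hcomp_homog rels_in_ideal I.zero_closed by fastforce
  ultimately show ?thesis using ideal_least assms by blast
qed

lemma free_modulo: "superalgebra_modulo F I"
proof (rule superalgebra_modulo.intro)
  show "vspace F" by (rule F.vsp.vspace_axioms)
  show "x \<in> carrier F" if "x \<in> I" for x
    using I.a_Hcarr[OF that] .
  show "0 \<in> I" using I.zero_closed by simp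
  show "x + y \<in> I" if "x \<in> I" "y \<in> I" for x y
    using I.a_closed[OF that] by simp
  show "k \<odot>\<^bsub>F\<^esub> x \<in> I" if "x \<in> I" for k x
    using I.I_l_closed[OF that, of "const k"] by (simp add: const_times)
  show "x \<otimes>\<^bsub>F\<^esub> y \<in> I" "y \<otimes>\<^bsub>F\<^esub> x \<in> I" if "x \<in> carrier F" "y \<in> I" for x y
    using I.I_l_closed[OF that(2,1)] I.I_r_closed[OF that(2,1)] by simp_all
  show "\<exists>x0\<in>homog F 0. \<exists>x1\<in>homog F 1. x - (x0 + x1) \<in> I" if "x \<in> carrier F" for x
  proof (intro bexI)
    show "x - (hcomp F 0 x + hcomp F 1 x) \<in> I"
      using F.hcomp_decomp(2)[OF that, of 0, symmetric] I.zero_closed by simp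
  qed (rule F.hcomp_decomp(1)[OF that])+
  show "\<exists>z\<in>homog F (s + t). x \<otimes>\<^bsub>F\<^esub> y - z \<in> I" if "x \<in> homog F s" "y \<in> homog F t" for x y s t
    using F.homog_mult[OF that] I.zero_closed by (auto intro: bexI[of _ "x * y"])
  show "x0 \<in> I" if "x0 \<in> homog F 0" "x1 \<in> homog F 1" "x0 + x1 \<in> I" for x0 x1
    using ideal_homog[OF that(3), of 0] F.hcomp_unique[of x0 0 x1] that by simp
qed (use I.zero_closed F.homog_zero F.homog_one F.homog_add F.homog_smult in
    \<open>simp_all add: lscale_mult_left lscale_mult_right algebra_simps\<close>)

sublocale Q: superalgebra_modulo F I
  by (rule free_modulo)

lemma cls_eq_cl: "Q.cls = cl"
  by (rule ext) (simp add: Q.cls_def presented_class_def)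

sublocale P: superalgebra P
  using Q.superalgebra_superquot by (simp add: presented_def)

lemma superalgebra_hom_class: "superalgebra_hom F P cl"
  by (rule superalgebra_homI[OF F.superalgebra_axioms P.superalgebra_axioms])
    (auto simp: presented_def Q.Q_simps[unfolded cls_eq_cl])

sublocale cl: superalgebra_homomorphism F P cl
  using superalgebra_hom_class by auto

lemma carrier_presented: "carrier P = cl ` carrier F"
  by (simp add: presented_def Q.Q_carrier cls_eq_cl)

lemma homog_presented: "homog P s = cl ` homog F s"
  by (simp add: presented_def Q.Q_homog cls_eq_cl)

lemma class_eq_iff: "cl f = cl g \<longleftrightarrow> f - g \<in> I"
  using Q.cls_eq by (simp add: cls_eq_cl)

lemma class_mem: "f \<in> cl g \<longleftrightarrow> f - g \<in> I"
  using Q.mem_cls by (simp add: cls_eq_cl)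

lemma relation_vanishes: "r \<in> S \<Longrightarrow> cl r = \<zero>\<^bsub>P\<^esub>"
  using class_eq_iff[of r 0] cl.zero rels_in_ideal by simp

text \<open>The universal property: images of the generators that have the right parity and satisfy the
  relations extend to a homomorphism. Its kernel on the free superalgebra is an ideal containing the
  relations, hence contains the relation ideal.\<close>

lemma presented_hom_exists:
  assumes A: "superalgebra A"
    and g: "\<And>x. x \<in> X \<Longrightarrow> g x \<in> homog A (p x)"
    and rels: "\<And>r. r \<in> S \<Longrightarrow> free_eval A g r = \<zero>\<^bsub>A\<^esub>"
  obtains h where "superalgebra_hom P A h" "\<And>f. f \<in> carrier F \<Longrightarrow> h (cl f) = free_eval A g f"
proof -
  let ?e = "free_eval A g"
  interpret A: superalgebra A by (rule A)
  interpret e: superalgebra_homomorphism F A ?e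
    using A.superalgebra_hom_free_eval[of X g p] g by auto
  let ?K = "{f \<in> carrier F. ?e f = \<zero>\<^bsub>A\<^esub>}"
  have "ideal ?K F"
  proof (rule idealI[OF F.ring_axioms])
    show "subgroup ?K (add_monoid F)"
    proof (rule F.add.subgroupI)
      show "?K \<noteq> {}" using e.zero F.zero_closed by auto
    qed (use e.uminus e.add in auto)
  qed (use e.mult in auto)
  then have "I \<subseteq> ?K" by (rule ideal_least) (use rels rels_carrier in auto)
  then have kills: "?e f = \<zero>\<^bsub>A\<^esub>" if "f \<in> I" for f
    using that by auto
  show ?thesis
  proof (rule Q.superquot_hom_exists[OF A, of ?e])
    fix h assume "superalgebra_hom Q.Q A h" "\<And>f. f \<in> carrier F \<Longrightarrow> h (Q.cls f) = ?e f"
    then show thesis by (intro that) (simp_all add: presented_def cls_eq_cl)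
  qed (use e.add e.mult e.one e.scale e.homog kills in simp_all)
qed

text \<open>Composed with the projection from the free superalgebra, the two maps become homomorphisms that
agree on letters.\<close>

lemma presented_hom_unique:
  assumes h: "superalgebra_hom P A h" and h': "superalgebra_hom P A h'"
    and eq: "\<And>x. x \<in> X \<Longrightarrow> h (cl (gen x)) = h' (cl (gen x))"
    and Y: "Y \<in> carrier P"
  shows "h Y = h' Y"
proof -
  obtain f where f: "f \<in> carrier F" "Y = cl f" using Y by (auto simp: carrier_presented)
  have "h (cl f) = h' (cl f)"
    by (rule superalgebra_hom_free_unique[OF superalgebra_hom_comp[OF superalgebra_hom_class h]
          superalgebra_hom_comp[OF superalgebra_hom_class h'] eq f(1)])
  then show ?thesis using f by simp
qed

lemma free_eval_presented: "f \<in> carrier F \<Longrightarrow> free_eval P (\<lambda>x. cl (gen x)) f = cl f"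
proof -
  have g: "cl (gen x) \<in> homog P (p x)" if "x \<in> X" for x
    using cl.homog[OF gen_homog[OF that]] .
  show "f \<in> carrier F \<Longrightarrow> free_eval P (\<lambda>x. cl (gen x)) f = cl f"
  proof (rule superalgebra_hom_free_unique[OF P.superalgebra_hom_free_eval superalgebra_hom_class])
    show "free_eval P (\<lambda>x. cl (gen x)) (gen x) = cl (gen x)" if "x \<in> X" for x
      using P.free_eval_gen[of "\<lambda>x. cl (gen x)" x] g[OF that] by simp
  qed (use g in auto)
qed

lemma superalgebra_presented: "superalgebra P"
  by (rule P.superalgebra_axioms)

lemma class_rules:
  "\<lbrakk>f \<in> carrier F; f' \<in> carrier F\<rbrakk> \<Longrightarrow> cl (f * f') = cl f \<otimes>\<^bsub>P\<^esub> cl f'"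
  "\<lbrakk>f \<in> carrier F; f' \<in> carrier F\<rbrakk> \<Longrightarrow> cl (f + f') = cl f \<oplus>\<^bsub>P\<^esub> cl f'"
  "\<lbrakk>f \<in> carrier F; f' \<in> carrier F\<rbrakk> \<Longrightarrow> cl (f - f') = cl f \<ominus>\<^bsub>P\<^esub> cl f'"
  "cl (const k) = k \<odot>\<^bsub>P\<^esub> \<one>\<^bsub>P\<^esub>" "cl 1 = \<one>\<^bsub>P\<^esub>"
proof -
  show "cl (f * f') = cl f \<otimes>\<^bsub>P\<^esub> cl f'" "cl (f + f') = cl f \<oplus>\<^bsub>P\<^esub> cl f'" "cl (f - f') = cl f \<ominus>\<^bsub>P\<^esub> cl f'"
    if "f \<in> carrier F" "f' \<in> carrier F"
    using cl.mult[OF that] cl.add[OF that] cl.minus[OF that] that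
    by (simp_all add: a_minus_def[of F] free_uminus)
  show "cl 1 = \<one>\<^bsub>P\<^esub>" using cl.one by simp
  then show "cl (const k) = k \<odot>\<^bsub>P\<^esub> \<one>\<^bsub>P\<^esub>" using cl.scale[of 1 k] by (simp add: const_eq)
qed

lemma class_gen_homog: "x \<in> X \<Longrightarrow> cl (gen x) \<in> homog P (p x)"
  using cl.homog[OF gen_homog] .

text \<open>The signs multiply along a word, so supercommutation with the images of the generators passes to
  words and, by linearity, to the whole image.\<close>

lemma presented_supercommute:
  fixes E (structure)
  assumes f: "superalgebra_hom P E f" and y: "y \<in> carrier E"
    and gens: "\<And>x. x \<in> X \<Longrightarrow> y \<otimes> f (cl (gen x)) = bit_sign (t * p x) \<odot> (f (cl (gen x)) \<otimes> y)"
    and Y: "Y \<in> homog P s"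
  shows "y \<otimes> f Y = bit_sign (t * s) \<odot> (f Y \<otimes> y)"
proof -
  interpret u: superalgebra_homomorphism F E "\<lambda>w. f (cl w)"
    using superalgebra_hom_comp[OF superalgebra_hom_class f] by auto
  let ?u = "\<lambda>w. f (cl w)" and ?w = "\<lambda>w. Poly_Mapping.single w (1 :: 'k)"
  have ucl: "?u f' \<in> carrier E" if "f' \<in> carrier F" for f' using u.closed[OF that] .
  have word: "y \<otimes> ?u (?w w) = bit_sign (t * sum_list (map p w)) \<odot> (?u (?w w) \<otimes> y)" if "set w \<subseteq> X" for w
    using that
  proof (induction w)
    case Nil
    then show ?case using u.one y by (simp add: one_eq_single_Nil)
  next
    case (Cons x w)
    have mem: "gen x \<in> carrier F" "?w w \<in> carrier F" using Cons.prems by (simp_all add: carrier_free gen_def)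
    note c = ucl[OF mem(1)] ucl[OF mem(2)]
    have "?w (x # w) = gen x * ?w w" by (simp add: gen_def mult_single plus_list_def)
    then have eq: "?u (?w (x # w)) = ?u (gen x) \<otimes> ?u (?w w)"
      using u.mult[OF mem] by simp
    have "y \<otimes> ?u (?w (x # w)) = (y \<otimes> ?u (gen x)) \<otimes> ?u (?w w)"
      unfolding eq using y c by (simp add: u.B.m_assoc)
    also have "\<dots> = bit_sign (t * p x) \<odot> (?u (gen x) \<otimes> (y \<otimes> ?u (?w w)))"
      using gens[of x] Cons.prems y c by (simp add: u.B.smult_mult_left u.B.m_assoc)
    also have "\<dots> = (bit_sign (t * p x) * bit_sign (t * sum_list (map p w))) \<odot> (?u (gen x) \<otimes> (?u (?w w) \<otimes> y))"
      using Cons y c by (simp add: u.B.smult_mult_right)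
    also have "\<dots> = bit_sign (t * sum_list (map p (x # w))) \<odot> (?u (?w (x # w)) \<otimes> y)"
      unfolding eq using y c by (simp add: bit_sign_add distrib_left u.B.m_assoc)
    finally show ?case .
  qed
  obtain f' where f': "f' \<in> homog F s" "Y = cl f'" using Y by (auto simp: homog_presented)
  have "f' \<in> carrier F \<and> y \<otimes> ?u f' = bit_sign (t * s) \<odot> (?u f' \<otimes> y)"
    using f'(1) unfolding homog_free
  proof (induction f' rule: poly_mapping_linear_induct)
    case zero
    then show ?case using u.zero y by (simp add: carrier_free)
  next
    case (single w k)
    have mem: "?w w \<in> carrier F" using single by (simp add: carrier_free)
    have "Poly_Mapping.single w k = lscale k (?w w)" by simp
    then have eq: "?u (Poly_Mapping.single w k) = k \<odot> ?u (?w w)"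
      using u.scale[OF mem, of k] by simp
    show ?case
      unfolding eq using word[of w] single y ucl[OF mem]
      by (simp add: u.B.smult_mult_left u.B.smult_mult_right carrier_free mult.commute)
  next
    case (add g h)
    then show ?case
      using u.add[of g h] y ucl[of g] ucl[of h]
      by (simp add: u.B.r_distr u.B.l_distr u.B.vsp.scale_right_add)
  qed
  then show ?thesis using f'(2) by simp
qed

end

section \<open>Tensor products of superalgebras\<close>

subsection \<open>Formal tensors\<close>

text \<open>Linear extension of a map between bases, with values in a free vector space.\<close>

definition basis_ext :: "('c \<Rightarrow> ('d \<Rightarrow>\<^sub>0 'k)) \<Rightarrow> ('c \<Rightarrow>\<^sub>0 'k::field) \<Rightarrow> ('d \<Rightarrow>\<^sub>0 'k)" where
  "basis_ext g f = (\<Sum>c\<in>Poly_Mapping.keys f. lscale (Poly_Mapping.lookup f c) (g c))"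

lemma basis_ext_superset:
  assumes "finite K" "Poly_Mapping.keys f \<subseteq> K"
  shows "basis_ext g f = (\<Sum>c\<in>K. lscale (Poly_Mapping.lookup f c) (g c))"
  unfolding basis_ext_def
  by (rule sum.mono_neutral_left) (use assms in \<open>auto simp: in_keys_iff\<close>)

lemma basis_ext_zero [simp]: "basis_ext g 0 = 0"
  by (simp add: basis_ext_def)

lemma basis_ext_add: "basis_ext g (f + f') = basis_ext g f + basis_ext g f'"
proof -
  let ?K = "Poly_Mapping.keys f \<union> Poly_Mapping.keys f'"
  have "basis_ext g (f + f') = (\<Sum>c\<in>?K. lscale (Poly_Mapping.lookup (f + f') c) (g c))"
    by (rule basis_ext_superset) (use Poly_Mapping.keys_add[of f f'] in auto)
  also have "\<dots> = basis_ext g f + basis_ext g f'"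
    using basis_ext_superset[of ?K f g] basis_ext_superset[of ?K f' g]
    by (simp add: lookup_add lscale.scale_left_distrib sum.distrib)
  finally show ?thesis .
qed

lemma basis_ext_scale: "basis_ext g (lscale k f) = lscale k (basis_ext g f)"
  using basis_ext_superset[OF finite_keys keys_lscale[of k f]]
  by (simp add: basis_ext_def lscale.scale_sum_right)

lemma basis_ext_single [simp]: "basis_ext g (Poly_Mapping.single c k) = lscale k (g c)"
  using basis_ext_superset[of "{c}" "Poly_Mapping.single c k" g] by simp

lemma basis_ext_fun_add: "basis_ext (\<lambda>c. g c + g' c) f = basis_ext g f + basis_ext g' f"
  by (simp add: basis_ext_def lscale_add sum.distrib)

lemma basis_ext_fun_scale: "basis_ext (\<lambda>c. lscale k (g c)) f = lscale k (basis_ext g f)"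
  by (simp add: basis_ext_def lscale.scale_sum_right mult.commute)

locale super_tensor_product = A: superalgebra A + B: superalgebra B
  for A :: "('k::field, 'a) superalgebra" and B :: "('l::field, 'b) superalgebra" +
  fixes j :: "'k \<Rightarrow> 'l"
  assumes j: "field_embedding j"
begin

abbreviation T :: "('l, ('a \<times> 'b) \<Rightarrow>\<^sub>0 'l) superalgebra" where "T \<equiv> formal_tensors A B"
abbreviation N where "N \<equiv> tensor_null j A B"
abbreviation ft :: "'a \<Rightarrow> 'b \<Rightarrow> ('a \<times> 'b) \<Rightarrow>\<^sub>0 'l" where "ft a b \<equiv> formal_tensor a b"

lemma T_simps [simp]:
  "\<one>\<^bsub>T\<^esub> = ft \<one>\<^bsub>A\<^esub> \<one>\<^bsub>B\<^esub>" "\<zero>\<^bsub>T\<^esub> = 0" "x \<oplus>\<^bsub>T\<^esub> y = x + y" "k \<odot>\<^bsub>T\<^esub> x = lscale k x"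
  by (simp_all add: formal_tensors_def)

lemma carrier_T: "x \<in> carrier T \<longleftrightarrow> Poly_Mapping.keys x \<subseteq> carrier A \<times> carrier B"
  by (simp add: formal_tensors_def)

lemma homog_T: "x \<in> homog T u \<longleftrightarrow> Poly_Mapping.keys x \<subseteq> (\<Union>s. homog A s \<times> homog B (u - s))"
  by (simp add: formal_tensors_def)

text \<open>The product of two basis tensors. Their entries need not be homogeneous, whence the sum over
parities.\<close>

definition ft_mult :: "'a \<times> 'b \<Rightarrow> 'a \<times> 'b \<Rightarrow> ('a \<times> 'b) \<Rightarrow>\<^sub>0 'l" where
  "ft_mult x y = (\<Sum>s\<in>{0, 1}. \<Sum>t\<in>{0, 1}. lscale (bit_sign (s * t))
     (ft (fst x \<otimes>\<^bsub>A\<^esub> hcomp A t (fst y)) (hcomp B s (snd x) \<otimes>\<^bsub>B\<^esub> snd y)))"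

lemma mult_T: "x \<otimes>\<^bsub>T\<^esub> y = basis_ext (\<lambda>c'. basis_ext (ft_mult c') y) x"
proof -
  have "x \<otimes>\<^bsub>T\<^esub> y = (\<Sum>c'\<in>Poly_Mapping.keys x. \<Sum>c\<in>Poly_Mapping.keys y.
      lscale (Poly_Mapping.lookup x c') (lscale (Poly_Mapping.lookup y c) (ft_mult c' c)))"
    unfolding formal_tensors_def formal_tensor_mult_def ft_mult_def
    by (simp add: lscale.scale_sum_right case_prod_unfold mult_ac lscale_add)
  then show ?thesis
    by (simp add: basis_ext_def lscale.scale_sum_right)
qed

lemma mult_T_add_left: "(x + y) \<otimes>\<^bsub>T\<^esub> z = x \<otimes>\<^bsub>T\<^esub> z + y \<otimes>\<^bsub>T\<^esub> z"
  by (simp add: mult_T basis_ext_add)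

lemma mult_T_scale_left: "lscale k x \<otimes>\<^bsub>T\<^esub> z = lscale k (x \<otimes>\<^bsub>T\<^esub> z)"
  by (simp add: mult_T basis_ext_scale)

lemma mult_T_add_right: "z \<otimes>\<^bsub>T\<^esub> (x + y) = z \<otimes>\<^bsub>T\<^esub> x + z \<otimes>\<^bsub>T\<^esub> y"
  by (simp add: mult_T basis_ext_add basis_ext_fun_add)

lemma mult_T_scale_right: "z \<otimes>\<^bsub>T\<^esub> lscale k x = lscale k (z \<otimes>\<^bsub>T\<^esub> x)"
  by (simp add: mult_T basis_ext_scale basis_ext_fun_scale)

lemma mult_T_ft: "ft a b \<otimes>\<^bsub>T\<^esub> ft a' b' = ft_mult (a, b) (a', b')"
  by (simp add: mult_T)

lemma mult_T_zero [simp]: "0 \<otimes>\<^bsub>T\<^esub> z = 0" "z \<otimes>\<^bsub>T\<^esub> 0 = 0"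
  by (simp_all add: mult_T basis_ext_def)

lemma mult_T_diff_left: "(x - y) \<otimes>\<^bsub>T\<^esub> z = x \<otimes>\<^bsub>T\<^esub> z - y \<otimes>\<^bsub>T\<^esub> z"
  using mult_T_add_left[of "x - y" y z] by simp

lemma mult_T_diff_right: "z \<otimes>\<^bsub>T\<^esub> (x - y) = z \<otimes>\<^bsub>T\<^esub> x - z \<otimes>\<^bsub>T\<^esub> y"
  using mult_T_add_right[of z "x - y" y] by simp

subsection \<open>The balancing relations\<close>

lemma N_zero: "0 \<in> N" and N_add: "\<lbrakk>x \<in> N; y \<in> N\<rbrakk> \<Longrightarrow> x + y \<in> N"
  and N_diff: "\<lbrakk>x \<in> N; y \<in> N\<rbrakk> \<Longrightarrow> x - y \<in> N"
  and N_scale: "x \<in> N \<Longrightarrow> lscale k x \<in> N"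
  by (simp_all add: tensor_null_def lscale.span_zero lscale.span_add lscale.span_diff lscale.span_scale)

lemma N_sum: "(\<And>i. i \<in> S \<Longrightarrow> x i \<in> N) \<Longrightarrow> sum x S \<in> N"
  unfolding tensor_null_def by (rule lscale.span_sum)

lemma N_trans: "\<lbrakk>x - y \<in> N; y - z \<in> N\<rbrakk> \<Longrightarrow> x - z \<in> N"
  using N_add[of "x - y" "y - z"] by simp

lemma N_cong: "x - y \<in> N \<Longrightarrow> x \<in> N \<longleftrightarrow> y \<in> N"
  using N_add[of "x - y" y] N_diff[of x "x - y"] by auto

lemma balance:
  "\<lbrakk>a \<in> carrier A; a' \<in> carrier A; b \<in> carrier B\<rbrakk> \<Longrightarrow> ft (a \<oplus>\<^bsub>A\<^esub> a') b - ft a b - ft a' b \<in> N"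
  "\<lbrakk>a \<in> carrier A; b \<in> carrier B; b' \<in> carrier B\<rbrakk> \<Longrightarrow> ft a (b \<oplus>\<^bsub>B\<^esub> b') - ft a b - ft a b' \<in> N"
  "\<lbrakk>a \<in> carrier A; b \<in> carrier B\<rbrakk> \<Longrightarrow> ft (k \<odot>\<^bsub>A\<^esub> a) b - lscale (j k) (ft a b) \<in> N"
  "\<lbrakk>a \<in> carrier A; b \<in> carrier B\<rbrakk> \<Longrightarrow> ft a (l \<odot>\<^bsub>B\<^esub> b) - lscale l (ft a b) \<in> N"
  unfolding tensor_null_def tensor_relations_def by (rule lscale.span_base, blast)+

lemma ft_zero: "b \<in> carrier B \<Longrightarrow> ft \<zero>\<^bsub>A\<^esub> b \<in> N" "a \<in> carrier A \<Longrightarrow> ft a \<zero>\<^bsub>B\<^esub> \<in> N"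
  using N_diff[OF N_zero balance(1)[of "\<zero>\<^bsub>A\<^esub>" "\<zero>\<^bsub>A\<^esub>" b]]
    N_diff[OF N_zero balance(2)[of a "\<zero>\<^bsub>B\<^esub>" "\<zero>\<^bsub>B\<^esub>"]] by simp_all

text \<open>A linear map out of the formal tensors sends all of \<open>N\<close> to a subspace once it sends the
  balancing relations there.\<close>

lemma N_induct [consumes 1, case_names zero add scale left_add right_add left_scale right_scale]:
  assumes "x \<in> N" and "P 0" and "\<And>x y. \<lbrakk>P x; P y\<rbrakk> \<Longrightarrow> P (x + y)" and "\<And>k x. P x \<Longrightarrow> P (lscale k x)"
    and "\<And>a a' b. \<lbrakk>a \<in> carrier A; a' \<in> carrier A; b \<in> carrier B\<rbrakk> \<Longrightarrow> P (ft (a \<oplus>\<^bsub>A\<^esub> a') b - ft a b - ft a' b)"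
    and "\<And>a b b'. \<lbrakk>a \<in> carrier A; b \<in> carrier B; b' \<in> carrier B\<rbrakk> \<Longrightarrow> P (ft a (b \<oplus>\<^bsub>B\<^esub> b') - ft a b - ft a b')"
    and "\<And>k a b. \<lbrakk>a \<in> carrier A; b \<in> carrier B\<rbrakk> \<Longrightarrow> P (ft (k \<odot>\<^bsub>A\<^esub> a) b - lscale (j k) (ft a b))"
    and "\<And>l a b. \<lbrakk>a \<in> carrier A; b \<in> carrier B\<rbrakk> \<Longrightarrow> P (ft a (l \<odot>\<^bsub>B\<^esub> b) - lscale l (ft a b))"
  shows "P x"
  using assms(1) unfolding tensor_null_def
proof (induction rule: lscale.span_induct)
  show "lscale.subspace (Collect P)"
    by (rule lscale.subspaceI) (simp_all add: assms(2,3,4))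
next
  fix x assume "x \<in> tensor_relations j A B"
  then show "P x"
    unfolding tensor_relations_def
    by (elim UnE CollectE exE conjE) (simp_all only: assms(5,6,7,8))
qed

lemma ft_carrier [simp]: "\<lbrakk>a \<in> carrier A; b \<in> carrier B\<rbrakk> \<Longrightarrow> Poly_Mapping.single (a, b) k \<in> carrier T"
  by (simp add: carrier_T)

lemma T_carrier_closed [simp]:
  "0 \<in> carrier T" "\<lbrakk>x \<in> carrier T; y \<in> carrier T\<rbrakk> \<Longrightarrow> x + y \<in> carrier T"
  "x \<in> carrier T \<Longrightarrow> lscale k x \<in> carrier T" "x \<in> carrier T \<Longrightarrow> - x \<in> carrier T"
  "\<lbrakk>x \<in> carrier T; y \<in> carrier T\<rbrakk> \<Longrightarrow> x - y \<in> carrier T"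
  using Poly_Mapping.keys_add[of x y] keys_minus_subset[of x y] keys_lscale[of k x]
  by (auto simp: carrier_T)

lemma T_sum_closed: "(\<And>i. i \<in> S \<Longrightarrow> x i \<in> carrier T) \<Longrightarrow> sum x S \<in> carrier T"
  by (induction S rule: infinite_finite_induct) simp_all

lemma N_carrier: "x \<in> N \<Longrightarrow> x \<in> carrier T"
  by (induction rule: N_induct) simp_all

lemma T_induct [consumes 1, case_names zero single add]:
  assumes "x \<in> carrier T" and "P 0"
    and "\<And>a b k. \<lbrakk>a \<in> carrier A; b \<in> carrier B\<rbrakk> \<Longrightarrow> P (lscale k (ft a b))"
    and "\<And>x y. \<lbrakk>x \<in> carrier T; y \<in> carrier T; P x; P y\<rbrakk> \<Longrightarrow> P (x + y)"
  shows "P x"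
  using assms(1) unfolding carrier_T
proof (induction x rule: poly_mapping_linear_induct)
  case (single c k)
  then show ?case using assms(3)[of "fst c" "snd c" k] by auto
qed (use assms carrier_T in auto)

lemma ft_mult_closed: "\<lbrakk>a \<in> carrier A; b \<in> carrier B; a' \<in> carrier A; b' \<in> carrier B\<rbrakk> \<Longrightarrow>
    ft_mult (a, b) (a', b') \<in> carrier T"
  unfolding ft_mult_def by (intro T_sum_closed T_carrier_closed(3)) simp

lemma mult_T_closed: "\<lbrakk>x \<in> carrier T; y \<in> carrier T\<rbrakk> \<Longrightarrow> x \<otimes>\<^bsub>T\<^esub> y \<in> carrier T"
proof (induction x rule: T_induct)
  case (single a b k)
  from single(3) show ?case
    by (induction y rule: T_induct)
      (use single in \<open>simp_all add: mult_T_scale_left mult_T_scale_right mult_T_add_right mult_T_ft ft_mult_closed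
        del: lscale_single\<close>)
qed (simp_all add: mult_T_add_left)

text \<open>The product of formal tensors is additive and homogeneous in each of its four arguments up to
  \<open>N\<close>, so \<open>N\<close> absorbs products.\<close>

lemma N_sums:
  assumes "\<And>s t. lscale (bit_sign (s * t)) (x s t) - lscale (bit_sign (s * t)) (y s t) - lscale (bit_sign (s * t)) (z s t) \<in> N"
  shows "(\<Sum>s\<in>{0::bit, 1}. \<Sum>t\<in>{0::bit, 1}. lscale (bit_sign (s * t)) (x s t))
    - (\<Sum>s\<in>{0, 1}. \<Sum>t\<in>{0, 1}. lscale (bit_sign (s * t)) (y s t))
    - (\<Sum>s\<in>{0, 1}. \<Sum>t\<in>{0, 1}. lscale (bit_sign (s * t)) (z s t)) \<in> N"
  unfolding sum_subtractf[symmetric] by (intro N_sum assms)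

lemma ft_mult_add:
  assumes "a \<in> carrier A" "a' \<in> carrier A" "b \<in> carrier B" "b' \<in> carrier B" "c \<in> carrier A" "d \<in> carrier B"
  shows "ft_mult (a \<oplus>\<^bsub>A\<^esub> a', b) (c, d) - ft_mult (a, b) (c, d) - ft_mult (a', b) (c, d) \<in> N"
    and "ft_mult (a, b \<oplus>\<^bsub>B\<^esub> b') (c, d) - ft_mult (a, b) (c, d) - ft_mult (a, b') (c, d) \<in> N"
    and "ft_mult (c, d) (a \<oplus>\<^bsub>A\<^esub> a', b) - ft_mult (c, d) (a, b) - ft_mult (c, d) (a', b) \<in> N"
    and "ft_mult (c, d) (a, b \<oplus>\<^bsub>B\<^esub> b') - ft_mult (c, d) (a, b) - ft_mult (c, d) (a, b') \<in> N"
  unfolding ft_mult_def fst_conv snd_conv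
  by (rule N_sums, unfold lscale.scale_right_diff_distrib[symmetric], rule N_scale,
      use assms in \<open>simp add: A.l_distr A.r_distr B.l_distr B.r_distr A.hcomp_add B.hcomp_add balance\<close>)+

lemma ft_mult_scale:
  assumes "a \<in> carrier A" "b \<in> carrier B" "c \<in> carrier A" "d \<in> carrier B"
  shows "ft_mult (k \<odot>\<^bsub>A\<^esub> a, b) (c, d) - lscale (j k) (ft_mult (a, b) (c, d)) \<in> N"
    and "ft_mult (a, l \<odot>\<^bsub>B\<^esub> b) (c, d) - lscale l (ft_mult (a, b) (c, d)) \<in> N"
    and "ft_mult (c, d) (k \<odot>\<^bsub>A\<^esub> a, b) - lscale (j k) (ft_mult (c, d) (a, b)) \<in> N"
    and "ft_mult (c, d) (a, l \<odot>\<^bsub>B\<^esub> b) - lscale l (ft_mult (c, d) (a, b)) \<in> N"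
proof -
  have swap: "lscale m (\<Sum>s\<in>{0::bit, 1}. \<Sum>t\<in>{0::bit, 1}. lscale (bit_sign (s * t)) (x s t)) =
      (\<Sum>s\<in>{0, 1}. \<Sum>t\<in>{0, 1}. lscale (bit_sign (s * t)) (lscale m (x s t)))" for m x
    unfolding lscale.scale_sum_right by (simp only: lscale.scale_scale mult.commute)
  show "ft_mult (k \<odot>\<^bsub>A\<^esub> a, b) (c, d) - lscale (j k) (ft_mult (a, b) (c, d)) \<in> N"
    "ft_mult (a, l \<odot>\<^bsub>B\<^esub> b) (c, d) - lscale l (ft_mult (a, b) (c, d)) \<in> N"
    "ft_mult (c, d) (k \<odot>\<^bsub>A\<^esub> a, b) - lscale (j k) (ft_mult (c, d) (a, b)) \<in> N"
    "ft_mult (c, d) (a, l \<odot>\<^bsub>B\<^esub> b) - lscale l (ft_mult (c, d) (a, b)) \<in> N"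
    unfolding ft_mult_def fst_conv snd_conv swap sum_subtractf[symmetric]
      lscale.scale_right_diff_distrib[symmetric]
    by (rule N_sum, rule N_sum, rule N_scale,
        use assms in \<open>simp add: A.smult_mult_left A.smult_mult_right B.smult_mult_left B.smult_mult_right
          A.hcomp_scale B.hcomp_scale balance del: lscale_single\<close>)+
qed

lemma N_mult_right: "\<lbrakk>y \<in> carrier T; x \<in> N\<rbrakk> \<Longrightarrow> x \<otimes>\<^bsub>T\<^esub> y \<in> N"
proof (induction y rule: T_induct)
  case (single c d k)
  have "x \<otimes>\<^bsub>T\<^esub> ft c d \<in> N"
    using single(3)
    by (induction x rule: N_induct)
      (use single(1,2) in \<open>simp_all add: N_zero N_add N_scale mult_T_add_left mult_T_diff_left mult_T_scale_left
        mult_T_ft ft_mult_add ft_mult_scale del: lscale_single\<close>)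
  then show ?case by (simp add: mult_T_scale_right N_scale del: lscale_single)
qed (simp_all add: N_zero N_add mult_T_add_right)

lemma N_mult_left: "\<lbrakk>y \<in> carrier T; x \<in> N\<rbrakk> \<Longrightarrow> y \<otimes>\<^bsub>T\<^esub> x \<in> N"
proof (induction y rule: T_induct)
  case (single c d k)
  have "ft c d \<otimes>\<^bsub>T\<^esub> x \<in> N"
    using single(3)
    by (induction x rule: N_induct)
      (use single(1,2) in \<open>simp_all add: N_zero N_add N_scale mult_T_add_right mult_T_diff_right mult_T_scale_right
        mult_T_ft ft_mult_add ft_mult_scale del: lscale_single\<close>)
  then show ?case by (simp add: mult_T_scale_left N_scale del: lscale_single)
qed (simp_all add: N_zero N_add mult_T_add_left)

text \<open>Up to \<open>N\<close> every formal tensor is a combination of tensors of homogeneous elements.\<close>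

lemma T_homog_induct [consumes 1, case_names zero single add cong]:
  assumes "x \<in> carrier T" and "P 0"
    and single: "\<And>a b s t k. \<lbrakk>a \<in> homog A s; b \<in> homog B t\<rbrakk> \<Longrightarrow> P (lscale k (ft a b))"
    and add: "\<And>x y. \<lbrakk>x \<in> carrier T; y \<in> carrier T; P x; P y\<rbrakk> \<Longrightarrow> P (x + y)"
    and cong: "\<And>x y. \<lbrakk>x \<in> carrier T; y \<in> carrier T; x - y \<in> N; P y\<rbrakk> \<Longrightarrow> P x"
  shows "P x"
  using assms(1)
proof (induction x rule: T_induct)
  case (single a b k)
  let ?a = "\<lambda>s. hcomp A s a" and ?b = "\<lambda>s. hcomp B s b"
  have a: "ft a b - ft (?a 0) b - ft (?a 1) b \<in> N"
    using balance(1)[of "?a 0" "?a 1" b] A.hcomp_decomp(2)[of a 0] single by simp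
  have b: "ft (?a s) b - ft (?a s) (?b 0) - ft (?a s) (?b 1) \<in> N" for s
    using balance(2)[of "?a s" "?b 0" "?b 1"] B.hcomp_decomp(2)[of b 0] single by simp
  let ?y = "ft (?a 0) (?b 0) + ft (?a 0) (?b 1) + (ft (?a 1) (?b 0) + ft (?a 1) (?b 1))"
  have "ft a b - ?y \<in> N"
    using N_add[OF a N_add[OF b[of 0] b[of 1]]] by (simp add: algebra_simps)
  then have "lscale k (ft a b) - lscale k ?y \<in> N"
    using N_scale by (metis lscale.scale_right_diff_distrib)
  moreover have "P (lscale k (ft (?a s) (?b t)))" for s t
    by (rule assms(3)) (use A.hcomp_decomp(1) B.hcomp_decomp(1) single in auto)
  then have "P (lscale k ?y)"
    unfolding lscale_add using single by (intro add T_carrier_closed ft_carrier) auto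
  ultimately show ?case
    using single by (intro cong[of "lscale k (ft a b)" "lscale k ?y"] T_carrier_closed ft_carrier) auto
qed (use assms in auto)

text \<open>For homogeneous inner entries all but one of the four summands contain a zero entry, and
tensors with a zero entry lie in \<open>N\<close>.\<close>

lemma ft_mult_homog:
  assumes "a \<in> carrier A" "b \<in> homog B t" "a' \<in> homog A s" "b' \<in> carrier B"
  shows "ft_mult (a, b) (a', b') - lscale (bit_sign (t * s)) (ft (a \<otimes>\<^bsub>A\<^esub> a') (b \<otimes>\<^bsub>B\<^esub> b')) \<in> N"
proof -
  let ?X = "ft (a \<otimes>\<^bsub>A\<^esub> a') (b \<otimes>\<^bsub>B\<^esub> b')"
  have c: "a' \<in> carrier A" "b \<in> carrier B" using assms by auto
  have delta: "lscale (bit_sign (t * s)) ?X =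
      (\<Sum>s'\<in>{0, 1}. \<Sum>t'\<in>{0, 1}. if s' = t \<and> t' = s then lscale (bit_sign (s' * t')) ?X else 0)"
    by (cases s; cases t) simp_all
  show ?thesis
    unfolding ft_mult_def fst_conv snd_conv A.hcomp_homog[OF assms(3)] B.hcomp_homog[OF assms(2)]
      delta sum_subtractf[symmetric]
    by (intro N_sum) (use c assms in \<open>simp add: N_zero N_scale ft_zero del: lscale_single\<close>)
qed

text \<open>The component of degree \<open>u\<close> of a formal tensor. It respects the balancing relations, so the
  two components of the tensor product meet only in zero.\<close>

definition T_comp :: "bit \<Rightarrow> (('a \<times> 'b) \<Rightarrow>\<^sub>0 'l) \<Rightarrow> (('a \<times> 'b) \<Rightarrow>\<^sub>0 'l)" where
  "T_comp u = basis_ext (\<lambda>c. \<Sum>s\<in>{0, 1}. ft (hcomp A s (fst c)) (hcomp B (u - s) (snd c)))"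

lemma T_comp_linear:
  "T_comp u 0 = 0" "T_comp u (x + y) = T_comp u x + T_comp u y" "T_comp u (lscale k x) = lscale k (T_comp u x)"
  by (simp_all add: T_comp_def basis_ext_add basis_ext_scale)

lemma T_comp_diff: "T_comp u (x - y) = T_comp u x - T_comp u y"
  using T_comp_linear(2)[of u "x - y" y] by simp

lemma T_comp_ft: "T_comp u (ft a b) = (\<Sum>s\<in>{0, 1}. ft (hcomp A s a) (hcomp B (u - s) b))"
  by (simp add: T_comp_def)

lemma T_comp_N: "x \<in> N \<Longrightarrow> T_comp u x \<in> N"
proof (induction rule: N_induct)
  case (left_add a a' b)
  then show ?case
    unfolding T_comp_diff T_comp_ft sum_subtractf[symmetric]
    by (intro N_sum) (simp add: A.hcomp_add balance)
next
  case (right_add a b b')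
  then show ?case
    unfolding T_comp_diff T_comp_ft sum_subtractf[symmetric]
    by (intro N_sum) (simp add: B.hcomp_add balance)
next
  case (left_scale k a b)
  then show ?case
    unfolding T_comp_diff T_comp_linear T_comp_ft lscale.scale_sum_right sum_subtractf[symmetric]
    by (intro N_sum) (simp add: A.hcomp_scale balance del: lscale_single)
next
  case (right_scale l a b)
  then show ?case
    unfolding T_comp_diff T_comp_linear T_comp_ft lscale.scale_sum_right sum_subtractf[symmetric]
    by (intro N_sum) (simp add: B.hcomp_scale balance del: lscale_single)
qed (simp_all add: T_comp_linear N_zero N_add N_scale)

lemma homog_T_induct [consumes 1, case_names zero single add]:
  assumes "x \<in> homog T u" and "P 0"
    and "\<And>a b k s. \<lbrakk>a \<in> homog A s; b \<in> homog B (u - s)\<rbrakk> \<Longrightarrow> P (lscale k (ft a b))"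
    and "\<And>x y. \<lbrakk>x \<in> homog T u; y \<in> homog T u; P x; P y\<rbrakk> \<Longrightarrow> P (x + y)"
  shows "P x"
  using assms(1) unfolding homog_T
proof (induction x rule: poly_mapping_linear_induct)
  case (single c k)
  then obtain s where "fst c \<in> homog A s" "snd c \<in> homog B (u - s)" by auto
  from assms(3)[OF this, of k] show ?case by simp
qed (use assms homog_T in auto)

lemma T_comp_homog: "x \<in> homog T t \<Longrightarrow> T_comp u x - (if u = t then x else 0) \<in> N"
proof (induction x rule: homog_T_induct)
  case zero
  show ?case by (simp add: T_comp_linear N_zero)
next
  case (add x y)
  then show ?case using N_add[OF add.IH] by (simp add: T_comp_linear algebra_simps split: if_splits)
next
  case (single a b k s)
  have c: "a \<in> carrier A" "b \<in> carrier B" using single by auto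
  have delta: "(if u = t then ft a b else 0) =
      (\<Sum>s'\<in>{0, 1}. if s' = s \<and> u - s' = t - s then ft a b else 0)"
    by (cases s; cases u; cases t) simp_all
  have "T_comp u (ft a b) - (if u = t then ft a b else 0) \<in> N"
    unfolding T_comp_ft A.hcomp_homog[OF single(1)] B.hcomp_homog[OF single(2)] delta
      sum_subtractf[symmetric]
    by (intro N_sum) (use c in \<open>simp add: N_zero ft_zero\<close>)
  from N_scale[OF this, of k] show ?case
    by (simp add: T_comp_linear lscale.scale_right_diff_distrib split: if_splits del: lscale_single)
qed

lemma homog_T_ft: "\<lbrakk>a \<in> homog A s; b \<in> homog B t\<rbrakk> \<Longrightarrow> ft a b \<in> homog T (s + t)"
  by (cases s; cases t) (auto simp: homog_T)

lemma homog_T_closed: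
  "x \<in> homog T u \<Longrightarrow> x \<in> carrier T" "0 \<in> homog T u"
  "\<lbrakk>x \<in> homog T u; y \<in> homog T u\<rbrakk> \<Longrightarrow> x + y \<in> homog T u" "x \<in> homog T u \<Longrightarrow> lscale k x \<in> homog T u"
  using Poly_Mapping.keys_add[of x y] keys_lscale[of k x] A.homog_carrier B.homog_carrier
  unfolding homog_T carrier_T by (blast, simp, blast, blast)

lemma homog_T_mult:
  assumes "x \<in> homog T s" "y \<in> homog T t"
  shows "\<exists>z\<in>homog T (s + t). x \<otimes>\<^bsub>T\<^esub> y - z \<in> N"
  using assms(1)
proof (induction x rule: homog_T_induct)
  case zero
  show ?case using homog_T_closed(2) N_zero by (intro bexI[of _ 0]) simp_all
next
  case (add x x')
  then obtain z z' where "z \<in> homog T (s + t)" "x \<otimes>\<^bsub>T\<^esub> y - z \<in> N" "z' \<in> homog T (s + t)" "x' \<otimes>\<^bsub>T\<^esub> y - z' \<in> N"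
    by blast
  then show ?case
    using N_add[of "x \<otimes>\<^bsub>T\<^esub> y - z" "x' \<otimes>\<^bsub>T\<^esub> y - z'"]
    by (intro bexI[of _ "z + z'"]) (simp_all add: homog_T_closed mult_T_add_left algebra_simps)
next
  case (single a b k p)
  have "\<exists>z\<in>homog T (s + t). ft a b \<otimes>\<^bsub>T\<^esub> y - z \<in> N"
    using assms(2)
  proof (induction y rule: homog_T_induct)
    case zero
    show ?case using homog_T_closed(2) N_zero by (intro bexI[of _ 0]) simp_all
  next
    case (add x x')
    then obtain z z' where "z \<in> homog T (s + t)" "ft a b \<otimes>\<^bsub>T\<^esub> x - z \<in> N"
      "z' \<in> homog T (s + t)" "ft a b \<otimes>\<^bsub>T\<^esub> x' - z' \<in> N"
      by blast
    then show ?case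
      using N_add[of "ft a b \<otimes>\<^bsub>T\<^esub> x - z" "ft a b \<otimes>\<^bsub>T\<^esub> x' - z'"]
      by (intro bexI[of _ "z + z'"]) (simp_all add: homog_T_closed mult_T_add_right algebra_simps)
  next
    case (single a' b' l r)
    note ab = \<open>a \<in> homog A p\<close> \<open>b \<in> homog B (s - p)\<close>
    let ?z = "lscale (bit_sign ((s - p) * r)) (ft (a \<otimes>\<^bsub>A\<^esub> a') (b \<otimes>\<^bsub>B\<^esub> b'))"
    have "(p + r) + ((s - p) + (t - r)) = s + t"
      by (cases s; cases t; cases p; cases r) simp_all
    then have "?z \<in> homog T (s + t)"
      using homog_T_ft[OF A.homog_mult[OF ab(1) single(1)] B.homog_mult[OF ab(2) single(2)]]
      by (simp add: homog_T_closed del: lscale_single)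
    moreover have "ft a b \<otimes>\<^bsub>T\<^esub> ft a' b' - ?z \<in> N"
      unfolding mult_T_ft using ab single by (intro ft_mult_homog) auto
    ultimately show ?case
      using N_scale[of "ft a b \<otimes>\<^bsub>T\<^esub> ft a' b' - ?z" l]
      by (intro bexI[of _ "lscale l ?z"])
        (simp_all add: homog_T_closed mult_T_scale_right lscale.scale_right_diff_distrib
          del: lscale_single lscale.scale_scale)
  qed
  then obtain z where "z \<in> homog T (s + t)" "ft a b \<otimes>\<^bsub>T\<^esub> y - z \<in> N" by blast
  then show ?case
    using N_scale[of "ft a b \<otimes>\<^bsub>T\<^esub> y - z" k]
    by (intro bexI[of _ "lscale k z"])
      (simp_all add: homog_T_closed mult_T_scale_left lscale.scale_right_diff_distrib del: lscale_single)
qed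

lemma T_one_mult: "x \<in> carrier T \<Longrightarrow> ft \<one>\<^bsub>A\<^esub> \<one>\<^bsub>B\<^esub> \<otimes>\<^bsub>T\<^esub> x - x \<in> N"
proof (induction x rule: T_homog_induct)
  case (single a b s t k)
  have "ft \<one>\<^bsub>A\<^esub> \<one>\<^bsub>B\<^esub> \<otimes>\<^bsub>T\<^esub> ft a b - ft a b \<in> N"
    using ft_mult_homog[OF A.one_closed B.homog_one single(1), of b] single by (simp add: mult_T_ft)
  from N_scale[OF this, of k] show ?case
    by (simp add: mult_T_scale_right lscale.scale_right_diff_distrib del: lscale_single)
next
  case (add x y)
  then show ?case using N_add[OF add.IH] by (simp add: mult_T_add_right algebra_simps)
next
  case (cong x y)
  have "ft \<one>\<^bsub>A\<^esub> \<one>\<^bsub>B\<^esub> \<otimes>\<^bsub>T\<^esub> (x - y) - (x - y) \<in> N"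
    using cong by (intro N_diff[OF N_mult_left]) simp_all
  from N_add[OF this cong(4)] show ?case by (simp add: mult_T_diff_right)
qed (simp add: N_zero)

lemma T_mult_one: "x \<in> carrier T \<Longrightarrow> x \<otimes>\<^bsub>T\<^esub> ft \<one>\<^bsub>A\<^esub> \<one>\<^bsub>B\<^esub> - x \<in> N"
proof (induction x rule: T_homog_induct)
  case (single a b s t k)
  have "ft a b \<otimes>\<^bsub>T\<^esub> ft \<one>\<^bsub>A\<^esub> \<one>\<^bsub>B\<^esub> - ft a b \<in> N"
    using ft_mult_homog[OF _ single(2) A.homog_one B.one_closed, of a] single by (simp add: mult_T_ft)
  from N_scale[OF this, of k] show ?case
    by (simp add: mult_T_scale_left lscale.scale_right_diff_distrib del: lscale_single)
next
  case (add x y)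
  then show ?case using N_add[OF add.IH] by (simp add: mult_T_add_left algebra_simps)
next
  case (cong x y)
  have "(x - y) \<otimes>\<^bsub>T\<^esub> ft \<one>\<^bsub>A\<^esub> \<one>\<^bsub>B\<^esub> - (x - y) \<in> N"
    using cong by (intro N_diff[OF N_mult_right]) simp_all
  from N_add[OF this cong(4)] show ?case by (simp add: mult_T_diff_left)
qed (simp add: N_zero)

text \<open>Associativity up to \<open>N\<close>: the associator is trilinear and vanishes up to \<open>N\<close> whenever an
  argument lies in \<open>N\<close>, so it may be computed on homogeneous tensors, where both bracketings
  carry the sign \<open>(-1)\<^bsup>t s' + t s'' + t' s''\<^esup>\<close>.\<close>

definition T_assoc where "T_assoc x y z = (x \<otimes>\<^bsub>T\<^esub> y) \<otimes>\<^bsub>T\<^esub> z - x \<otimes>\<^bsub>T\<^esub> (y \<otimes>\<^bsub>T\<^esub> z)"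

lemma T_assoc_linear:
  "T_assoc 0 y z = 0" "T_assoc x 0 z = 0" "T_assoc x y 0 = 0"
  "T_assoc (x + x') y z = T_assoc x y z + T_assoc x' y z"
  "T_assoc x (y + y') z = T_assoc x y z + T_assoc x y' z"
  "T_assoc x y (z + z') = T_assoc x y z + T_assoc x y z'"
  "T_assoc (lscale k x) y z = lscale k (T_assoc x y z)"
  "T_assoc x (lscale k y) z = lscale k (T_assoc x y z)"
  "T_assoc x y (lscale k z) = lscale k (T_assoc x y z)"
  by (simp_all add: T_assoc_def mult_T_add_left mult_T_add_right mult_T_scale_left mult_T_scale_right
      lscale.scale_right_diff_distrib)

lemma T_assoc_N:
  assumes "x \<in> carrier T" "y \<in> carrier T" "n \<in> N"
  shows "T_assoc n x y \<in> N" "T_assoc x n y \<in> N" "T_assoc x y n \<in> N"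
  unfolding T_assoc_def using assms
  by (simp_all add: N_diff N_mult_left N_mult_right mult_T_closed N_carrier)

lemma ft_mult_assoc:
  assumes h: "a \<in> homog A s" "b \<in> homog B t" "a' \<in> homog A s'" "b' \<in> homog B t'"
    "a'' \<in> homog A s''" "b'' \<in> homog B t''"
  shows "T_assoc (ft a b) (ft a' b') (ft a'' b'') \<in> N"
proof -
  have c: "a \<in> carrier A" "b \<in> carrier B" "a' \<in> carrier A" "b' \<in> carrier B" "a'' \<in> carrier A" "b'' \<in> carrier B"
    using h by auto
  let ?e = "bit_sign (t * s' + t * s'' + t' * s'') :: 'l"
  let ?X = "ft (a \<otimes>\<^bsub>A\<^esub> a' \<otimes>\<^bsub>A\<^esub> a'') (b \<otimes>\<^bsub>B\<^esub> b' \<otimes>\<^bsub>B\<^esub> b'')"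
  let ?Y = "ft (a \<otimes>\<^bsub>A\<^esub> a') (b \<otimes>\<^bsub>B\<^esub> b')" and ?Z = "ft (a' \<otimes>\<^bsub>A\<^esub> a'') (b' \<otimes>\<^bsub>B\<^esub> b'')"
  have "(ft a b \<otimes>\<^bsub>T\<^esub> ft a' b') \<otimes>\<^bsub>T\<^esub> ft a'' b'' - lscale (bit_sign (t * s')) ?Y \<otimes>\<^bsub>T\<^esub> ft a'' b'' \<in> N"
    unfolding mult_T_diff_left[symmetric] unfolding mult_T_ft
    by (intro N_mult_right ft_mult_homog) (use h c in simp_all)
  moreover have "lscale (bit_sign (t * s')) ?Y \<otimes>\<^bsub>T\<^esub> ft a'' b'' - lscale ?e ?X \<in> N"
  proof -
    have "?Y \<otimes>\<^bsub>T\<^esub> ft a'' b'' - lscale (bit_sign ((t + t') * s'')) ?X \<in> N"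
      unfolding mult_T_ft by (intro ft_mult_homog B.homog_mult) (use h c in simp_all)
    from N_scale[OF this, of "bit_sign (t * s')"] show ?thesis
      by (simp add: mult_T_scale_left lscale.scale_right_diff_distrib bit_sign_add algebra_simps del: lscale_single)
  qed
  ultimately have left: "(ft a b \<otimes>\<^bsub>T\<^esub> ft a' b') \<otimes>\<^bsub>T\<^esub> ft a'' b'' - lscale ?e ?X \<in> N"
    by (rule N_trans)
  have "ft a b \<otimes>\<^bsub>T\<^esub> (ft a' b' \<otimes>\<^bsub>T\<^esub> ft a'' b'') - ft a b \<otimes>\<^bsub>T\<^esub> lscale (bit_sign (t' * s'')) ?Z \<in> N"
    unfolding mult_T_diff_right[symmetric] unfolding mult_T_ft
    by (intro N_mult_left ft_mult_homog) (use h c in simp_all)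
  moreover have "ft a b \<otimes>\<^bsub>T\<^esub> lscale (bit_sign (t' * s'')) ?Z - lscale ?e ?X \<in> N"
  proof -
    have "ft a b \<otimes>\<^bsub>T\<^esub> ?Z - lscale (bit_sign (t * (s' + s''))) (ft (a \<otimes>\<^bsub>A\<^esub> (a' \<otimes>\<^bsub>A\<^esub> a'')) (b \<otimes>\<^bsub>B\<^esub> (b' \<otimes>\<^bsub>B\<^esub> b''))) \<in> N"
      unfolding mult_T_ft by (intro ft_mult_homog A.homog_mult) (use h c in simp_all)
    from N_scale[OF this, of "bit_sign (t' * s'')"] show ?thesis
      using c by (simp add: mult_T_scale_right lscale.scale_right_diff_distrib bit_sign_add algebra_simps
          A.m_assoc B.m_assoc del: lscale_single)
  qed
  ultimately have "ft a b \<otimes>\<^bsub>T\<^esub> (ft a' b' \<otimes>\<^bsub>T\<^esub> ft a'' b'') - lscale ?e ?X \<in> N"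
    by (rule N_trans)
  from N_diff[OF left this] show ?thesis by (simp add: T_assoc_def)
qed

lemma T_assoc_in_N:
  assumes "x \<in> carrier T" "y \<in> carrier T" "z \<in> carrier T"
  shows "T_assoc x y z \<in> N"
proof -
  have diff: "T_assoc (u - v) y z = T_assoc u y z - T_assoc v y z"
    "T_assoc x (u - v) z = T_assoc x u z - T_assoc x v z"
    "T_assoc x y (u - v) = T_assoc x y u - T_assoc x y v" for u v x y z
    using T_assoc_linear(4)[of "u - v" v y z] T_assoc_linear(5)[of x "u - v" v z]
      T_assoc_linear(6)[of x y "u - v" v] by simp_all
  show ?thesis
    using assms
  proof (induction x arbitrary: y z rule: T_homog_induct)
    case (cong x x')
    have "T_assoc (x - x') y z \<in> N" using cong by (intro T_assoc_N) simp_all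
    then show ?case using N_cong cong by (simp add: diff)
  next
    case x: (single a b s t k)
    have "T_assoc (ft a b) y z \<in> N"
      using x(3,4)
    proof (induction y arbitrary: z rule: T_homog_induct)
      case (cong y y')
      have "T_assoc (ft a b) (y - y') z \<in> N" using cong x by (intro T_assoc_N) simp_all
      then show ?case using N_cong cong by (simp add: diff)
    next
      case y: (single a' b' s' t' k')
      have "T_assoc (ft a b) (ft a' b') z \<in> N"
        using y(3)
      proof (induction z rule: T_homog_induct)
        case (cong z z')
        have "T_assoc (ft a b) (ft a' b') (z - z') \<in> N" using cong x y by (intro T_assoc_N) simp_all
        then show ?case using N_cong cong by (simp add: diff)
      next
        case (single a'' b'' s'' t'' k'')
        then show ?case
          using ft_mult_assoc[OF x(1,2) y(1,2) single(1,2)]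
          by (simp add: T_assoc_linear N_scale del: lscale_single)
      qed (simp_all add: T_assoc_linear N_zero N_add)
      then show ?case by (simp add: T_assoc_linear N_scale del: lscale_single)
    qed (simp_all add: T_assoc_linear N_zero N_add)
    then show ?case by (simp add: T_assoc_linear N_scale del: lscale_single)
  qed (simp_all add: T_assoc_linear N_zero N_add)
qed

subsection \<open>The tensor product\<close>

lemma vspace_T: "vspace T"
proof (rule vspaceI)
  show "abelian_group T"
  proof (rule abelian_groupI)
    show "\<exists>y\<in>carrier T. y \<oplus>\<^bsub>T\<^esub> x = \<zero>\<^bsub>T\<^esub>" if "x \<in> carrier T" for x
      using that by (intro bexI[of _ "- x"]) simp_all
  qed (simp_all add: algebra_simps)
qed (simp_all add: lscale_add lscale.scale_left_distrib)

lemma tensor_modulo: "superalgebra_modulo T N"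
proof (rule superalgebra_modulo.intro)
  show "vspace T" by (rule vspace_T)
  show "\<exists>z\<in>homog T (s + t). x \<otimes>\<^bsub>T\<^esub> y - z \<in> N" if "x \<in> homog T s" "y \<in> homog T t" for x y s t
    by (rule homog_T_mult[OF that])
  show "(x \<otimes>\<^bsub>T\<^esub> y) \<otimes>\<^bsub>T\<^esub> z - x \<otimes>\<^bsub>T\<^esub> (y \<otimes>\<^bsub>T\<^esub> z) \<in> N"
    if "x \<in> carrier T" "y \<in> carrier T" "z \<in> carrier T" for x y z
    using T_assoc_in_N[OF that] by (simp add: T_assoc_def)
  show "x0 \<in> N" if "x0 \<in> homog T 0" "x1 \<in> homog T 1" "x0 + x1 \<in> N" for x0 x1
  proof -
    have "T_comp 0 x0 - x0 \<in> N" "T_comp 0 x1 \<in> N"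
      using T_comp_homog[OF that(1), of 0] T_comp_homog[OF that(2), of 0] by simp_all
    moreover have "T_comp 0 x0 + T_comp 0 x1 \<in> N"
      using T_comp_N[OF that(3), of 0] by (simp add: T_comp_linear)
    ultimately show ?thesis
      using N_diff[of "T_comp 0 x0 + T_comp 0 x1" "T_comp 0 x1"] N_cong by simp
  qed
  show "\<exists>x0\<in>homog T 0. \<exists>x1\<in>homog T 1. x - (x0 + x1) \<in> N" if "x \<in> carrier T" for x
    using that
  proof (induction x rule: T_homog_induct)
    case zero
    show ?case by (intro bexI[of _ 0]) (simp_all add: homog_T_closed N_zero)
  next
    case (single a b s t k)
    have h: "lscale k (ft a b) \<in> homog T (s + t)"
      using single by (intro homog_T_closed(4) homog_T_ft)
    show ?case
    proof (cases "s + t = 0")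
      case True
      show ?thesis
        by (intro bexI[of _ "lscale k (ft a b)"] bexI[of _ 0]) (use h True in \<open>simp_all add: homog_T_closed N_zero\<close>)
    next
      case False
      then have "s + t = 1" by simp
      show ?thesis
        by (intro bexI[of _ 0] bexI[of _ "lscale k (ft a b)"])
          (use h \<open>s + t = 1\<close> in \<open>simp_all add: homog_T_closed N_zero\<close>)
    qed
  next
    case (add x y)
    then obtain x0 x1 y0 y1 where *: "x0 \<in> homog T 0" "x1 \<in> homog T 1" "x - (x0 + x1) \<in> N"
      "y0 \<in> homog T 0" "y1 \<in> homog T 1" "y - (y0 + y1) \<in> N" by blast
    then have "(x + y) - ((x0 + y0) + (x1 + y1)) \<in> N"
      using N_add[OF *(3,6)] by (simp add: algebra_simps)
    with * show ?case
      by (intro bexI[of _ "x0 + y0"] bexI[of _ "x1 + y1"]) (simp_all add: homog_T_closed)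
  next
    case (cong x y)
    then obtain y0 y1 where "y0 \<in> homog T 0" "y1 \<in> homog T 1" "y - (y0 + y1) \<in> N" by blast
    then show ?case using N_trans[OF cong(3)] by blast
  qed
qed (simp_all add: N_zero N_add N_scale N_carrier N_mult_left N_mult_right mult_T_closed homog_T_closed
    mult_T_add_left mult_T_add_right mult_T_scale_left mult_T_scale_right T_one_mult T_mult_one
    homog_T_ft[OF A.homog_one B.homog_one, simplified])

sublocale Q: superalgebra_modulo T N
  by (rule tensor_modulo)

abbreviation AB where "AB \<equiv> super_tensor j A B"
abbreviation pure where "pure \<equiv> pure_tensor j A B"

sublocale AB: superalgebra AB
  using Q.superalgebra_superquot by (simp add: super_tensor_def)

lemma pure_eq: "pure a b = Q.cls (ft a b)"
  by (simp add: pure_tensor_def Q.cls_def)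

lemma pure_closed [simp]: "\<lbrakk>a \<in> carrier A; b \<in> carrier B\<rbrakk> \<Longrightarrow> pure a b \<in> carrier AB"
  by (simp add: pure_eq super_tensor_def Q.Q_carrier)

lemma pure_homog: "\<lbrakk>a \<in> homog A s; b \<in> homog B t\<rbrakk> \<Longrightarrow> pure a b \<in> homog AB (s + t)"
  by (simp add: pure_eq super_tensor_def Q.Q_homog homog_T_ft)

lemma pure_one: "\<one>\<^bsub>AB\<^esub> = pure \<one>\<^bsub>A\<^esub> \<one>\<^bsub>B\<^esub>"
  by (simp add: pure_eq super_tensor_def Q.Q_one)

lemma pure_add:
  "\<lbrakk>a \<in> carrier A; a' \<in> carrier A; b \<in> carrier B\<rbrakk> \<Longrightarrow> pure (a \<oplus>\<^bsub>A\<^esub> a') b = pure a b \<oplus>\<^bsub>AB\<^esub> pure a' b"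
  "\<lbrakk>a \<in> carrier A; b \<in> carrier B; b' \<in> carrier B\<rbrakk> \<Longrightarrow> pure a (b \<oplus>\<^bsub>B\<^esub> b') = pure a b \<oplus>\<^bsub>AB\<^esub> pure a b'"
  using balance(1,2) by (simp_all add: pure_eq super_tensor_def Q.Q_add Q.cls_eq diff_diff_eq)

lemma pure_scale:
  "\<lbrakk>a \<in> carrier A; b \<in> carrier B\<rbrakk> \<Longrightarrow> pure (k \<odot>\<^bsub>A\<^esub> a) b = j k \<odot>\<^bsub>AB\<^esub> pure a b"
  "\<lbrakk>a \<in> carrier A; b \<in> carrier B\<rbrakk> \<Longrightarrow> pure a (l \<odot>\<^bsub>B\<^esub> b) = l \<odot>\<^bsub>AB\<^esub> pure a b"
  using balance(3,4)
  by (simp_all add: pure_eq super_tensor_def Q.Q_scale Q.cls_eq del: lscale_single)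

lemma pure_mult:
  assumes "a \<in> carrier A" "b \<in> homog B t" "a' \<in> homog A s" "b' \<in> carrier B"
  shows "pure a b \<otimes>\<^bsub>AB\<^esub> pure a' b' = bit_sign (t * s) \<odot>\<^bsub>AB\<^esub> pure (a \<otimes>\<^bsub>A\<^esub> a') (b \<otimes>\<^bsub>B\<^esub> b')"
proof -
  have c: "a' \<in> carrier A" "b \<in> carrier B" using assms by auto
  show ?thesis
    using ft_mult_homog[OF assms] assms(1,4) c
    by (simp add: pure_eq super_tensor_def Q.Q_mult Q.Q_scale Q.cls_eq mult_T_ft del: lscale_single)
qed

text \<open>The canonical maps of the two factors into the tensor product are homomorphisms, the first one
  after restriction of scalars along \<open>j\<close>.\<close>

lemma superalgebra_hom_left: "superalgebra_hom A (restrict_scalars j AB) (\<lambda>a. pure a \<one>\<^bsub>B\<^esub>)"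
proof (rule superalgebra_homI[OF A.superalgebra_axioms superalgebra_restrict_scalars[OF AB.superalgebra_axioms j]])
  show "pure (a \<otimes>\<^bsub>A\<^esub> a') \<one>\<^bsub>B\<^esub> = pure a \<one>\<^bsub>B\<^esub> \<otimes>\<^bsub>restrict_scalars j AB\<^esub> pure a' \<one>\<^bsub>B\<^esub>"
    if "a \<in> carrier A" "a' \<in> carrier A" for a a'
  proof -
    let ?h = "\<lambda>s. hcomp A s a'"
    have h: "?h s \<in> homog A s" "a' = ?h 0 \<oplus>\<^bsub>A\<^esub> ?h 1" for s
      using A.hcomp_decomp(1)[OF that(2)] A.hcomp_decomp(2)[OF that(2), of 0] by simp_all
    have *: "pure a \<one>\<^bsub>B\<^esub> \<otimes>\<^bsub>AB\<^esub> pure (?h s) \<one>\<^bsub>B\<^esub> = pure (a \<otimes>\<^bsub>A\<^esub> ?h s) \<one>\<^bsub>B\<^esub>" for s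
      using pure_mult[OF that(1) B.homog_one h(1) B.one_closed, of s] that by simp
    have "pure a \<one>\<^bsub>B\<^esub> \<otimes>\<^bsub>AB\<^esub> pure (?h 0 \<oplus>\<^bsub>A\<^esub> ?h 1) \<one>\<^bsub>B\<^esub> = pure (a \<otimes>\<^bsub>A\<^esub> (?h 0 \<oplus>\<^bsub>A\<^esub> ?h 1)) \<one>\<^bsub>B\<^esub>"
      using that * by (simp add: pure_add AB.r_distr A.r_distr)
    then show ?thesis using h(2) by simp
  qed
  show "pure a \<one>\<^bsub>B\<^esub> \<in> homog (restrict_scalars j AB) s" if "a \<in> homog A s" for a s
    using pure_homog[OF that B.homog_one] by simp
qed (simp_all add: pure_add pure_scale pure_one)

lemma superalgebra_hom_right: "superalgebra_hom B AB (\<lambda>b. pure \<one>\<^bsub>A\<^esub> b)"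
proof (rule superalgebra_homI[OF B.superalgebra_axioms AB.superalgebra_axioms])
  show "pure \<one>\<^bsub>A\<^esub> (b \<otimes>\<^bsub>B\<^esub> b') = pure \<one>\<^bsub>A\<^esub> b \<otimes>\<^bsub>AB\<^esub> pure \<one>\<^bsub>A\<^esub> b'"
    if "b \<in> carrier B" "b' \<in> carrier B" for b b'
  proof -
    let ?h = "\<lambda>s. hcomp B s b"
    have h: "?h s \<in> homog B s" "b = ?h 0 \<oplus>\<^bsub>B\<^esub> ?h 1" for s
      using B.hcomp_decomp(1)[OF that(1)] B.hcomp_decomp(2)[OF that(1), of 0] by simp_all
    have *: "pure \<one>\<^bsub>A\<^esub> (?h s) \<otimes>\<^bsub>AB\<^esub> pure \<one>\<^bsub>A\<^esub> b' = pure \<one>\<^bsub>A\<^esub> (?h s \<otimes>\<^bsub>B\<^esub> b')" for s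
      using pure_mult[OF A.one_closed h(1) A.homog_one that(2), of s] that by simp
    have "pure \<one>\<^bsub>A\<^esub> (?h 0 \<oplus>\<^bsub>B\<^esub> ?h 1) \<otimes>\<^bsub>AB\<^esub> pure \<one>\<^bsub>A\<^esub> b' = pure \<one>\<^bsub>A\<^esub> ((?h 0 \<oplus>\<^bsub>B\<^esub> ?h 1) \<otimes>\<^bsub>B\<^esub> b')"
      using that * by (simp add: pure_add AB.l_distr B.l_distr)
    then show ?thesis using h(2) by simp
  qed
  show "pure \<one>\<^bsub>A\<^esub> b \<in> homog AB s" if "b \<in> homog B s" for b s
    using pure_homog[OF A.homog_one that] by simp
qed (simp_all add: pure_add pure_scale pure_one)

lemma pure_eq_mult:
  assumes "a \<in> carrier A" "b \<in> carrier B"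
  shows "pure a b = pure a \<one>\<^bsub>B\<^esub> \<otimes>\<^bsub>AB\<^esub> pure \<one>\<^bsub>A\<^esub> b"
  using pure_mult[OF assms(1) B.homog_one A.homog_one assms(2)] assms by simp

lemma pure_supercommute:
  assumes "a \<in> homog A s" "b \<in> homog B t"
  shows "pure \<one>\<^bsub>A\<^esub> b \<otimes>\<^bsub>AB\<^esub> pure a \<one>\<^bsub>B\<^esub> = bit_sign (t * s) \<odot>\<^bsub>AB\<^esub> (pure a \<one>\<^bsub>B\<^esub> \<otimes>\<^bsub>AB\<^esub> pure \<one>\<^bsub>A\<^esub> b)"
proof -
  have c: "a \<in> carrier A" "b \<in> carrier B" using assms by auto
  then show ?thesis
    using pure_mult[OF A.one_closed assms(2,1) B.one_closed] pure_eq_mult[of a b] by simp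
qed

text \<open>The universal property. The assignment of \<open>f a \<otimes> g b\<close> to \<open>(a, b)\<close> is balanced, hence kills
  the relations of the tensor product; on homogeneous tensors it is multiplicative because the images
  supercommute.\<close>

lemma super_tensor_hom_exists:
  assumes D: "superalgebra D" and f: "superalgebra_hom A (restrict_scalars j D) f" and g: "superalgebra_hom B D g"
    and comm: "\<And>a b s t. \<lbrakk>a \<in> homog A s; b \<in> homog B t\<rbrakk> \<Longrightarrow>
      g b \<otimes>\<^bsub>D\<^esub> f a = bit_sign (t * s) \<odot>\<^bsub>D\<^esub> (f a \<otimes>\<^bsub>D\<^esub> g b)"
  obtains h where "superalgebra_hom AB D h"
    "\<And>a b. \<lbrakk>a \<in> carrier A; b \<in> carrier B\<rbrakk> \<Longrightarrow> h (pure a b) = f a \<otimes>\<^bsub>D\<^esub> g b"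
proof -
  interpret D: superalgebra D by (rule D)
  interpret f: superalgebra_homomorphism A "restrict_scalars j D" f using f by auto
  interpret g: superalgebra_homomorphism B D g using g by auto
  have f_rules: "f a \<in> carrier D" "f (a \<oplus>\<^bsub>A\<^esub> a') = f a \<oplus>\<^bsub>D\<^esub> f a'" "f (a \<otimes>\<^bsub>A\<^esub> a') = f a \<otimes>\<^bsub>D\<^esub> f a'"
    "f (k \<odot>\<^bsub>A\<^esub> a) = j k \<odot>\<^bsub>D\<^esub> f a" if "a \<in> carrier A" "a' \<in> carrier A" for a a' k
    using that f.closed[of a] f.add f.mult f.scale by simp_all
  let ?X = "carrier A \<times> carrier B" and ?m = "\<lambda>(a, b). f a \<otimes>\<^bsub>D\<^esub> g b"
  define e where "e = lin_ext D ?m"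
  have m: "?m \<in> ?X \<rightarrow> carrier D" using f_rules(1) by auto
  have e_closed: "e x \<in> carrier D" if "x \<in> carrier T" for x
    using D.vsp.lin_ext_closed[OF _ m] that by (simp add: e_def carrier_T)
  have e_add: "e (x + y) = e x \<oplus>\<^bsub>D\<^esub> e y" if "x \<in> carrier T" "y \<in> carrier T" for x y
    using D.vsp.lin_ext_add[OF _ _ m] that by (simp add: e_def carrier_T)
  have e_minus: "e (x - y) = e x \<ominus>\<^bsub>D\<^esub> e y" if "x \<in> carrier T" "y \<in> carrier T" for x y
    using D.vsp.lin_ext_minus[OF _ _ m] that by (simp add: e_def carrier_T)
  have e_scale: "e (lscale k x) = k \<odot>\<^bsub>D\<^esub> e x" if "x \<in> carrier T" for x k
    using D.vsp.lin_ext_scale[OF _ m] that by (simp add: e_def carrier_T)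
  have e_ft: "e (ft a b) = f a \<otimes>\<^bsub>D\<^esub> g b" if "a \<in> carrier A" "b \<in> carrier B" for a b
    using D.vsp.lin_ext_single[of ?m "(a, b)" 1] that f_rules(1) by (simp add: e_def)
  have e_zero: "e 0 = \<zero>\<^bsub>D\<^esub>" by (simp add: e_def)
  have e_kills: "e x = \<zero>\<^bsub>D\<^esub>" if "x \<in> N" for x
  proof -
    have "x \<in> carrier T \<and> e x = \<zero>\<^bsub>D\<^esub>"
      using that
    proof (induction rule: N_induct)
      case (left_add a a' b)
      then have "e (ft (a \<oplus>\<^bsub>A\<^esub> a') b - ft a b - ft a' b) = \<zero>\<^bsub>D\<^esub>"
        by (simp add: e_minus e_ft f_rules D.l_distr D.minus_eq D.a_assoc)
          (simp add: D.minus_add[symmetric] D.r_neg f_rules flip: D.a_assoc)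
      with left_add show ?case by simp
    next
      case (right_add a b b')
      then have "e (ft a (b \<oplus>\<^bsub>B\<^esub> b') - ft a b - ft a b') = \<zero>\<^bsub>D\<^esub>"
        by (simp add: e_minus e_ft f_rules g.add D.r_distr D.minus_eq D.a_assoc)
          (simp add: D.minus_add[symmetric] D.r_neg f_rules flip: D.a_assoc)
      with right_add show ?case by simp
    next
      case (left_scale k a b)
      then show ?case
        by (simp add: e_minus e_ft e_scale f_rules D.smult_mult_left D.r_neg D.minus_eq del: lscale_single)
    next
      case (right_scale l a b)
      then show ?case
        by (simp add: e_minus e_ft e_scale f_rules g.scale D.smult_mult_right D.r_neg D.minus_eq del: lscale_single)
    qed (simp_all add: e_zero e_add e_scale)
    then show ?thesis by simp
  qed
  have e_cong: "e x = e y" if "x - y \<in> N" "x \<in> carrier T" "y \<in> carrier T" for x y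
    using e_add[of "x - y" y] e_kills[OF that(1)] e_closed that by simp
  have e_mult: "e (x \<otimes>\<^bsub>T\<^esub> y) = e x \<otimes>\<^bsub>D\<^esub> e y" if "x \<in> carrier T" "y \<in> carrier T" for x y
    using that
  proof (induction x arbitrary: y rule: T_homog_induct)
    case zero
    then show ?case by (simp add: e_zero e_closed)
  next
    case (add x x')
    then show ?case by (simp add: mult_T_add_left e_add
        mult_T_closed e_closed D.l_distr)
  next
    case (cong x x')
    have "x \<otimes>\<^bsub>T\<^esub> y - x' \<otimes>\<^bsub>T\<^esub> y \<in> N"
      using N_mult_right[of y "x - x'"] cong by (simp add: mult_T_diff_left)
    with cong show ?case using e_cong
      by (metis mult_T_closed)
  next
    case x: (single a b s t k)
    have "e (ft a b \<otimes>\<^bsub>T\<^esub> y) = e (ft a b) \<otimes>\<^bsub>D\<^esub> e y"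
      using x(3)
    proof (induction y rule: T_homog_induct)
      case zero
      show ?case using x by (simp add: e_zero e_closed)
    next
      case (add y y')
      then show ?case using x by (simp add: mult_T_add_right
          e_add mult_T_closed e_closed D.r_distr)
    next
      case (cong y y')
      have "ft a b \<otimes>\<^bsub>T\<^esub> y - ft a b \<otimes>\<^bsub>T\<^esub> y' \<in> N"
        using N_mult_left[of "ft a b" "y - y'"] cong x by (simp add: mult_T_diff_right)
      with cong x show ?case
        using e_cong
        by (metis mult_T_closed ft_carrier A.homog_in_carrier B.homog_in_carrier)
    next
      case (single a' b' s' t' k')
      have c: "a \<in> carrier A" "b \<in> carrier B" "a' \<in> carrier A" "b' \<in> carrier B"
        using x single by auto
      have "e (ft a b \<otimes>\<^bsub>T\<^esub> ft a' b') = e (lscale (bit_sign (t * s')) (ft (a \<otimes>\<^bsub>A\<^esub> a') (b \<otimes>\<^bsub>B\<^esub> b')))"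
        using ft_mult_homog[OF c(1) x(2) single(1) c(4)] c
        by (intro e_cong)
          (simp_all add: mult_T_ft ft_mult_closed del: lscale_single)
      also have "\<dots> = bit_sign (t * s') \<odot>\<^bsub>D\<^esub> ((f a \<otimes>\<^bsub>D\<^esub> f a') \<otimes>\<^bsub>D\<^esub> (g b \<otimes>\<^bsub>D\<^esub> g b'))"
        using c by (simp add: e_scale e_ft f_rules g.mult del: lscale_single)
      also have "\<dots> = f a \<otimes>\<^bsub>D\<^esub> (bit_sign (t * s') \<odot>\<^bsub>D\<^esub> (f a' \<otimes>\<^bsub>D\<^esub> g b)) \<otimes>\<^bsub>D\<^esub> g b'"
        using c f_rules(1) by (simp add: D.smult_mult_left D.smult_mult_right D.m_assoc)
      also have "\<dots> = e (ft a b) \<otimes>\<^bsub>D\<^esub> e (ft a' b')"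
        unfolding comm[OF single(1) x(2), symmetric] using c f_rules(1) by (simp add: e_ft D.m_assoc)
      finally show ?case
        using c by (simp add: mult_T_scale_right e_scale mult_T_closed e_closed D.smult_mult_right del: lscale_single)
    qed
    then show ?case
      using x by (simp add: mult_T_scale_left e_scale mult_T_closed e_closed D.smult_mult_left del: lscale_single)
  qed
  have e_homog: "e x \<in> homog D u" if "x \<in> homog T u" for x u
    using that
  proof (induction x rule: homog_T_induct)
    case zero
    show ?case by (simp add: e_zero D.homog_zero)
  next
    case (add x y)
    then show ?case
      using e_add
      by (simp add: homog_T_closed(1) D.homog_add)
  next
    case (single a b k s)
    have "f a \<otimes>\<^bsub>D\<^esub> g b \<in> homog D (s + (u - s))"
      using f.homog[OF single(1)] g.homog[OF single(2)] by (intro D.homog_mult) simp_all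
    moreover have "s + (u - s) = u" by (cases s; cases u) simp_all
    ultimately show ?case
      using single by (simp add: e_scale e_ft D.homog_smult del: lscale_single)
  qed
  show ?thesis
  proof (rule Q.superquot_hom_exists[OF D, of e])
    fix h assume h: "superalgebra_hom Q.Q D h" "\<And>x. x \<in> carrier T \<Longrightarrow> h (Q.cls x) = e x"
    show thesis
    proof (rule that[of h])
      show "h (pure a b) = f a \<otimes>\<^bsub>D\<^esub> g b" if "a \<in> carrier A" "b \<in> carrier B" for a b
        unfolding pure_eq using that by (subst h(2)) (simp_all add: e_ft)
    qed (use h(1) in \<open>simp add: super_tensor_def\<close>)
  next
    show "e \<one>\<^bsub>T\<^esub> = \<one>\<^bsub>D\<^esub>" using f.one g.one by (simp add: e_ft)
  qed (simp_all add: e_closed e_add e_scale e_mult e_homog e_kills)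
qed

text \<open>Every element is a combination of tensors \<open>a \<otimes> b = (a \<otimes> 1) (1 \<otimes> b)\<close>.\<close>

lemma super_tensor_hom_unique:
  assumes h: "superalgebra_hom AB D h" and h': "superalgebra_hom AB D h'"
    and left: "\<And>a. a \<in> carrier A \<Longrightarrow> h (pure a \<one>\<^bsub>B\<^esub>) = h' (pure a \<one>\<^bsub>B\<^esub>)"
    and right: "\<And>b. b \<in> carrier B \<Longrightarrow> h (pure \<one>\<^bsub>A\<^esub> b) = h' (pure \<one>\<^bsub>A\<^esub> b)"
    and X: "X \<in> carrier AB"
  shows "h X = h' X"
proof -
  interpret h: superalgebra_homomorphism AB D h using h by auto
  interpret h': superalgebra_homomorphism AB D h' using h' by auto
  obtain x where x: "x \<in> carrier T" "X = Q.cls x"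
    using X by (auto simp: super_tensor_def Q.Q_carrier)
  have cls: "Q.cls x \<in> carrier AB" if "x \<in> carrier T" for x
    using that by (simp add: super_tensor_def Q.Q_carrier)
  have pure: "h (pure a b) = h' (pure a b)" if "a \<in> carrier A" "b \<in> carrier B" for a b
    unfolding pure_eq_mult[OF that] using that by (simp add: h.mult h'.mult left right)
  have "h (Q.cls x) = h' (Q.cls x)"
    using x(1)
  proof (induction x rule: T_induct)
    case zero
    then show ?case using h.zero h'.zero by (simp add: super_tensor_def Q.Q_zero)
  next
    case (single a b k)
    then have "Q.cls (lscale k (ft a b)) = k \<odot>\<^bsub>AB\<^esub> pure a b"
      by (simp add: super_tensor_def Q.Q_scale pure_eq del: lscale_single)
    then show ?case using single pure by (simp add: h.scale h'.scale del: lscale_single)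
  next
    case (add x y)
    have "Q.cls (x + y) = Q.cls x \<oplus>\<^bsub>AB\<^esub> Q.cls y" by (simp add: super_tensor_def Q.Q_add)
    then show ?case using add cls by (simp add: h.add h'.add)
  qed
  then show ?thesis using x by simp
qed

end

section \<open>Hecke and spin generators in a ring\<close>

context ring
begin

text \<open>Turns a rewrite rule for a product of two generators into one that applies inside a longer
  right-nested product.\<close>

lemma mult_eq_assoc:
  "\<lbrakk>x \<otimes> y = w; x \<in> carrier R; y \<in> carrier R; z \<in> carrier R\<rbrakk> \<Longrightarrow> x \<otimes> (y \<otimes> z) = w \<otimes> z"
  by (auto simp: m_assoc[symmetric])

text \<open>In the Hecke-Clifford algebra: \<open>a = c\<^sub>i\<close>, \<open>b = c\<^bsub>i+1\<^esub>\<close> and \<open>T = T\<^sub>i\<close>. The rule for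
  \<open>T b\<close> comes from computing \<open>T b T\<^sup>2\<close> in two ways.\<close>

lemma Hecke_swap:
  assumes c: "a \<in> carrier R" "b \<in> carrier R" "T \<in> carrier R" "e \<in> carrier R"
    and e: "a \<otimes> e = e \<otimes> a" "b \<otimes> e = e \<otimes> b" "T \<otimes> e = e \<otimes> T"
    and Ta: "T \<otimes> a = b \<otimes> T" and TT: "T \<otimes> T = e \<otimes> T \<oplus> \<one>"
  shows "T \<otimes> b = a \<otimes> T \<ominus> e \<otimes> (a \<ominus> b)"
proof -
  note rules = e e[THEN mult_eq_assoc] Ta Ta[THEN mult_eq_assoc] TT TT[THEN mult_eq_assoc]
  have TbT: "T \<otimes> (b \<otimes> T) = e \<otimes> (b \<otimes> T) \<oplus> a"
  proof -
    have "T \<otimes> (b \<otimes> T) = T \<otimes> (T \<otimes> a)" by (simp add: Ta)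
    also have "\<dots> = (T \<otimes> T) \<otimes> a" using c by (simp add: m_assoc)
    also have "\<dots> = e \<otimes> (b \<otimes> T) \<oplus> a" using c rules r_one by algebra
    finally show ?thesis .
  qed
  have "T \<otimes> b = T \<otimes> (b \<otimes> (T \<otimes> T)) \<ominus> e \<otimes> (T \<otimes> (b \<otimes> T))"
    unfolding TT using c e e[THEN mult_eq_assoc] r_one by algebra
  also have "T \<otimes> (b \<otimes> (T \<otimes> T)) = (T \<otimes> (b \<otimes> T)) \<otimes> T"
    using c by (simp add: m_assoc)
  also have "(T \<otimes> (b \<otimes> T)) \<otimes> T \<ominus> e \<otimes> (T \<otimes> (b \<otimes> T)) = a \<otimes> T \<ominus> e \<otimes> (a \<ominus> b)"
    unfolding TbT using c e e[THEN mult_eq_assoc] TT TT[THEN mult_eq_assoc] r_one by algebra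
  finally show ?thesis .
qed

text \<open>With \<open>R = (a - b) T + e b\<close>, moving \<open>T\<close> to the right of \<open>a\<close> and \<open>b\<close> brings each
claim to a normal form. The last one inverts the definition of \<open>R\<close>, using \<open>(a - b)\<^sup>2 = 2\<close>;
it is stated for \<open>2 T\<close> because a general ring has no \<open>1/2\<close>.\<close>

lemma spin_of_Hecke:
  assumes c: "a \<in> carrier R" "b \<in> carrier R" "T \<in> carrier R" "e \<in> carrier R"
    and e: "a \<otimes> e = e \<otimes> a" "b \<otimes> e = e \<otimes> b" "T \<otimes> e = e \<otimes> T"
    and ab: "a \<otimes> a = \<one>" "b \<otimes> b = \<one>" "b \<otimes> a = \<ominus> (a \<otimes> b)"
    and Ta: "T \<otimes> a = b \<otimes> T" and TT: "T \<otimes> T = e \<otimes> T \<oplus> \<one>"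
    and R': "R' = (a \<ominus> b) \<otimes> T \<oplus> e \<otimes> b"
  shows "R' \<otimes> R' = \<ominus> (e \<otimes> e) \<ominus> (\<one> \<oplus> \<one>)"
    and "R' \<otimes> a = \<ominus> (a \<otimes> R')" and "R' \<otimes> b = \<ominus> (b \<otimes> R')"
    and "T \<oplus> T = \<ominus> (R' \<otimes> (a \<ominus> b)) \<oplus> e \<otimes> (\<one> \<ominus> a \<otimes> b)"
proof -
  have Tb: "T \<otimes> b = a \<otimes> T \<ominus> e \<otimes> (a \<ominus> b)"
    by (rule Hecke_swap[OF c e Ta TT])
  note rules = e e[THEN mult_eq_assoc] ab ab[THEN mult_eq_assoc] Ta Ta[THEN mult_eq_assoc]
    TT TT[THEN mult_eq_assoc] Tb Tb[THEN mult_eq_assoc]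
  show "R' \<otimes> R' = \<ominus> (e \<otimes> e) \<ominus> (\<one> \<oplus> \<one>)" "R' \<otimes> a = \<ominus> (a \<otimes> R')" "R' \<otimes> b = \<ominus> (b \<otimes> R')"
    "T \<oplus> T = \<ominus> (R' \<otimes> (a \<ominus> b)) \<oplus> e \<otimes> (\<one> \<ominus> a \<otimes> b)"
    unfolding R' using c rules r_one by algebra+
qed

lemma double_cancel:
  assumes "\<And>x. \<lbrakk>x \<in> carrier R; x \<oplus> x = \<zero>\<rbrakk> \<Longrightarrow> x = \<zero>"
    and "x \<in> carrier R" "y \<in> carrier R" "x \<oplus> x = y \<oplus> y"
  shows "x = y"
proof -
  have "(x \<ominus> y) \<oplus> (x \<ominus> y) = (x \<oplus> x) \<ominus> (y \<oplus> y)" using assms(2,3) by algebra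
  then have "(x \<ominus> y) \<oplus> (x \<ominus> y) = \<zero>" using assms(2-4) by (simp add: minus_eq r_neg)
  then have "x \<ominus> y = \<zero>" using assms(1)[of "x \<ominus> y"] assms(2,3) by simp
  moreover have "x = (x \<ominus> y) \<oplus> y" using assms(2,3) by algebra
  ultimately show ?thesis using assms(3) by simp
qed

lemma minus_eq_zero_iff: "\<lbrakk>x \<in> carrier R; y \<in> carrier R\<rbrakk> \<Longrightarrow> x \<ominus> y = \<zero> \<longleftrightarrow> x = y"
proof
  assume "x \<in> carrier R" "y \<in> carrier R" "x \<ominus> y = \<zero>"
  moreover from this(1,2) have "x = (x \<ominus> y) \<oplus> y" by algebra
  ultimately show "x = y" by simp
qed (simp add: minus_eq r_neg)

lemma add_eq_zero_iff: "\<lbrakk>x \<in> carrier R; y \<in> carrier R\<rbrakk> \<Longrightarrow> x \<oplus> y = \<zero> \<longleftrightarrow> x = \<ominus> y"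
  using minus_equality[of x y] by (auto simp: l_neg)

text \<open>The converse, in a ring without \<open>2\<close>-torsion, where an identity may be verified after
doubling it.\<close>

lemma Hecke_of_spin:
  assumes two: "\<And>x. \<lbrakk>x \<in> carrier R; x \<oplus> x = \<zero>\<rbrakk> \<Longrightarrow> x = \<zero>"
    and c: "a \<in> carrier R" "b \<in> carrier R" "T \<in> carrier R" "R' \<in> carrier R" "e \<in> carrier R"
    and e: "a \<otimes> e = e \<otimes> a" "b \<otimes> e = e \<otimes> b" "T \<otimes> e = e \<otimes> T" "R' \<otimes> e = e \<otimes> R'"
    and ab: "a \<otimes> a = \<one>" "b \<otimes> b = \<one>" "b \<otimes> a = \<ominus> (a \<otimes> b)"
    and R': "R' \<otimes> R' = \<ominus> (e \<otimes> e) \<ominus> (\<one> \<oplus> \<one>)" "R' \<otimes> a = \<ominus> (a \<otimes> R')" "R' \<otimes> b = \<ominus> (b \<otimes> R')"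
    and T: "T \<oplus> T = \<ominus> (R' \<otimes> (a \<ominus> b)) \<oplus> e \<otimes> (\<one> \<ominus> a \<otimes> b)"
  shows "T \<otimes> a = b \<otimes> T" and "T \<otimes> T = e \<otimes> T \<oplus> \<one>" and "R' = (a \<ominus> b) \<otimes> T \<oplus> e \<otimes> b"
proof -
  note rules = e e[THEN mult_eq_assoc] ab ab[THEN mult_eq_assoc] R' R'[THEN mult_eq_assoc]
  let ?U = "\<ominus> (R' \<otimes> (a \<ominus> b)) \<oplus> e \<otimes> (\<one> \<ominus> a \<otimes> b)"
  show "T \<otimes> a = b \<otimes> T"
  proof (rule double_cancel[OF two])
    have "T \<otimes> a \<oplus> T \<otimes> a = (T \<oplus> T) \<otimes> a" using c by algebra
    also have "\<dots> = b \<otimes> (T \<oplus> T)" unfolding T using c rules r_one by algebra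
    also have "\<dots> = b \<otimes> T \<oplus> b \<otimes> T" using c by algebra
    finally show "T \<otimes> a \<oplus> T \<otimes> a = b \<otimes> T \<oplus> b \<otimes> T" .
  qed (use c in simp_all)
  show R'_eq: "R' = (a \<ominus> b) \<otimes> T \<oplus> e \<otimes> b"
  proof (rule double_cancel[OF two])
    have "R' \<oplus> R' = (a \<ominus> b) \<otimes> (T \<oplus> T) \<oplus> (e \<otimes> b \<oplus> e \<otimes> b)"
      unfolding T using c rules r_one by algebra
    also have "\<dots> = ((a \<ominus> b) \<otimes> T \<oplus> e \<otimes> b) \<oplus> ((a \<ominus> b) \<otimes> T \<oplus> e \<otimes> b)" using c by algebra
    finally show "R' \<oplus> R' = \<dots>" .
  qed (use c in simp_all)
  have swap: "T \<otimes> (a \<ominus> b) = e \<otimes> a \<ominus> R'"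
  proof (rule double_cancel[OF two])
    have "T \<otimes> (a \<ominus> b) \<oplus> T \<otimes> (a \<ominus> b) = (T \<oplus> T) \<otimes> (a \<ominus> b)" using c by algebra
    also have "\<dots> = (e \<otimes> a \<ominus> R') \<oplus> (e \<otimes> a \<ominus> R')" unfolding T using c rules r_one by algebra
    finally show "T \<otimes> (a \<ominus> b) \<oplus> T \<otimes> (a \<ominus> b) = \<dots>" .
  qed (use c in simp_all)
  \<comment> \<open>Both sides of the quadratic relation appear in \<open>((a - b) T)\<^sup>2 = (R - e b)\<^sup>2 = -2\<close>.\<close>
  let ?S = "R' \<ominus> e \<otimes> b"
  have S: "(a \<ominus> b) \<otimes> T = ?S" by (subst R'_eq) (use c in algebra)
  have "e \<otimes> a \<ominus> R' = e \<otimes> (a \<ominus> b) \<ominus> ?S" using c by algebra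
  then have "T \<otimes> (a \<ominus> b) = e \<otimes> (a \<ominus> b) \<ominus> (a \<ominus> b) \<otimes> T" unfolding swap S .
  note swap' = this
  let ?u = "a \<ominus> b"
  have u: "?u \<in> carrier R" "?u \<otimes> ?u = \<one> \<oplus> \<one>" "?u \<otimes> e = e \<otimes> ?u" using c rules r_one by (simp, algebra, algebra)
  have SS: "?S \<otimes> ?S = \<ominus> (\<one> \<oplus> \<one>)" using c rules r_one by algebra
  have "(?u \<otimes> T) \<otimes> (?u \<otimes> T) = ?u \<otimes> ((T \<otimes> ?u) \<otimes> T)" using u c by (simp add: m_assoc)
  also have "\<dots> = ?u \<otimes> ((e \<otimes> ?u \<ominus> ?u \<otimes> T) \<otimes> T)" by (simp only: swap')
  also have "\<dots> = e \<otimes> (?u \<otimes> ?u) \<otimes> T \<ominus> (?u \<otimes> ?u) \<otimes> (T \<otimes> T)"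
    using u(1,3) c(3,5) u(3)[THEN mult_eq_assoc]
    by (simp add: minus_eq l_distr r_distr l_minus r_minus m_assoc)
  also have "\<dots> = (e \<otimes> T \<oplus> e \<otimes> T) \<ominus> (T \<otimes> T \<oplus> T \<otimes> T)"
    unfolding u(2) using c(3,5) by (simp add: minus_eq l_distr r_distr)
  finally have W: "(e \<otimes> T \<oplus> e \<otimes> T) \<ominus> (T \<otimes> T \<oplus> T \<otimes> T) = \<ominus> (\<one> \<oplus> \<one>)"
    unfolding S SS ..
  have "T \<otimes> T \<oplus> T \<otimes> T = (e \<otimes> T \<oplus> e \<otimes> T) \<ominus> ((e \<otimes> T \<oplus> e \<otimes> T) \<ominus> (T \<otimes> T \<oplus> T \<otimes> T))"
    using c(3,5) by (simp add: minus_eq minus_add r_neg1 flip: a_assoc) (simp add: a_assoc r_neg r_neg2)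
  also have "\<dots> = (e \<otimes> T \<oplus> \<one>) \<oplus> (e \<otimes> T \<oplus> \<one>)"
    unfolding W using c(3,5) by (simp add: minus_eq a_ac)
  finally show "T \<otimes> T = e \<otimes> T \<oplus> \<one>"
    by (rule double_cancel[OF two, rotated -1]) (use c in simp_all)
qed

text \<open>\<open>R = (a - b) T + e b\<close> is odd in \<open>a\<close> and \<open>b\<close>, so an element that anticommutes with these
and commutes with \<open>T\<close> anticommutes with \<open>R\<close>; dually \<open>2 T = - R (a - b) + e (1 - a b)\<close> is even
in \<open>a\<close>, \<open>b\<close> and \<open>R\<close>.\<close>

lemma spin_anticommutes:
  assumes c: "a \<in> carrier R" "b \<in> carrier R" "T \<in> carrier R" "e \<in> carrier R" "d \<in> carrier R"
    and d: "d \<otimes> a = \<ominus> (a \<otimes> d)" "d \<otimes> b = \<ominus> (b \<otimes> d)" "d \<otimes> e = e \<otimes> d" "T \<otimes> d = d \<otimes> T"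
    and R': "R' = (a \<ominus> b) \<otimes> T \<oplus> e \<otimes> b"
  shows "R' \<otimes> d = \<ominus> (d \<otimes> R')"
  unfolding R' using c d d[THEN mult_eq_assoc] r_one by algebra

lemma Hecke_commutes:
  assumes two: "\<And>x. \<lbrakk>x \<in> carrier R; x \<oplus> x = \<zero>\<rbrakk> \<Longrightarrow> x = \<zero>"
    and c: "a \<in> carrier R" "b \<in> carrier R" "T \<in> carrier R" "R' \<in> carrier R" "e \<in> carrier R" "d \<in> carrier R"
    and d: "d \<otimes> a = \<ominus> (a \<otimes> d)" "d \<otimes> b = \<ominus> (b \<otimes> d)" "d \<otimes> e = e \<otimes> d" "d \<otimes> R' = \<ominus> (R' \<otimes> d)"
    and T: "T \<oplus> T = \<ominus> (R' \<otimes> (a \<ominus> b)) \<oplus> e \<otimes> (\<one> \<ominus> a \<otimes> b)"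
  shows "T \<otimes> d = d \<otimes> T"
proof (rule double_cancel[OF two])
  have "T \<otimes> d \<oplus> T \<otimes> d = (T \<oplus> T) \<otimes> d" using c by algebra
  also have "\<dots> = d \<otimes> (T \<oplus> T)" unfolding T using c d d[THEN mult_eq_assoc] r_one by algebra
  also have "\<dots> = d \<otimes> T \<oplus> d \<otimes> T" using c by algebra
  finally show "T \<otimes> d \<oplus> T \<otimes> d = d \<otimes> T \<oplus> d \<otimes> T" .
qed (use c in simp_all)

text \<open>Elements that commute with everything on the right hand side of the formula for \<open>R\<close>, or of
that for \<open>2 T\<close>, commute with \<open>R\<close> or \<open>T\<close>.\<close>

lemma commutes_spin:
  assumes "a \<in> carrier R" "b \<in> carrier R" "T \<in> carrier R" "e \<in> carrier R" "d \<in> carrier R"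
    and d: "d \<otimes> a = a \<otimes> d" "d \<otimes> b = b \<otimes> d" "d \<otimes> T = T \<otimes> d" "d \<otimes> e = e \<otimes> d"
    and R': "R' = (a \<ominus> b) \<otimes> T \<oplus> e \<otimes> b"
  shows "d \<otimes> R' = R' \<otimes> d"
  unfolding R' using assms(1-5) d d[THEN mult_eq_assoc] by algebra

lemma commutes_Hecke:
  assumes two: "\<And>x. \<lbrakk>x \<in> carrier R; x \<oplus> x = \<zero>\<rbrakk> \<Longrightarrow> x = \<zero>"
    and c: "a \<in> carrier R" "b \<in> carrier R" "T \<in> carrier R" "R' \<in> carrier R" "e \<in> carrier R" "d \<in> carrier R"
    and d: "d \<otimes> a = a \<otimes> d" "d \<otimes> b = b \<otimes> d" "d \<otimes> e = e \<otimes> d" "d \<otimes> R' = R' \<otimes> d"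
    and T: "T \<oplus> T = \<ominus> (R' \<otimes> (a \<ominus> b)) \<oplus> e \<otimes> (\<one> \<ominus> a \<otimes> b)"
  shows "d \<otimes> T = T \<otimes> d"
proof (rule double_cancel[OF two])
  have "d \<otimes> T \<oplus> d \<otimes> T = d \<otimes> (T \<oplus> T)" using c by algebra
  also have "\<dots> = (T \<oplus> T) \<otimes> d" unfolding T using c d d[THEN mult_eq_assoc] r_one by algebra
  also have "\<dots> = T \<otimes> d \<oplus> T \<otimes> d" using c by algebra
  finally show "d \<otimes> T \<oplus> d \<otimes> T = T \<otimes> d \<oplus> T \<otimes> d" .
qed (use c in simp_all)

text \<open>With \<open>x = c\<^bsub>i+1\<^esub>\<close>, \<open>y = c\<^bsub>i+2\<^esub>\<close> and \<open>t = 2\<close>: how the spin braid relation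
  reads in the shifted generators \<open>R\<^sub>1 - e x\<close> and \<open>R\<^sub>2 - e y\<close>, which are the products
  \<open>(c\<^sub>i - c\<^bsub>i+1\<^esub>) T\<^sub>i\<close>.\<close>

lemma shifted_spin_braid:
  assumes c: "x \<in> carrier R" "y \<in> carrier R" "R1 \<in> carrier R" "R2 \<in> carrier R" "e \<in> carrier R" "t \<in> carrier R"
    and t: "x \<otimes> t = t \<otimes> x" "y \<otimes> t = t \<otimes> y" "R1 \<otimes> t = t \<otimes> R1" "R2 \<otimes> t = t \<otimes> R2" "e \<otimes> t = t \<otimes> e"
    and e: "x \<otimes> e = e \<otimes> x" "y \<otimes> e = e \<otimes> y" "R1 \<otimes> e = e \<otimes> R1" "R2 \<otimes> e = e \<otimes> R2"
    and xy: "x \<otimes> x = \<one>" "y \<otimes> y = \<one>" "y \<otimes> x = \<ominus> (x \<otimes> y)"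
    and R: "R1 \<otimes> R1 = \<ominus> (e \<otimes> e) \<ominus> t" "R2 \<otimes> R2 = \<ominus> (e \<otimes> e) \<ominus> t"
      "R1 \<otimes> x = \<ominus> (x \<otimes> R1)" "R1 \<otimes> y = \<ominus> (y \<otimes> R1)" "R2 \<otimes> x = \<ominus> (x \<otimes> R2)" "R2 \<otimes> y = \<ominus> (y \<otimes> R2)"
    and S: "S1 = R1 \<ominus> e \<otimes> x" "S2 = R2 \<ominus> e \<otimes> y"
  shows "S1 \<otimes> S2 \<otimes> S1 \<ominus> S2 \<otimes> S1 \<otimes> S2 \<oplus> e \<otimes> (x \<ominus> y) \<otimes> (S1 \<otimes> S2 \<oplus> S2 \<otimes> S1 \<ominus> t) =
    R1 \<otimes> R2 \<otimes> R1 \<ominus> R2 \<otimes> R1 \<otimes> R2 \<ominus> (e \<otimes> e) \<otimes> (R2 \<ominus> R1)"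
proof -
  note rules = t t[THEN mult_eq_assoc] e e[THEN mult_eq_assoc] xy xy[THEN mult_eq_assoc] R R[THEN mult_eq_assoc]
  have anti: "S1 \<otimes> S2 \<oplus> S2 \<otimes> S1 = R1 \<otimes> R2 \<oplus> R2 \<otimes> R1"
    unfolding S using c rules r_one by algebra
  have left: "S1 \<otimes> S2 \<otimes> S1 = R1 \<otimes> R2 \<otimes> R1 \<ominus> e \<otimes> x \<otimes> (R1 \<otimes> R2 \<oplus> R2 \<otimes> R1) \<ominus> e \<otimes> e \<otimes> R2 \<ominus> t \<otimes> e \<otimes> y"
    unfolding S using c rules r_one by algebra
  have right: "S2 \<otimes> S1 \<otimes> S2 = R2 \<otimes> R1 \<otimes> R2 \<ominus> e \<otimes> y \<otimes> (R1 \<otimes> R2 \<oplus> R2 \<otimes> R1) \<ominus> e \<otimes> e \<otimes> R1 \<ominus> t \<otimes> e \<otimes> x"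
    unfolding S using c rules r_one by algebra
  \<comment> \<open>Here the anticommutator \<open>d\<close> of the \<open>R\<close>'s, with its coefficients \<open>e x\<close> and \<open>e y\<close>,
    cancels against the last summand of the left hand side.\<close>
  have collect: "(p \<ominus> e \<otimes> x \<otimes> d \<ominus> e \<otimes> e \<otimes> R2 \<ominus> t \<otimes> e \<otimes> y)
      \<ominus> (r \<ominus> e \<otimes> y \<otimes> d \<ominus> e \<otimes> e \<otimes> R1 \<ominus> t \<otimes> e \<otimes> x) \<oplus> e \<otimes> (x \<ominus> y) \<otimes> (d \<ominus> t) =
      p \<ominus> r \<ominus> (e \<otimes> e) \<otimes> (R2 \<ominus> R1)"
    if "p \<in> carrier R" "r \<in> carrier R" "d \<in> carrier R" for p r d
    using c that t(1,2,5) t(1,2,5)[THEN mult_eq_assoc] by algebra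
  show ?thesis
    unfolding anti left right by (rule collect) (use c in simp_all)
qed

text \<open>The braid words in \<open>u S\<^sub>1 = 2 T\<^sub>1\<close> and \<open>v S\<^sub>2 = 2 T\<^sub>2\<close>, where \<open>u = c\<^sub>i - c\<^bsub>i+1\<^esub>\<close>,
  \<open>v = c\<^bsub>i+1\<^esub> - c\<^bsub>i+2\<^esub>\<close> and \<open>t = 2\<close>.\<close>

lemma shifted_braid_words:
  assumes c: "u \<in> carrier R" "v \<in> carrier R" "S1 \<in> carrier R" "S2 \<in> carrier R" "e \<in> carrier R" "t \<in> carrier R"
    and t: "u \<otimes> t = t \<otimes> u" "v \<otimes> t = t \<otimes> v" "S1 \<otimes> t = t \<otimes> S1" "S2 \<otimes> t = t \<otimes> S2" "e \<otimes> t = t \<otimes> e"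
    and e: "u \<otimes> e = e \<otimes> u" "v \<otimes> e = e \<otimes> v" "S1 \<otimes> e = e \<otimes> S1" "S2 \<otimes> e = e \<otimes> S2"
    and uv: "u \<otimes> u = t" "v \<otimes> v = t" "v \<otimes> u = \<ominus> (u \<otimes> v) \<ominus> t"
    and S: "S1 \<otimes> u = t \<otimes> e \<ominus> u \<otimes> S1" "S1 \<otimes> v = \<ominus> (t \<otimes> e) \<ominus> v \<otimes> S1"
      "S2 \<otimes> v = t \<otimes> e \<ominus> v \<otimes> S2" "S2 \<otimes> u = \<ominus> (u \<otimes> S2)" "S2 \<otimes> S2 = \<ominus> t"
  shows "(u \<otimes> S1) \<otimes> (v \<otimes> S2) \<otimes> (u \<otimes> S1) \<ominus> (v \<otimes> S2) \<otimes> (u \<otimes> S1) \<otimes> (v \<otimes> S2) =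
    t \<otimes> (u \<oplus> v) \<otimes> (S1 \<otimes> S2 \<otimes> S1 \<ominus> S2 \<otimes> S1 \<otimes> S2 \<oplus> e \<otimes> v \<otimes> (S1 \<otimes> S2 \<oplus> S2 \<otimes> S1 \<ominus> t))"
proof -
  note rules = t t[THEN mult_eq_assoc] e e[THEN mult_eq_assoc] uv uv[THEN mult_eq_assoc] S S[THEN mult_eq_assoc]
  have "(u \<otimes> S1) \<otimes> (v \<otimes> S2) \<otimes> (u \<otimes> S1) =
      t \<otimes> (u \<oplus> v) \<otimes> (S1 \<otimes> S2 \<otimes> S1) \<oplus> t \<otimes> e \<otimes> (u \<otimes> v \<oplus> t) \<otimes> (S2 \<otimes> S1)"
    using c rules r_one by algebra
  moreover have "(v \<otimes> S2) \<otimes> (u \<otimes> S1) \<otimes> (v \<otimes> S2) =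
      t \<otimes> (u \<oplus> v) \<otimes> (S2 \<otimes> S1 \<otimes> S2) \<ominus> t \<otimes> e \<otimes> (u \<otimes> v \<oplus> t) \<otimes> (S1 \<otimes> S2 \<ominus> t)"
    using c rules r_one by algebra
  moreover have "(u \<oplus> v) \<otimes> (e \<otimes> v) = e \<otimes> (u \<otimes> v \<oplus> t)"
    using c rules r_one by algebra
  note uvv = this this[THEN mult_eq_assoc]
  have "t \<otimes> (u \<oplus> v) \<otimes> (e \<otimes> v \<otimes> z) = t \<otimes> e \<otimes> (u \<otimes> v \<oplus> t) \<otimes> z" if "z \<in> carrier R" for z
    using c that uv(2) uv(2)[THEN mult_eq_assoc] e e[THEN mult_eq_assoc] t t[THEN mult_eq_assoc] by algebra
  note merge = this
  have split: "t \<otimes> (u \<oplus> v) \<otimes> (p \<ominus> p' \<oplus> e \<otimes> v \<otimes> z) =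
      t \<otimes> (u \<oplus> v) \<otimes> p \<ominus> t \<otimes> (u \<oplus> v) \<otimes> p' \<oplus> t \<otimes> e \<otimes> (u \<otimes> v \<oplus> t) \<otimes> z"
    if "p \<in> carrier R" "p' \<in> carrier R" "z \<in> carrier R" for p p' z
    unfolding merge[OF that(3), symmetric] using c that by (simp add: minus_eq r_distr r_minus)
  let ?k = "t \<otimes> e \<otimes> (u \<otimes> v \<oplus> t)"
  have join: "(p \<oplus> ?k \<otimes> p2) \<ominus> (p' \<ominus> ?k \<otimes> (p1 \<ominus> t)) = p \<ominus> p' \<oplus> ?k \<otimes> (p1 \<oplus> p2 \<ominus> t)"
    if "p \<in> carrier R" "p' \<in> carrier R" "p1 \<in> carrier R" "p2 \<in> carrier R" for p p' p1 p2
  proof -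
    have k: "?k \<in> carrier R" using c by simp
    obtain k where "k = ?k" by simp
    with k have "k \<in> carrier R" by simp
    then have "(p \<oplus> k \<otimes> p2) \<ominus> (p' \<ominus> k \<otimes> (p1 \<ominus> t)) = p \<ominus> p' \<oplus> k \<otimes> (p1 \<oplus> p2 \<ominus> t)"
      using that c(6) by algebra
    then show ?thesis using \<open>k = ?k\<close> by simp
  qed
  ultimately show ?thesis
    using c by (simp only: split join m_closed a_closed minus_closed)
qed

text \<open>Modulo the Clifford and quadratic relations the defects of the two braid relations differ by
  the factor \<open>c\<^sub>i - c\<^bsub>i+2\<^esub>\<close> and a power of \<open>2\<close>. The square of that factor is \<open>2\<close>, so
  either braid relation implies the other.\<close>

lemma braid_defect:
  assumes c: "c1 \<in> carrier R" "c2 \<in> carrier R" "c3 \<in> carrier R" "T1 \<in> carrier R" "T2 \<in> carrier R"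
      "R1 \<in> carrier R" "R2 \<in> carrier R" "e \<in> carrier R"
    and e: "\<And>x. x \<in> carrier R \<Longrightarrow> x \<otimes> e = e \<otimes> x"
    and cc: "c1 \<otimes> c1 = \<one>" "c2 \<otimes> c2 = \<one>" "c3 \<otimes> c3 = \<one>"
      "c2 \<otimes> c1 = \<ominus> (c1 \<otimes> c2)" "c3 \<otimes> c1 = \<ominus> (c1 \<otimes> c3)" "c3 \<otimes> c2 = \<ominus> (c2 \<otimes> c3)"
    and t: "t = \<one> \<oplus> \<one>"
    and RR: "R1 \<otimes> R1 = \<ominus> (e \<otimes> e) \<ominus> t" "R2 \<otimes> R2 = \<ominus> (e \<otimes> e) \<ominus> t"
    and Rc: "R1 \<otimes> c1 = \<ominus> (c1 \<otimes> R1)" "R1 \<otimes> c2 = \<ominus> (c2 \<otimes> R1)" "R1 \<otimes> c3 = \<ominus> (c3 \<otimes> R1)"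
      "R2 \<otimes> c1 = \<ominus> (c1 \<otimes> R2)" "R2 \<otimes> c2 = \<ominus> (c2 \<otimes> R2)" "R2 \<otimes> c3 = \<ominus> (c3 \<otimes> R2)"
    and T: "t \<otimes> T1 = (c1 \<ominus> c2) \<otimes> (R1 \<ominus> e \<otimes> c2)" "t \<otimes> T2 = (c2 \<ominus> c3) \<otimes> (R2 \<ominus> e \<otimes> c3)"
  shows "t \<otimes> (t \<otimes> (t \<otimes> (T1 \<otimes> T2 \<otimes> T1 \<ominus> T2 \<otimes> T1 \<otimes> T2))) =
    t \<otimes> (c1 \<ominus> c3) \<otimes> (R1 \<otimes> R2 \<otimes> R1 \<ominus> R2 \<otimes> R1 \<otimes> R2 \<ominus> (e \<otimes> e) \<otimes> (R2 \<ominus> R1))"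
proof -
  have tc: "t \<in> carrier R" using t by simp
  have t_central: "x \<otimes> t = t \<otimes> x" if "x \<in> carrier R" for x
    using that by (simp add: t l_distr r_distr)
  have e': "c1 \<otimes> e = e \<otimes> c1" "c2 \<otimes> e = e \<otimes> c2" "c3 \<otimes> e = e \<otimes> c3" "R1 \<otimes> e = e \<otimes> R1" "R2 \<otimes> e = e \<otimes> R2"
    using c e by simp_all
  let ?u = "c1 \<ominus> c2" and ?v = "c2 \<ominus> c3" and ?S1 = "R1 \<ominus> e \<otimes> c2" and ?S2 = "R2 \<ominus> e \<otimes> c3"
  note rules = e' e'[THEN mult_eq_assoc] cc cc[THEN mult_eq_assoc] Rc Rc[THEN mult_eq_assoc]
  have "t \<otimes> (t \<otimes> (t \<otimes> (T1 \<otimes> T2 \<otimes> T1 \<ominus> T2 \<otimes> T1 \<otimes> T2))) =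
      (t \<otimes> T1) \<otimes> (t \<otimes> T2) \<otimes> (t \<otimes> T1) \<ominus> (t \<otimes> T2) \<otimes> (t \<otimes> T1) \<otimes> (t \<otimes> T2)"
    using c(4,5) tc t_central[OF c(4)] t_central[OF c(5)]
      t_central[OF c(4), THEN mult_eq_assoc] t_central[OF c(5), THEN mult_eq_assoc] by algebra
  also have "\<dots> = t \<otimes> (?u \<oplus> ?v) \<otimes> (?S1 \<otimes> ?S2 \<otimes> ?S1 \<ominus> ?S2 \<otimes> ?S1 \<otimes> ?S2
      \<oplus> e \<otimes> ?v \<otimes> (?S1 \<otimes> ?S2 \<oplus> ?S2 \<otimes> ?S1 \<ominus> t))"
    unfolding T
  proof (rule shifted_braid_words)
    show "?u \<otimes> ?u = t" "?v \<otimes> ?v = t" "?v \<otimes> ?u = \<ominus> (?u \<otimes> ?v) \<ominus> t"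
      unfolding t using c rules r_one by algebra+
    show "?S1 \<otimes> ?u = t \<otimes> e \<ominus> ?u \<otimes> ?S1" "?S1 \<otimes> ?v = \<ominus> (t \<otimes> e) \<ominus> ?v \<otimes> ?S1"
      "?S2 \<otimes> ?v = t \<otimes> e \<ominus> ?v \<otimes> ?S2" "?S2 \<otimes> ?u = \<ominus> (?u \<otimes> ?S2)"
      unfolding t using c rules r_one by algebra+
    show "?S2 \<otimes> ?S2 = \<ominus> t"
      using c tc rules RR RR[THEN mult_eq_assoc] r_one by algebra
  qed (intro t_central e minus_closed m_closed c tc)+
  also have "?u \<oplus> ?v = c1 \<ominus> c3" using c by algebra
  also have "?S1 \<otimes> ?S2 \<otimes> ?S1 \<ominus> ?S2 \<otimes> ?S1 \<otimes> ?S2 \<oplus> e \<otimes> ?v \<otimes> (?S1 \<otimes> ?S2 \<oplus> ?S2 \<otimes> ?S1 \<ominus> t) =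
      R1 \<otimes> R2 \<otimes> R1 \<ominus> R2 \<otimes> R1 \<otimes> R2 \<ominus> (e \<otimes> e) \<otimes> (R2 \<ominus> R1)"
    by (rule shifted_spin_braid) (intro t_central e c tc cc RR Rc refl)+
  finally show ?thesis .
qed

text \<open>Multiplying by \<open>a - b\<close> turns the hypothesis into \<open>4 x = 0\<close>.\<close>

lemma Clifford_difference_cancel:
  assumes two: "\<And>x. \<lbrakk>x \<in> carrier R; x \<oplus> x = \<zero>\<rbrakk> \<Longrightarrow> x = \<zero>"
    and c: "a \<in> carrier R" "b \<in> carrier R" "x \<in> carrier R"
    and ab: "a \<otimes> a = \<one>" "b \<otimes> b = \<one>" "b \<otimes> a = \<ominus> (a \<otimes> b)"
    and zero: "(\<one> \<oplus> \<one>) \<otimes> (a \<ominus> b) \<otimes> x = \<zero>"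
  shows "x = \<zero>"
proof -
  have sq: "(a \<ominus> b) \<otimes> (a \<ominus> b) = \<one> \<oplus> \<one>"
    using c ab ab[THEN mult_eq_assoc] r_one by algebra
  have u: "a \<ominus> b \<in> carrier R" using c by simp
  define u t where "u = a \<ominus> b" and "t = \<one> \<oplus> \<one>"
  have ut: "u \<in> carrier R" "t \<in> carrier R" "u \<otimes> u = t" "u \<otimes> t = t \<otimes> u" "t \<otimes> u \<otimes> x = \<zero>"
    using u sq zero by (simp_all add: u_def t_def l_distr r_distr)
  have "t \<otimes> (t \<otimes> x) = t \<otimes> ((u \<otimes> u) \<otimes> x)" by (simp only: ut(3))
  also have "\<dots> = (t \<otimes> u) \<otimes> (u \<otimes> x)" using ut(1,2) c(3) by (simp add: m_assoc)
  also have "\<dots> = (u \<otimes> t) \<otimes> (u \<otimes> x)" by (simp only: ut(4))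
  also have "\<dots> = u \<otimes> (t \<otimes> u \<otimes> x)" using ut(1,2) c(3) by (simp add: m_assoc)
  also have "\<dots> = \<zero>" using ut by simp
  finally have "(x \<oplus> x) \<oplus> (x \<oplus> x) = \<zero>"
    using c by (simp add: t_def l_distr r_distr)
  then show ?thesis using two[of "x \<oplus> x"] two[of x] c by simp
qed

end

section \<open>Families of generators\<close>

lemma cq_of_complex_embedding: "field_embedding cq_of_complex"
  by (simp add: field_embedding_def cq_of_complex_def One_fract_def one_pCons mult.commute)

lemma cq_two_nonzero: "(2 :: cq) \<noteq> 0"
proof -
  have "(2 :: cq) = Fract 2 1"
    by (simp only: one_add_one[symmetric] One_fract_def add_fract[OF one_neq_zero one_neq_zero]
        mult_1_right mult_1)
  also have "\<dots> \<noteq> Fract 0 1"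
    by (subst eq_fract) simp_all
  finally show ?thesis by (simp add: Zero_fract_def)
qed

lemma q_nonzero: "q \<noteq> 0"
  by (simp add: q_def Zero_fract_def eq_fract)

text \<open>The element \<open>\<epsilon> 1\<close> plays the role of the central element \<open>e\<close> in the ring identities above.\<close>

locale cq_superalgebra = superalgebra D for D :: "(cq, 'a) superalgebra" (structure)
begin

abbreviation eps where "eps \<equiv> \<epsilon> \<odot> \<one>"

lemma eps_closed [simp]: "eps \<in> carrier D"
  by simp

lemma eps_central: "x \<in> carrier D \<Longrightarrow> x \<otimes> eps = eps \<otimes> x"
  by (rule scale_one_central)

lemma eps_mult: "x \<in> carrier D \<Longrightarrow> eps \<otimes> x = \<epsilon> \<odot> x"
  by (rule scale_one_mult)

lemma double_eq_scale: "x \<in> carrier D \<Longrightarrow> x \<oplus> x = 2 \<odot> x"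
  using vsp.scale_left_add[of x 1 1] by simp

lemma no_2_torsion: "\<lbrakk>x \<in> carrier D; x \<oplus> x = \<zero>\<rbrakk> \<Longrightarrow> x = \<zero>"
proof -
  assume x: "x \<in> carrier D" "x \<oplus> x = \<zero>"
  have half: "(1 / 2) * 2 = (1 :: cq)" using cq_two_nonzero by simp
  have "x = ((1 / 2) * 2) \<odot> x" unfolding half using x(1) by simp
  also have "\<dots> = (1 / 2) \<odot> (2 \<odot> x)" using x(1) by simp
  also have "2 \<odot> x = \<zero>" using x double_eq_scale by simp
  finally show "x = \<zero>" by simp
qed

end

text \<open>The three sets of relations, imposed on elements of an arbitrary superalgebra. The relation
between \<open>R\<^sub>i\<close> and \<open>c\<^sub>j\<close> in \<open>clifford_spin_family\<close> is the one that holds in the tensor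
product.\<close>

locale clifford_family = cq_superalgebra D for D :: "(cq, 'a) superalgebra" (structure) +
  fixes n :: nat and c :: "nat \<Rightarrow> 'a"
  assumes c_homog: "i \<in> {1..n} \<Longrightarrow> c i \<in> homog D 1"
    and c_square: "i \<in> {1..n} \<Longrightarrow> c i \<otimes> c i = \<one>"
    and c_anticommute: "\<lbrakk>i \<in> {1..n}; j \<in> {1..n}; i \<noteq> j\<rbrakk> \<Longrightarrow> c i \<otimes> c j = \<ominus> (c j \<otimes> c i)"

locale hecke_clifford_family = clifford_family D n c
  for D :: "(cq, 'a) superalgebra" (structure) and n c +
  fixes T :: "nat \<Rightarrow> 'a"
  assumes T_homog: "i \<in> {1..<n} \<Longrightarrow> T i \<in> homog D 0"
    and T_square: "i \<in> {1..<n} \<Longrightarrow> T i \<otimes> T i = eps \<otimes> T i \<oplus> \<one>"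
    and T_braid: "\<lbrakk>i \<in> {1..<n}; i + 1 \<in> {1..<n}\<rbrakk> \<Longrightarrow> T i \<otimes> T (i + 1) \<otimes> T i = T (i + 1) \<otimes> T i \<otimes> T (i + 1)"
    and T_distant: "\<lbrakk>i \<in> {1..<n}; j \<in> {1..<n}; \<bar>int i - int j\<bar> > 1\<rbrakk> \<Longrightarrow> T i \<otimes> T j = T j \<otimes> T i"
    and T_c: "i \<in> {1..<n} \<Longrightarrow> T i \<otimes> c i = c (i + 1) \<otimes> T i"
    and T_c_distant: "\<lbrakk>i \<in> {1..<n}; j \<in> {1..n}; j \<noteq> i; j \<noteq> i + 1\<rbrakk> \<Longrightarrow> T i \<otimes> c j = c j \<otimes> T i"

locale clifford_spin_family = clifford_family D n c
  for D :: "(cq, 'a) superalgebra" (structure) and n c +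
  fixes S :: "nat \<Rightarrow> 'a"
  assumes S_homog: "i \<in> {1..<n} \<Longrightarrow> S i \<in> homog D 1"
    and S_square: "i \<in> {1..<n} \<Longrightarrow> S i \<otimes> S i = \<ominus> (eps \<otimes> eps) \<ominus> (\<one> \<oplus> \<one>)"
    and S_braid: "\<lbrakk>i \<in> {1..<n}; i + 1 \<in> {1..<n}\<rbrakk> \<Longrightarrow>
      S i \<otimes> S (i + 1) \<otimes> S i \<ominus> S (i + 1) \<otimes> S i \<otimes> S (i + 1) \<ominus> (eps \<otimes> eps) \<otimes> (S (i + 1) \<ominus> S i) = \<zero>"
    and S_distant: "\<lbrakk>i \<in> {1..<n}; j \<in> {1..<n}; \<bar>int i - int j\<bar> > 1\<rbrakk> \<Longrightarrow> S i \<otimes> S j = \<ominus> (S j \<otimes> S i)"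
    and S_c: "\<lbrakk>i \<in> {1..<n}; j \<in> {1..n}\<rbrakk> \<Longrightarrow> S i \<otimes> c j = \<ominus> (c j \<otimes> S i)"

text \<open>The expressions by which \<open>\<Psi>\<close> and \<open>\<Phi>\<close> are prescribed on generators.\<close>

definition spin_generator ::
    "(cq, 'a) superalgebra \<Rightarrow> (nat \<Rightarrow> 'a) \<Rightarrow> (nat \<Rightarrow> 'a) \<Rightarrow> nat \<Rightarrow> 'a" where
  "spin_generator D c T i =
     (c i \<ominus>\<^bsub>D\<^esub> c (i + 1)) \<otimes>\<^bsub>D\<^esub> T i \<oplus>\<^bsub>D\<^esub> \<epsilon> \<odot>\<^bsub>D\<^esub> c (i + 1)"

definition hecke_generator ::
    "(cq, 'a) superalgebra \<Rightarrow> (nat \<Rightarrow> 'a) \<Rightarrow> (nat \<Rightarrow> 'a) \<Rightarrow> nat \<Rightarrow> 'a" where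
  "hecke_generator D c S i =
     (- (1/2)) \<odot>\<^bsub>D\<^esub> (S i \<otimes>\<^bsub>D\<^esub> (c i \<ominus>\<^bsub>D\<^esub> c (i + 1))) \<oplus>\<^bsub>D\<^esub>
     (\<epsilon>/2) \<odot>\<^bsub>D\<^esub> (\<one>\<^bsub>D\<^esub> \<ominus>\<^bsub>D\<^esub> c i \<otimes>\<^bsub>D\<^esub> c (i + 1))"

context clifford_family
begin

lemma c_closed [simp]: "i \<in> {1..n} \<Longrightarrow> c i \<in> carrier D"
  using c_homog by (rule homog_in_carrier)

lemma c_rules:
  assumes "i \<in> {1..<n}"
  shows "c i \<in> carrier D" "c (i + 1) \<in> carrier D" "c i \<otimes> c i = \<one>" "c (i + 1) \<otimes> c (i + 1) = \<one>"
    "c (i + 1) \<otimes> c i = \<ominus> (c i \<otimes> c (i + 1))"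
  using assms by (auto intro!: c_closed c_square c_anticommute)

lemma hecke_generator_double:
  assumes "i \<in> {1..<n}" "S i \<in> carrier D"
  shows "hecke_generator D c S i \<oplus> hecke_generator D c S i =
    \<ominus> (S i \<otimes> (c i \<ominus> c (i + 1))) \<oplus> eps \<otimes> (\<one> \<ominus> c i \<otimes> c (i + 1))"
proof -
  let ?x = "S i \<otimes> (c i \<ominus> c (i + 1))" and ?y = "\<one> \<ominus> c i \<otimes> c (i + 1)"
  have cl: "?x \<in> carrier D" "?y \<in> carrier D" using assms c_rules[OF assms(1)] by simp_all
  have "hecke_generator D c S i \<oplus> hecke_generator D c S i = 2 \<odot> ((- (1/2)) \<odot> ?x \<oplus> (\<epsilon>/2) \<odot> ?y)"
    unfolding hecke_generator_def using cl by (intro double_eq_scale) simp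
  also have "\<dots> = (2 * (- (1/2))) \<odot> ?x \<oplus> (2 * (\<epsilon>/2)) \<odot> ?y"
    using cl vsp.scale_right_add[of "(- (1/2)) \<odot> ?x" "(\<epsilon>/2) \<odot> ?y" 2] by (simp del: vsp.scale_minus_left)
  finally have "hecke_generator D c S i \<oplus> hecke_generator D c S i = (2 * (- (1/2))) \<odot> ?x \<oplus> (2 * (\<epsilon>/2)) \<odot> ?y" .
  moreover have "2 * (- (1/2)) = (-1 :: cq)" "2 * (\<epsilon>/2) = \<epsilon>"
    using cq_two_nonzero by simp_all
  ultimately show ?thesis using cl by (simp add: eps_mult)
qed

text \<open>Doubling is injective, so a solution of the doubled equation is the generator itself.\<close>

lemma hecke_generator_unique:
  assumes "i \<in> {1..<n}" "S i \<in> carrier D" "x \<in> carrier D"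
    and "x \<oplus> x = \<ominus> (S i \<otimes> (c i \<ominus> c (i + 1))) \<oplus> eps \<otimes> (\<one> \<ominus> c i \<otimes> c (i + 1))"
  shows "hecke_generator D c S i = x"
proof (rule double_cancel[OF no_2_torsion])
  show "hecke_generator D c S i \<in> carrier D"
    using assms c_rules[OF assms(1)] by (simp add: hecke_generator_def)
  show "hecke_generator D c S i \<oplus> hecke_generator D c S i = x \<oplus> x"
    using hecke_generator_double[where S = S, OF assms(1,2)] assms(4) by simp
qed (use assms in simp_all)

text \<open>The element \<open>2 T\<close> equals \<open>(a - b) S\<close> with the shifted generator
\<open>S = R - \<epsilon> b\<close>.\<close>

lemma half_shift:
  assumes "a \<in> carrier D" "b \<in> carrier D" "s \<in> carrier D" "a \<otimes> a = \<one>" "b \<otimes> b = \<one>" "b \<otimes> a = \<ominus> (a \<otimes> b)"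
    and "s \<otimes> a = \<ominus> (a \<otimes> s)" "s \<otimes> b = \<ominus> (b \<otimes> s)"
  shows "\<ominus> (s \<otimes> (a \<ominus> b)) \<oplus> eps \<otimes> (\<one> \<ominus> a \<otimes> b) = (a \<ominus> b) \<otimes> (s \<ominus> eps \<otimes> b)"
proof -
  obtain e where e: "e = eps" by simp
  have ec: "e \<in> carrier D" "a \<otimes> e = e \<otimes> a" "b \<otimes> e = e \<otimes> b"
    using assms(1,2) eps_central unfolding e by simp_all
  show ?thesis
    unfolding e[symmetric]
    using assms ec assms(4-8)[THEN mult_eq_assoc] ec(2,3)[THEN mult_eq_assoc] r_one by algebra
qed

text \<open>Multiplication by \<open>2 (c\<^sub>i - c\<^bsub>i+2\<^esub>)\<close> and by \<open>8\<close> is injective, and the two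
defects become equal after these multiplications.\<close>

lemma braid_relations_iff:
  assumes i: "i \<in> {1..<n}" "i + 1 \<in> {1..<n}"
    and closed: "T1 \<in> carrier D" "T2 \<in> carrier D" "S1 \<in> carrier D" "S2 \<in> carrier D"
    and S: "S1 \<otimes> S1 = \<ominus> (eps \<otimes> eps) \<ominus> (\<one> \<oplus> \<one>)" "S2 \<otimes> S2 = \<ominus> (eps \<otimes> eps) \<ominus> (\<one> \<oplus> \<one>)"
    and Sc: "\<And>j. j \<in> {1..n} \<Longrightarrow> S1 \<otimes> c j = \<ominus> (c j \<otimes> S1)" "\<And>j. j \<in> {1..n} \<Longrightarrow> S2 \<otimes> c j = \<ominus> (c j \<otimes> S2)"
    and T: "T1 \<oplus> T1 = \<ominus> (S1 \<otimes> (c i \<ominus> c (i + 1))) \<oplus> eps \<otimes> (\<one> \<ominus> c i \<otimes> c (i + 1))"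
      "T2 \<oplus> T2 = \<ominus> (S2 \<otimes> (c (i + 1) \<ominus> c (i + 2))) \<oplus> eps \<otimes> (\<one> \<ominus> c (i + 1) \<otimes> c (i + 2))"
  shows "T1 \<otimes> T2 \<otimes> T1 = T2 \<otimes> T1 \<otimes> T2 \<longleftrightarrow>
    S1 \<otimes> S2 \<otimes> S1 \<ominus> S2 \<otimes> S1 \<otimes> S2 \<ominus> (eps \<otimes> eps) \<otimes> (S2 \<ominus> S1) = \<zero>"
proof -
  let ?a = "c i" and ?b = "c (i + 1)" and ?d = "c (i + 2)" and ?t = "\<one> \<oplus> \<one>"
  let ?x = "T1 \<otimes> T2 \<otimes> T1 \<ominus> T2 \<otimes> T1 \<otimes> T2"
  let ?y = "S1 \<otimes> S2 \<otimes> S1 \<ominus> S2 \<otimes> S1 \<otimes> S2 \<ominus> (eps \<otimes> eps) \<otimes> (S2 \<ominus> S1)"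
  have idx: "i \<in> {1..n}" "i + 1 \<in> {1..n}" "i + 2 \<in> {1..n}" using i by auto
  have cl: "?a \<in> carrier D" "?b \<in> carrier D" "?d \<in> carrier D" using idx by simp_all
  have cc: "?a \<otimes> ?a = \<one>" "?b \<otimes> ?b = \<one>" "?d \<otimes> ?d = \<one>"
      "?b \<otimes> ?a = \<ominus> (?a \<otimes> ?b)" "?d \<otimes> ?a = \<ominus> (?a \<otimes> ?d)" "?d \<otimes> ?b = \<ominus> (?b \<otimes> ?d)"
    using idx by (auto intro!: c_square c_anticommute)
  have tT: "?t \<otimes> x = x \<oplus> x" if "x \<in> carrier D" for x using that by (simp add: l_distr)
  have shift: "?t \<otimes> T1 = (?a \<ominus> ?b) \<otimes> (S1 \<ominus> eps \<otimes> ?b)" "?t \<otimes> T2 = (?b \<ominus> ?d) \<otimes> (S2 \<ominus> eps \<otimes> ?d)"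
    unfolding tT[OF closed(1)] tT[OF closed(2)] T
    by (rule half_shift; (rule cl closed cc Sc idx)+)+
  have defect: "?t \<otimes> (?t \<otimes> (?t \<otimes> ?x)) = ?t \<otimes> (?a \<ominus> ?d) \<otimes> ?y"
    by (rule braid_defect[OF cl closed eps_closed _ cc refl S])
      (assumption | rule eps_central Sc idx shift)+
  have xy: "?x \<in> carrier D" "?y \<in> carrier D" using closed by simp_all
  have "?x = \<zero> \<longleftrightarrow> ?y = \<zero>"
  proof
    assume "?x = \<zero>"
    then have "?t \<otimes> (?a \<ominus> ?d) \<otimes> ?y = \<zero>" unfolding defect[symmetric] by simp
    from Clifford_difference_cancel[OF no_2_torsion cl(1,3) xy(2) cc(1,3,5) this]
    show "?y = \<zero>" by simp
  next
    assume "?y = \<zero>"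
    then have "?t \<otimes> (?t \<otimes> (?t \<otimes> ?x)) = \<zero>" unfolding defect using cl by simp
    moreover have "z = \<zero>" if "z \<in> carrier D" "?t \<otimes> z = \<zero>" for z
      using no_2_torsion[OF that(1)] that tT[of z] by simp
    ultimately show "?x = \<zero>" using xy(1) by (metis m_closed a_closed one_closed)
  qed
  then show ?thesis using closed by (simp add: minus_eq_zero_iff)
qed

end

text \<open>For distant \<open>i\<close> and \<open>j\<close>, the element \<open>T\<^sub>i\<close> commutes with \<open>R\<^sub>j\<close>, while \<open>c\<^sub>i\<close> and
\<open>c\<^bsub>i+1\<^esub>\<close> anticommute with it; hence \<open>R\<^sub>i\<close> anticommutes with \<open>R\<^sub>j\<close>.\<close>

lemma (in hecke_clifford_family) clifford_spin_family_spin_generator: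
  "clifford_spin_family D n c (spin_generator D c T)"
proof -
  let ?S = "spin_generator D c T"
  have Tcl: "T i \<in> carrier D" if "i \<in> {1..<n}" for i using T_homog[OF that] by simp
  have S_eq: "?S i = (c i \<ominus> c (i + 1)) \<otimes> T i \<oplus> eps \<otimes> c (i + 1)" if "i \<in> {1..<n}" for i
    using c_rules(2)[OF that] by (simp add: spin_generator_def eps_mult)
  have basic: "?S i \<otimes> ?S i = \<ominus> (eps \<otimes> eps) \<ominus> (\<one> \<oplus> \<one>)"
    "?S i \<otimes> c i = \<ominus> (c i \<otimes> ?S i)" "?S i \<otimes> c (i + 1) = \<ominus> (c (i + 1) \<otimes> ?S i)"
    "T i \<oplus> T i = \<ominus> (?S i \<otimes> (c i \<ominus> c (i + 1))) \<oplus> eps \<otimes> (\<one> \<ominus> c i \<otimes> c (i + 1))"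
    if "i \<in> {1..<n}" for i
    by (rule spin_of_Hecke[OF c_rules(1,2)[OF that] Tcl[OF that] eps_closed eps_central eps_central
          eps_central c_rules(3-5)[OF that] T_c[OF that] T_square[OF that] S_eq[OF that]],
        (rule c_rules[OF that] Tcl[OF that])+)+
  have Scl: "?S i \<in> carrier D" if "i \<in> {1..<n}" for i
    using S_eq[OF that] Tcl[OF that] c_rules[OF that] by simp
  have S_c: "?S i \<otimes> c j = \<ominus> (c j \<otimes> ?S i)" if i: "i \<in> {1..<n}" and j: "j \<in> {1..n}" for i j
  proof -
    consider "j = i" | "j = i + 1" | "j \<noteq> i" "j \<noteq> i + 1" by blast
    then show ?thesis
    proof cases
      case 3
      show ?thesis
        by (rule spin_anticommutes[OF c_rules(1,2)[OF i] Tcl[OF i] eps_closed c_closed[OF j] _ _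
              eps_central[OF c_closed[OF j]] _ S_eq[OF i]])
          (use i j 3 in \<open>auto intro!: c_anticommute T_c_distant\<close>)
    qed (use basic(2,3)[OF i] in simp_all)
  qed
  show ?thesis
  proof unfold_locales
    fix i assume i: "i \<in> {1..<n}"
    have "c i \<in> homog D 1" "c (i + 1) \<in> homog D 1" using i by (auto intro!: c_homog)
    then show "?S i \<in> homog D 1"
      unfolding spin_generator_def
      using homog_mult[of "c i \<ominus> c (i + 1)" 1 "T i" 0] T_homog[OF i]
      by (intro homog_add homog_smult) (simp_all add: homog_minus)
    show "?S i \<otimes> ?S i = \<ominus> (eps \<otimes> eps) \<ominus> (\<one> \<oplus> \<one>)" by (rule basic(1)[OF i])
    show "?S i \<otimes> c j = \<ominus> (c j \<otimes> ?S i)" if "j \<in> {1..n}" for j by (rule S_c[OF i that])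
    show "?S i \<otimes> ?S (i + 1) \<otimes> ?S i \<ominus> ?S (i + 1) \<otimes> ?S i \<otimes> ?S (i + 1) \<ominus>
        (eps \<otimes> eps) \<otimes> (?S (i + 1) \<ominus> ?S i) = \<zero>" if i': "i + 1 \<in> {1..<n}"
      using braid_relations_iff[OF i i' Tcl[OF i] Tcl[OF i'] Scl[OF i] Scl[OF i'] basic(1)[OF i] basic(1)[OF i']
          S_c[OF i] S_c[OF i'] basic(4)[OF i]] basic(4)[OF i'] T_braid[OF i i'] by simp
    show "?S i \<otimes> ?S j = \<ominus> (?S j \<otimes> ?S i)" if j: "j \<in> {1..<n}" and ij: "\<bar>int i - int j\<bar> > 1" for j
    proof -
      have idx: "i \<in> {1..n}" "i + 1 \<in> {1..n}" "j \<in> {1..n}" "j + 1 \<in> {1..n}" using i j by auto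
      have "T i \<otimes> ?S j = ?S j \<otimes> T i"
        by (rule commutes_spin[OF c_rules(1,2)[OF j] Tcl[OF j] eps_closed Tcl[OF i] _ _ _
              eps_central[OF Tcl[OF i]] S_eq[OF j]])
          (use i j ij idx in \<open>auto intro!: T_c_distant T_distant\<close>)
      then show ?thesis
        by (intro spin_anticommutes[OF c_rules(1,2)[OF i] Tcl[OF i] eps_closed Scl[OF j] _ _
              eps_central[OF Scl[OF j]] _ S_eq[OF i]] S_c j idx)
    qed
  qed
qed

lemma (in hecke_clifford_family) hecke_generator_spin_generator:
  assumes i: "i \<in> {1..<n}"
  shows "hecke_generator D c (spin_generator D c T) i = T i"
proof -
  have Tcl: "T i \<in> carrier D" using T_homog[OF i] by simp
  have S_eq: "spin_generator D c T i = (c i \<ominus> c (i + 1)) \<otimes> T i \<oplus> eps \<otimes> c (i + 1)"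
    using c_rules(2)[OF i] by (simp add: spin_generator_def eps_mult)
  show ?thesis
  proof (rule hecke_generator_unique[OF i _ Tcl])
    show "spin_generator D c T i \<in> carrier D"
      using S_eq Tcl c_rules[OF i] by simp
  qed (rule spin_of_Hecke(4)[OF c_rules(1,2)[OF i] Tcl eps_closed eps_central eps_central
        eps_central c_rules(3-5)[OF i] T_c[OF i] T_square[OF i] S_eq], (rule c_rules[OF i] Tcl)+)
qed

context clifford_spin_family
begin

lemma S_closed: "i \<in> {1..<n} \<Longrightarrow> S i \<in> carrier D"
  using S_homog by (rule homog_in_carrier)

lemma hecke_generator_rules:
  assumes i: "i \<in> {1..<n}"
  defines "t \<equiv> hecke_generator D c S i"
  shows "t \<in> homog D 0" "t \<otimes> c i = c (i + 1) \<otimes> t" "t \<otimes> t = eps \<otimes> t \<oplus> \<one>"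
    "S i = (c i \<ominus> c (i + 1)) \<otimes> t \<oplus> eps \<otimes> c (i + 1)"
proof -
  have idx: "i \<in> {1..n}" "i + 1 \<in> {1..n}" using i by auto
  have "S i \<otimes> (c i \<ominus> c (i + 1)) \<in> homog D (1 + 1)" "c i \<otimes> c (i + 1) \<in> homog D (1 + 1)"
    by (intro homog_mult homog_minus S_homog c_homog i idx)+
  then show homog: "t \<in> homog D 0"
    unfolding t_def hecke_generator_def
    by (intro homog_add homog_smult homog_minus homog_one) simp_all
  then have tcl: "t \<in> carrier D" by simp
  show "t \<otimes> c i = c (i + 1) \<otimes> t" "t \<otimes> t = eps \<otimes> t \<oplus> \<one>" "S i = (c i \<ominus> c (i + 1)) \<otimes> t \<oplus> eps \<otimes> c (i + 1)"
    by (rule Hecke_of_spin[OF no_2_torsion c_rules(1,2)[OF i] tcl S_closed[OF i] eps_closed eps_central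
          eps_central eps_central eps_central c_rules(3-5)[OF i] S_square[OF i] S_c[OF i idx(1)]
          S_c[OF i idx(2)] hecke_generator_double[where S = S, OF i S_closed[OF i], folded t_def]],
        (assumption | rule c_rules[OF i] tcl S_closed[OF i])+)+
qed

lemma spin_generator_hecke_generator:
  assumes i: "i \<in> {1..<n}"
  shows "spin_generator D c (hecke_generator D c S) i = S i"
  using hecke_generator_rules(4)[OF i] c_rules(2)[OF i] by (simp add: spin_generator_def eps_mult)

text \<open>For distant \<open>i\<close> and \<open>j\<close>, the element \<open>T\<^sub>i\<close> commutes with all odd elements \<open>R\<^sub>j\<close>,
\<open>c\<^sub>j\<close> and \<open>c\<^bsub>j+1\<^esub>\<close> from which \<open>T\<^sub>j\<close> is built.\<close>

lemma hecke_clifford_family_hecke_generator: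
  "hecke_clifford_family D n c (hecke_generator D c S)"
proof -
  let ?T = "hecke_generator D c S"
  note Scl = S_closed
  have Tcl: "?T i \<in> carrier D" if "i \<in> {1..<n}" for i using hecke_generator_rules(1)[OF that] by simp
  note double = hecke_generator_double[where S = S, OF _ S_closed]
  have T_c_distant: "?T i \<otimes> c j = c j \<otimes> ?T i"
    if i: "i \<in> {1..<n}" and j: "j \<in> {1..n}" "j \<noteq> i" "j \<noteq> i + 1" for i j
  proof (rule Hecke_commutes[OF no_2_torsion c_rules(1,2)[OF i] Tcl[OF i] Scl[OF i] eps_closed c_closed[OF j(1)]
        _ _ eps_central[OF c_closed[OF j(1)]] _ double[OF i i]])
    show "c j \<otimes> S i = \<ominus> (S i \<otimes> c j)"
      using S_c[OF i j(1)] Scl[OF i] c_closed[OF j(1)] by simp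
  qed (use i j in \<open>auto intro!: c_anticommute\<close>)
  show ?thesis
  proof unfold_locales
    fix i assume i: "i \<in> {1..<n}"
    have idx: "i \<in> {1..n}" "i + 1 \<in> {1..n}" using i by auto
    show "?T i \<in> homog D 0" "?T i \<otimes> c i = c (i + 1) \<otimes> ?T i" "?T i \<otimes> ?T i = eps \<otimes> ?T i \<oplus> \<one>"
      by (rule hecke_generator_rules[OF i])+
    show "?T i \<otimes> c j = c j \<otimes> ?T i" if "j \<in> {1..n}" "j \<noteq> i" "j \<noteq> i + 1" for j
      by (rule T_c_distant[OF i that])
    show "?T i \<otimes> ?T (i + 1) \<otimes> ?T i = ?T (i + 1) \<otimes> ?T i \<otimes> ?T (i + 1)" if i': "i + 1 \<in> {1..<n}"
      using braid_relations_iff[OF i i' Tcl[OF i] Tcl[OF i'] Scl[OF i] Scl[OF i'] S_square[OF i] S_square[OF i']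
          S_c[OF i] S_c[OF i'] double[OF i i]] double[OF i' i'] S_braid[OF i i'] by simp
    show "?T i \<otimes> ?T j = ?T j \<otimes> ?T i" if j: "j \<in> {1..<n}" and ij: "\<bar>int i - int j\<bar> > 1" for j
    proof -
      have jdx: "j \<in> {1..n}" "j + 1 \<in> {1..n}" using j by auto
      have SS: "S j \<otimes> S i = \<ominus> (S i \<otimes> S j)" using S_distant[OF j i] ij by simp
      have TS: "?T i \<otimes> S j = S j \<otimes> ?T i"
        by (rule Hecke_commutes[OF no_2_torsion c_rules(1,2)[OF i] Tcl[OF i] Scl[OF i] eps_closed Scl[OF j]
              _ _ eps_central[OF Scl[OF j]] _ double[OF i i]]) (assumption | rule S_c[OF j] SS idx)+
      show ?thesis
        by (rule commutes_Hecke[OF no_2_torsion c_rules(1,2)[OF j] Tcl[OF j] Scl[OF j] eps_closed Tcl[OF i]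
              _ _ eps_central[OF Tcl[OF i]] TS double[OF j j]])
          (use i j ij jdx in \<open>auto intro!: T_c_distant\<close>)
    qed
  qed
qed

end

section \<open>Evaluating the defining relations\<close>

text \<open>Expand, using \<open>q - q\<^bsup>-1\<^esup> = \<epsilon>\<close> and \<open>q q\<^bsup>-1\<^esup> = 1\<close>.\<close>

lemma (in cq_superalgebra) Hecke_quadratic:
  assumes "x \<in> carrier D"
  shows "(x \<ominus> q \<odot> \<one>) \<otimes> (x \<oplus> inverse q \<odot> \<one>) = x \<otimes> x \<ominus> (eps \<otimes> x \<oplus> \<one>)"
proof -
  obtain k l where kl: "k = q \<odot> \<one>" "l = inverse q \<odot> \<one>" by simp
  have "k \<otimes> l = (q * inverse q) \<odot> \<one>" unfolding kl by (simp add: scale_one_mult)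
  then have c: "k \<in> carrier D" "l \<in> carrier D" "x \<otimes> k = k \<otimes> x" "x \<otimes> l = l \<otimes> x" "k \<otimes> l = \<one>"
    using scale_one_central[OF assms, of q] scale_one_central[OF assms, of "inverse q"] q_nonzero
    by (simp_all add: kl)
  have "eps = k \<ominus> l"
    unfolding kl \<epsilon>_def using vsp.scale_left_add[of \<one> q "- inverse q"] by (simp add: minus_eq)
  then show ?thesis
    unfolding kl[symmetric] using assms c c(3-5)[THEN mult_eq_assoc] r_one by algebra
qed

lemma (in cq_superalgebra) spin_scalars:
  "(- \<epsilon>\<^sup>2 - 2) \<odot> \<one> = \<ominus> (eps \<otimes> eps) \<ominus> (\<one> \<oplus> \<one>)" "\<epsilon>\<^sup>2 \<odot> \<one> = eps \<otimes> eps"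
proof -
  show eps: "\<epsilon>\<^sup>2 \<odot> \<one> = eps \<otimes> eps"
    by (simp add: scale_one_mult power2_eq_square)
  have "(- \<epsilon>\<^sup>2 - 2) \<odot> \<one> = (- (\<epsilon>\<^sup>2)) \<odot> \<one> \<oplus> (- 2) \<odot> \<one>"
    using vsp.scale_left_add[of \<one> "- (\<epsilon>\<^sup>2)" "- 2"] by simp
  then show "(- \<epsilon>\<^sup>2 - 2) \<odot> \<one> = \<ominus> (eps \<otimes> eps) \<ominus> (\<one> \<oplus> \<one>)"
    using eps double_eq_scale[of \<one>] by (simp add: minus_eq)
qed

definition hc_letter_value :: "(nat \<Rightarrow> 'a) \<Rightarrow> (nat \<Rightarrow> 'a) \<Rightarrow> hc_letter \<Rightarrow> 'a" where
  "hc_letter_value c T x = (case x of HT i \<Rightarrow> T i | HC i \<Rightarrow> c i)"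

lemma hc_letter_value_simps [simp]: "hc_letter_value c T (HT i) = T i" "hc_letter_value c T (HC i) = c i"
  by (simp_all add: hc_letter_value_def)

lemma hc_gens_iff [simp]: "HT i \<in> hc_gens n \<longleftrightarrow> i \<in> {1..<n}" "HC i \<in> hc_gens n \<longleftrightarrow> i \<in> {1..n}"
  by (auto simp: hc_gens_def)

text \<open>Connects the presentation with families: from right to left it is applied to the generators of
  the presented algebra, from left to right to their prospective images. Each relation is evaluated
  separately.\<close>

lemma hecke_clifford_family_iff:
  fixes D :: "(cq, 'a) superalgebra" (structure)
  assumes D: "superalgebra D"
    and T: "\<And>i. i \<in> {1..<n} \<Longrightarrow> T i \<in> homog D 0" and c: "\<And>i. i \<in> {1..n} \<Longrightarrow> c i \<in> homog D 1"
  shows "hecke_clifford_family D n c T \<longleftrightarrow> (\<forall>r\<in>hc_rels n. free_eval D (hc_letter_value c T) r = \<zero>)"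
proof -
  interpret cq_superalgebra D using D by (simp add: cq_superalgebra_def)
  let ?ev = "free_eval D (hc_letter_value c T)"
  have g: "hc_letter_value c T x \<in> homog D (hc_parity x)" if "x \<in> hc_gens n" for x
    using that T c by (cases x) simp_all
  note ev = free_eval_rules[of "hc_gens n" "hc_letter_value c T" hc_parity, OF g]
  have cl: "T i \<in> carrier D" if "i \<in> {1..<n}" for i using T[OF that] by simp
  have ccl: "c i \<in> carrier D" if "i \<in> {1..n}" for i using c[OF that] by simp
  have [simp]: "i + 1 \<in> {1..n}" "Suc i \<in> {1..n}" "i \<in> {1..n}" if "i \<in> {1..<n}" for i using that by auto
  note [simp] = ev cl ccl minus_eq_zero_iff add_eq_zero_iff Hecke_quadratic
  have all_image: "(\<forall>r\<in>{f i | i. P i}. Q r) \<longleftrightarrow> (\<forall>i. P i \<longrightarrow> Q (f i))"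
    "(\<forall>r\<in>{h i j | i j. P' i j}. Q r) \<longleftrightarrow> (\<forall>i j. P' i j \<longrightarrow> Q (h i j))"
    for f :: "nat \<Rightarrow> hc_letter list \<Rightarrow>\<^sub>0 cq" and h P P' Q by blast+
  let ?t = "\<lambda>i. gen (HT i) :: hc_letter list \<Rightarrow>\<^sub>0 cq" and ?c = "\<lambda>i. gen (HC i) :: hc_letter list \<Rightarrow>\<^sub>0 cq"
  have 1: "?ev ((?t i - const q) * (?t i + const (inverse q))) = \<zero> \<longleftrightarrow> T i \<otimes> T i = eps \<otimes> T i \<oplus> \<one>"
    if "i \<in> {1..<n}" for i using that by simp
  have 2: "?ev (?t i * ?t (i + 1) * ?t i - ?t (i + 1) * ?t i * ?t (i + 1)) = \<zero> \<longleftrightarrow>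
      T i \<otimes> T (i + 1) \<otimes> T i = T (i + 1) \<otimes> T i \<otimes> T (i + 1)"
    if "i \<in> {1..<n} \<and> i + 1 \<in> {1..<n}" for i
    using that by simp
  have 3: "?ev (?t i * ?t j - ?t j * ?t i) = \<zero> \<longleftrightarrow> T i \<otimes> T j = T j \<otimes> T i"
    if "i \<in> {1..<n} \<and> j \<in> {1..<n} \<and> \<bar>int i - int j\<bar> > 1" for i j using that by simp
  have 4: "?ev (?t i * ?c i - ?c (i + 1) * ?t i) = \<zero> \<longleftrightarrow> T i \<otimes> c i = c (i + 1) \<otimes> T i"
    if "i \<in> {1..<n}" for i using that by simp
  have 5: "?ev (?t i * ?c j - ?c j * ?t i) = \<zero> \<longleftrightarrow> T i \<otimes> c j = c j \<otimes> T i"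
    if "i \<in> {1..<n} \<and> j \<in> {1..n} \<and> j \<noteq> i \<and> j \<noteq> i + 1" for i j using that by simp
  have 6: "?ev (?c i * ?c i - 1) = \<zero> \<longleftrightarrow> c i \<otimes> c i = \<one>" if "i \<in> {1..n}" for i using that by simp
  have 7: "?ev (?c i * ?c j + ?c j * ?c i) = \<zero> \<longleftrightarrow> c i \<otimes> c j = \<ominus> (c j \<otimes> c i)"
    if "i \<in> {1..n} \<and> j \<in> {1..n} \<and> i \<noteq> j" for i j using that by simp
  have "(\<forall>r\<in>hc_rels n. ?ev r = \<zero>) \<longleftrightarrow>
      (\<forall>i. i \<in> {1..<n} \<longrightarrow> T i \<otimes> T i = eps \<otimes> T i \<oplus> \<one>) \<and>
      (\<forall>i. i \<in> {1..<n} \<and> i + 1 \<in> {1..<n} \<longrightarrow> T i \<otimes> T (i + 1) \<otimes> T i = T (i + 1) \<otimes> T i \<otimes> T (i + 1)) \<and>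
      (\<forall>i j. i \<in> {1..<n} \<and> j \<in> {1..<n} \<and> \<bar>int i - int j\<bar> > 1 \<longrightarrow> T i \<otimes> T j = T j \<otimes> T i) \<and>
      (\<forall>i. i \<in> {1..<n} \<longrightarrow> T i \<otimes> c i = c (i + 1) \<otimes> T i) \<and>
      (\<forall>i j. i \<in> {1..<n} \<and> j \<in> {1..n} \<and> j \<noteq> i \<and> j \<noteq> i + 1 \<longrightarrow> T i \<otimes> c j = c j \<otimes> T i) \<and>
      (\<forall>i. i \<in> {1..n} \<longrightarrow> c i \<otimes> c i = \<one>) \<and>
      (\<forall>i j. i \<in> {1..n} \<and> j \<in> {1..n} \<and> i \<noteq> j \<longrightarrow> c i \<otimes> c j = \<ominus> (c j \<otimes> c i))"
    unfolding hc_rels_def Let_def ball_Un all_image conj_assoc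
    by (intro arg_cong2[where f = "(\<and>)"] all_cong1 imp_cong[OF refl] 1 2 3 4 5 6 7)
  also have "\<dots> \<longleftrightarrow> hecke_clifford_family D n c T"
    unfolding hecke_clifford_family_def hecke_clifford_family_axioms_def clifford_family_def
      clifford_family_axioms_def
    using cq_superalgebra_axioms T c by blast
  finally show ?thesis ..
qed

lemma clifford_rels_vanish:
  assumes "clifford_family D n c" and r: "r \<in> clifford_rels n"
  shows "free_eval (restrict_scalars cq_of_complex D) c r = \<zero>\<^bsub>D\<^esub>"
proof -
  interpret clifford_family D n c by fact
  interpret E: superalgebra "restrict_scalars cq_of_complex D"
    by (rule superalgebra_restrict_scalars[OF superalgebra_axioms cq_of_complex_embedding])
  have g: "c i \<in> homog (restrict_scalars cq_of_complex D) 1" if "i \<in> clifford_gens n" for i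
    using that c_homog by (simp add: clifford_gens_def)
  let ?F = "free_superalgebra (clifford_gens n) (\<lambda>_. 1)"
  let ?ev = "free_eval (restrict_scalars cq_of_complex D) c"
  have ev: "?ev (f * f') = ?ev f \<otimes>\<^bsub>D\<^esub> ?ev f'" "?ev (f + f') = ?ev f \<oplus>\<^bsub>D\<^esub> ?ev f'"
    "?ev (f - f') = ?ev f \<ominus>\<^bsub>restrict_scalars cq_of_complex D\<^esub> ?ev f'"
    if "f \<in> carrier ?F" "f' \<in> carrier ?F" for f f'
    using E.free_eval_rules(1-3)[of "clifford_gens n" c "\<lambda>_. 1" f f'] g that by simp_all
  have ev_one: "?ev 1 = \<one>\<^bsub>D\<^esub>"
    using E.free_eval_rules(5)[of "clifford_gens n" c "\<lambda>_. 1"] g by simp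
  have gen: "gen i \<in> carrier ?F" "?ev (gen i) = c i" "c i \<in> carrier D" if "i \<in> {1..n}" for i
    using that E.free_eval_rules(6)[of "clifford_gens n" c "\<lambda>_. 1" i] g by (simp_all add: clifford_gens_def)
  from r show ?thesis
    unfolding clifford_rels_def
  proof (elim UnE CollectE exE conjE)
    fix i assume r: "r = gen i * gen i - 1" and i: "i \<in> {1..n}"
    have "free_eval (restrict_scalars cq_of_complex D) c r =
        c i \<otimes>\<^bsub>D\<^esub> c i \<ominus>\<^bsub>restrict_scalars cq_of_complex D\<^esub> \<one>\<^bsub>D\<^esub>"
      unfolding r ev(3)[OF free_carrier_closed(2)[OF gen(1)[OF i] gen(1)[OF i]] free_one_carrier]
        ev(1)[OF gen(1)[OF i] gen(1)[OF i]] gen(2)[OF i] ev_one ..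
    then show ?thesis
      using c_square[OF i] E.minus_eq_zero_iff[of "\<one>\<^bsub>D\<^esub>" "\<one>\<^bsub>D\<^esub>"] by simp
  next
    fix i j assume r: "r = gen i * gen j + gen j * gen i" and i: "i \<in> {1..n}" and j: "j \<in> {1..n}" and "i \<noteq> j"
    have "free_eval (restrict_scalars cq_of_complex D) c r = c i \<otimes>\<^bsub>D\<^esub> c j \<oplus>\<^bsub>D\<^esub> c j \<otimes>\<^bsub>D\<^esub> c i"
      unfolding r ev(2)[OF free_carrier_closed(2)[OF gen(1)[OF i] gen(1)[OF j]]
          free_carrier_closed(2)[OF gen(1)[OF j] gen(1)[OF i]]]
        ev(1)[OF gen(1)[OF i] gen(1)[OF j]] ev(1)[OF gen(1)[OF j] gen(1)[OF i]]
        gen(2)[OF i] gen(2)[OF j] ..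
    then show ?thesis
      using c_anticommute[OF i j \<open>i \<noteq> j\<close>] gen(3)[OF i] gen(3)[OF j] by (simp add: l_neg)
  qed
qed

lemma spin_hecke_rels_vanish:
  fixes D :: "(cq, 'a) superalgebra" (structure)
  assumes "clifford_spin_family D n c S" and r: "r \<in> spin_hecke_rels n"
  shows "free_eval D S r = \<zero>"
proof -
  interpret clifford_spin_family D n c S by fact
  have g: "S i \<in> homog D 1" if "i \<in> spin_hecke_gens n" for i
    using that S_homog by (simp add: spin_hecke_gens_def)
  let ?F = "free_superalgebra (spin_hecke_gens n) (\<lambda>_. 1)" and ?ev = "free_eval D S"
  have ev: "?ev (f * f') = ?ev f \<otimes> ?ev f'" "?ev (f + f') = ?ev f \<oplus> ?ev f'" "?ev (f - f') = ?ev f \<ominus> ?ev f'"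
    if "f \<in> carrier ?F" "f' \<in> carrier ?F" for f f'
    using free_eval_rules(1-3)[of "spin_hecke_gens n" S "\<lambda>_. 1" f f'] g that by simp_all
  have ev_const: "?ev (const k) = k \<odot> \<one>" for k
    using free_eval_rules(4)[of "spin_hecke_gens n" S "\<lambda>_. 1"] g by simp
  have gen: "gen i \<in> carrier ?F" "?ev (gen i) = S i" if "i \<in> {1..<n}" for i
    using that free_eval_rules(6)[of "spin_hecke_gens n" S "\<lambda>_. 1" i] g by (simp_all add: spin_hecke_gens_def)
  note F = free_carrier_closed[where p = "\<lambda>_. 1"] const_carrier[where p = "\<lambda>_. 1"]
  from r show ?thesis
    unfolding spin_hecke_rels_def Let_def
  proof (elim UnE CollectE exE conjE)
    fix i assume r: "r = gen i * gen i - const (- \<epsilon>\<^sup>2 - 2)" and i: "i \<in> {1..<n}"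
    have "?ev r = S i \<otimes> S i \<ominus> (- \<epsilon>\<^sup>2 - 2) \<odot> \<one>"
      unfolding r by (simp only: ev F gen[OF i] ev_const)
    then show ?thesis
      unfolding S_square[OF i] spin_scalars by (simp add: minus_eq_zero_iff)
  next
    fix i j assume r: "r = gen i * gen j + gen j * gen i" and ij: "i \<in> {1..<n}" "j \<in> {1..<n}" "1 < \<bar>int i - int j\<bar>"
    have "?ev r = S i \<otimes> S j \<oplus> S j \<otimes> S i"
      unfolding r by (simp only: ev F gen[OF ij(1)] gen[OF ij(2)])
    then show ?thesis
      using S_distant[OF ij] S_closed ij by (simp add: l_neg)
  next
    fix i assume r: "r = gen i * gen (i + 1) * gen i - gen (i + 1) * gen i * gen (i + 1) - const (\<epsilon>\<^sup>2) * (gen (i + 1) - gen i)"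
      and i: "i \<in> {1..<n}" "i + 1 \<in> {1..<n}"
    have "?ev r = S i \<otimes> S (i + 1) \<otimes> S i \<ominus> S (i + 1) \<otimes> S i \<otimes> S (i + 1)
        \<ominus> (\<epsilon>\<^sup>2 \<odot> \<one>) \<otimes> (S (i + 1) \<ominus> S i)"
      unfolding r by (simp only: ev F gen[OF i(1)] gen[OF i(2)] ev_const)
    then show ?thesis using S_braid[OF i] by (simp only: spin_scalars)
  qed
qed

section \<open>Clifford, Hecke-Clifford and spin Hecke algebras\<close>

text \<open>A presentation yields a graded quotient because each relation is homogeneous.\<close>

lemma hc_presentation: "presentation (hc_gens n) hc_parity (hc_rels n)"
proof
  fix r assume r: "r \<in> hc_rels n"
  let ?F = "free_superalgebra (hc_gens n) hc_parity :: (cq, _) superalgebra"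
  let ?t = "\<lambda>i. gen (HT i) :: hc_letter list \<Rightarrow>\<^sub>0 cq" and ?c = "\<lambda>i. gen (HC i) :: hc_letter list \<Rightarrow>\<^sub>0 cq"
  have t: "?t i \<in> homog ?F 0" if "i \<in> {1..<n}" for i
    using gen_homog[of "HT i" "hc_gens n" hc_parity] that by simp
  have c: "?c i \<in> homog ?F 1" if "i \<in> {1..n}" for i
    using gen_homog[of "HC i" "hc_gens n" hc_parity] that by simp
  have succ: "i \<in> {1..n} \<and> i + 1 \<in> {1..n}" if "i \<in> {1..<n}" for i using that by auto
  note rules = free_homog_rules(2-5) free_homog_mult
  from r show "\<exists>s. r \<in> homog ?F s"
    unfolding hc_rels_def Let_def
  proof (elim UnE CollectE exE conjE)
    fix i assume r: "r = (?t i - const q) * (?t i + const (inverse q))" and i: "i \<in> {1..<n}"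
    have "r \<in> homog ?F 0" unfolding r by (intro rules t i)
    then show ?thesis ..
  next
    fix i assume r: "r = ?t i * ?t (i + 1) * ?t i - ?t (i + 1) * ?t i * ?t (i + 1)"
      and i: "i \<in> {1..<n}" "i + 1 \<in> {1..<n}"
    have "r \<in> homog ?F 0" unfolding r by (intro rules t i)
    then show ?thesis ..
  next
    fix i j assume r: "r = ?t i * ?t j - ?t j * ?t i" and i: "i \<in> {1..<n}" "j \<in> {1..<n}"
    have "r \<in> homog ?F 0" unfolding r by (intro rules t i)
    then show ?thesis ..
  next
    fix i assume r: "r = ?t i * ?c i - ?c (i + 1) * ?t i" and i: "i \<in> {1..<n}"
    have "r \<in> homog ?F 1"
      unfolding r using succ[OF i] by (intro free_homog_rules(3) free_homog_mult(2)[OF t c] free_homog_mult(3)[OF c t] i) simp_all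
    then show ?thesis ..
  next
    fix i j assume r: "r = ?t i * ?c j - ?c j * ?t i" and i: "i \<in> {1..<n}" "j \<in> {1..n}"
    have "r \<in> homog ?F 1"
      unfolding r by (intro free_homog_rules(3) free_homog_mult(2)[OF t c] free_homog_mult(3)[OF c t] i)
    then show ?thesis ..
  next
    fix i assume r: "r = ?c i * ?c i - 1" and i: "i \<in> {1..n}"
    have "r \<in> homog ?F 0" unfolding r by (intro free_homog_rules(3,5) free_homog_mult(4) c i)
    then show ?thesis ..
  next
    fix i j assume r: "r = ?c i * ?c j + ?c j * ?c i" and i: "i \<in> {1..n}" "j \<in> {1..n}"
    have "r \<in> homog ?F 0" unfolding r by (intro free_homog_rules(2) free_homog_mult(4) c i)
    then show ?thesis ..
  qed
qed

lemma clifford_presentation: "presentation (clifford_gens n) (\<lambda>_. 1) (clifford_rels n)"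
proof
  fix r assume r: "r \<in> clifford_rels n"
  let ?F = "free_superalgebra (clifford_gens n) (\<lambda>_. 1) :: (complex, _) superalgebra"
  have c: "gen i \<in> homog ?F 1" if "i \<in> {1..n}" for i
    using gen_homog[of i "clifford_gens n" "\<lambda>_. 1"] that by (simp add: clifford_gens_def)
  from r have "r \<in> homog ?F 0"
    unfolding clifford_rels_def
    by (elim UnE CollectE exE conjE) (simp_all only:, (intro free_homog_rules free_homog_mult(4) c; assumption)+)
  then show "\<exists>s. r \<in> homog ?F s" ..
qed

lemma spin_hecke_presentation: "presentation (spin_hecke_gens n) (\<lambda>_. 1) (spin_hecke_rels n)"
proof
  fix r assume r: "r \<in> spin_hecke_rels n"
  let ?F = "free_superalgebra (spin_hecke_gens n) (\<lambda>_. 1) :: (cq, _) superalgebra"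
  have c: "gen i \<in> homog ?F 1" if "i \<in> {1..<n}" for i
    using gen_homog[of i "spin_hecke_gens n" "\<lambda>_. 1"] that by (simp add: spin_hecke_gens_def)
  from r show "\<exists>s. r \<in> homog ?F s"
    unfolding spin_hecke_rels_def Let_def
  proof (elim UnE CollectE exE conjE)
    fix i assume r: "r = gen i * gen i - const (- \<epsilon>\<^sup>2 - 2)" and i: "i \<in> {1..<n}"
    have "r \<in> homog ?F 0" unfolding r by (intro free_homog_rules(3,4) free_homog_mult(4) c i)
    then show ?thesis ..
  next
    fix i j assume r: "r = gen i * gen j + gen j * gen i" and i: "i \<in> {1..<n}" "j \<in> {1..<n}"
    have "r \<in> homog ?F 0" unfolding r by (intro free_homog_rules(2) free_homog_mult(4) c i)
    then show ?thesis ..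
  next
    fix i assume r: "r = gen i * gen (i + 1) * gen i - gen (i + 1) * gen i * gen (i + 1) - const (\<epsilon>\<^sup>2) * (gen (i + 1) - gen i)"
      and i: "i \<in> {1..<n}" "i + 1 \<in> {1..<n}"
    have "r \<in> homog ?F 1"
      unfolding r by (intro free_homog_rules(3) free_homog_mult(2)[OF free_homog_mult(4)]
          free_homog_mult(2)[OF free_homog_rules(4)] c i)
    then show ?thesis ..
  qed
qed

lemma superalgebra_clifford: "superalgebra (clifford n)"
  and superalgebra_spin_hecke: "superalgebra (spin_hecke n)"
  unfolding clifford_def spin_hecke_def
  by (rule presentation.superalgebra_presented[OF clifford_presentation]
      presentation.superalgebra_presented[OF spin_hecke_presentation])+

text \<open>On the presented algebra, evaluation at the classes of the letters is the projection, which kills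
the relations.\<close>

lemma hecke_clifford_generators:
  "hecke_clifford_family (hecke_clifford n) n (hc_c n) (hc_T n)"
proof -
  interpret presentation "hc_gens n" hc_parity "hc_rels n" by (rule hc_presentation)
  have letters: "hc_letter_value (hc_c n) (hc_T n) = (\<lambda>x. cl (gen x))"
  proof
    show "hc_letter_value (hc_c n) (hc_T n) x = cl (gen x)" for x
      by (cases x) (simp_all add: hc_c_def hc_T_def hc_class_def)
  qed
  have homog: "hc_T n i \<in> homog P 0" if "i \<in> {1..<n}" for i
    using class_gen_homog[of "HT i"] that by (simp add: hc_T_def hc_class_def)
  have homog': "hc_c n i \<in> homog P 1" if "i \<in> {1..n}" for i
    using class_gen_homog[of "HC i"] that by (simp add: hc_c_def hc_class_def)
  have "\<forall>r\<in>hc_rels n. free_eval P (hc_letter_value (hc_c n) (hc_T n)) r = \<zero>\<^bsub>P\<^esub>"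
  proof
    fix r assume r: "r \<in> hc_rels n"
    have "r \<in> carrier F" using r rels_carrier by blast
    then show "free_eval P (hc_letter_value (hc_c n) (hc_T n)) r = \<zero>\<^bsub>P\<^esub>"
      unfolding letters by (simp only: free_eval_presented relation_vanishes[OF r])
  qed
  with hecke_clifford_family_iff[OF superalgebra_presented homog homog'] show ?thesis
    by (simp add: hecke_clifford_def)
qed

lemma clifford_c_rules:
  fixes n i j :: nat
  defines "C \<equiv> clifford n"
  assumes i: "i \<in> {1..n}"
  shows "clifford_c n i \<in> homog C 1" "clifford_c n i \<otimes>\<^bsub>C\<^esub> clifford_c n i = \<one>\<^bsub>C\<^esub>"
    and "\<lbrakk>j \<in> {1..n}; i \<noteq> j\<rbrakk> \<Longrightarrow> clifford_c n i \<otimes>\<^bsub>C\<^esub> clifford_c n j = \<ominus>\<^bsub>C\<^esub> (clifford_c n j \<otimes>\<^bsub>C\<^esub> clifford_c n i)"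
proof -
  interpret presentation "clifford_gens n" "\<lambda>_. 1" "clifford_rels n" by (rule clifford_presentation)
  have C: "C = P" by (simp add: C_def clifford_def)
  have gen: "gen k \<in> carrier F" "cl (gen k) = clifford_c n k" "cl (gen k) \<in> homog P 1" if "k \<in> {1..n}" for k
    using that class_gen_homog[of k] by (simp_all add: clifford_gens_def clifford_c_def)
  have ccl: "clifford_c n k \<in> carrier P" if "k \<in> {1..n}" for k
    using P.homog_in_carrier[OF gen(3)[OF that]] gen(2)[OF that] by simp
  show "clifford_c n i \<in> homog C 1" unfolding C using gen[OF i] by simp
  have "cl (gen i * gen i - 1) = \<zero>\<^bsub>P\<^esub>"
    by (rule relation_vanishes) (use i in \<open>auto simp: clifford_rels_def\<close>)
  moreover have "cl (gen i * gen i - 1) = clifford_c n i \<otimes>\<^bsub>P\<^esub> clifford_c n i \<ominus>\<^bsub>P\<^esub> \<one>\<^bsub>P\<^esub>"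
    by (simp only: class_rules free_carrier_closed free_one_carrier gen[OF i])
  ultimately show "clifford_c n i \<otimes>\<^bsub>C\<^esub> clifford_c n i = \<one>\<^bsub>C\<^esub>"
    unfolding C using ccl[OF i] by (simp add: P.minus_eq_zero_iff)
  show "clifford_c n i \<otimes>\<^bsub>C\<^esub> clifford_c n j = \<ominus>\<^bsub>C\<^esub> (clifford_c n j \<otimes>\<^bsub>C\<^esub> clifford_c n i)"
    if j: "j \<in> {1..n}" "i \<noteq> j"
  proof -
    have "cl (gen i * gen j + gen j * gen i) = \<zero>\<^bsub>P\<^esub>"
      by (rule relation_vanishes) (use i j in \<open>auto simp: clifford_rels_def\<close>)
    moreover have "cl (gen i * gen j + gen j * gen i) =
        clifford_c n i \<otimes>\<^bsub>P\<^esub> clifford_c n j \<oplus>\<^bsub>P\<^esub> clifford_c n j \<otimes>\<^bsub>P\<^esub> clifford_c n i"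
      by (simp only: class_rules free_carrier_closed gen[OF i] gen[OF j(1)])
    ultimately show ?thesis
      unfolding C using ccl[OF i] ccl[OF j(1)] by (simp add: P.add_eq_zero_iff)
  qed
qed

lemma spin_hecke_R_rules:
  fixes n i j :: nat
  defines "H \<equiv> spin_hecke n"
  assumes i: "i \<in> {1..<n}"
  shows "spin_hecke_R n i \<in> homog H 1"
    and "spin_hecke_R n i \<otimes>\<^bsub>H\<^esub> spin_hecke_R n i = (- \<epsilon>\<^sup>2 - 2) \<odot>\<^bsub>H\<^esub> \<one>\<^bsub>H\<^esub>"
    and "\<lbrakk>j \<in> {1..<n}; \<bar>int i - int j\<bar> > 1\<rbrakk> \<Longrightarrow>
      spin_hecke_R n i \<otimes>\<^bsub>H\<^esub> spin_hecke_R n j = \<ominus>\<^bsub>H\<^esub> (spin_hecke_R n j \<otimes>\<^bsub>H\<^esub> spin_hecke_R n i)"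
    and "i + 1 \<in> {1..<n} \<Longrightarrow>
      spin_hecke_R n i \<otimes>\<^bsub>H\<^esub> spin_hecke_R n (i + 1) \<otimes>\<^bsub>H\<^esub> spin_hecke_R n i
      \<ominus>\<^bsub>H\<^esub> spin_hecke_R n (i + 1) \<otimes>\<^bsub>H\<^esub> spin_hecke_R n i \<otimes>\<^bsub>H\<^esub> spin_hecke_R n (i + 1)
      \<ominus>\<^bsub>H\<^esub> (\<epsilon>\<^sup>2 \<odot>\<^bsub>H\<^esub> \<one>\<^bsub>H\<^esub>) \<otimes>\<^bsub>H\<^esub> (spin_hecke_R n (i + 1) \<ominus>\<^bsub>H\<^esub> spin_hecke_R n i) = \<zero>\<^bsub>H\<^esub>"
proof -
  interpret presentation "spin_hecke_gens n" "\<lambda>_. 1" "spin_hecke_rels n" by (rule spin_hecke_presentation)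
  have H: "H = P" by (simp add: H_def spin_hecke_def)
  have gen: "gen k \<in> carrier F" "cl (gen k) = spin_hecke_R n k" "cl (gen k) \<in> homog P 1" if "k \<in> {1..<n}" for k
    using that class_gen_homog[of k] by (simp_all add: spin_hecke_gens_def spin_hecke_R_def)
  have Rcl: "spin_hecke_R n k \<in> carrier P" if "k \<in> {1..<n}" for k
    using P.homog_in_carrier[OF gen(3)[OF that]] gen(2)[OF that] by simp
  show "spin_hecke_R n i \<in> homog H 1" unfolding H using gen[OF i] by simp
  have "cl (gen i * gen i - const (- \<epsilon>\<^sup>2 - 2)) = \<zero>\<^bsub>P\<^esub>"
    by (rule relation_vanishes) (use i in \<open>auto simp: spin_hecke_rels_def\<close>)
  moreover have "cl (gen i * gen i - const (- \<epsilon>\<^sup>2 - 2)) =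
      spin_hecke_R n i \<otimes>\<^bsub>P\<^esub> spin_hecke_R n i \<ominus>\<^bsub>P\<^esub> (- \<epsilon>\<^sup>2 - 2) \<odot>\<^bsub>P\<^esub> \<one>\<^bsub>P\<^esub>"
    by (simp only: class_rules free_carrier_closed const_carrier gen[OF i])
  ultimately show "spin_hecke_R n i \<otimes>\<^bsub>H\<^esub> spin_hecke_R n i = (- \<epsilon>\<^sup>2 - 2) \<odot>\<^bsub>H\<^esub> \<one>\<^bsub>H\<^esub>"
    unfolding H using Rcl[OF i] P.minus_eq_zero_iff P.m_closed P.one_closed P.vsp.scale_closed by metis
  show "spin_hecke_R n i \<otimes>\<^bsub>H\<^esub> spin_hecke_R n j = \<ominus>\<^bsub>H\<^esub> (spin_hecke_R n j \<otimes>\<^bsub>H\<^esub> spin_hecke_R n i)"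
    if j: "j \<in> {1..<n}" "\<bar>int i - int j\<bar> > 1"
  proof -
    have "cl (gen i * gen j + gen j * gen i) = \<zero>\<^bsub>P\<^esub>"
      by (rule relation_vanishes) (use i j in \<open>auto simp: spin_hecke_rels_def\<close>)
    moreover have "cl (gen i * gen j + gen j * gen i) =
        spin_hecke_R n i \<otimes>\<^bsub>P\<^esub> spin_hecke_R n j \<oplus>\<^bsub>P\<^esub> spin_hecke_R n j \<otimes>\<^bsub>P\<^esub> spin_hecke_R n i"
      by (simp only: class_rules free_carrier_closed gen[OF i] gen[OF j(1)])
    ultimately show ?thesis
      unfolding H using Rcl[OF i] Rcl[OF j(1)] by (simp add: P.add_eq_zero_iff)
  qed
  assume i': "i + 1 \<in> {1..<n}"
  let ?r = "gen i * gen (i + 1) * gen i - gen (i + 1) * gen i * gen (i + 1) - const (\<epsilon>\<^sup>2) * (gen (i + 1) - gen i)"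
  have "cl ?r = \<zero>\<^bsub>P\<^esub>"
    by (rule relation_vanishes, unfold spin_hecke_rels_def Let_def) (use i i' in blast)
  moreover have "cl ?r = spin_hecke_R n i \<otimes>\<^bsub>P\<^esub> spin_hecke_R n (i + 1) \<otimes>\<^bsub>P\<^esub> spin_hecke_R n i
      \<ominus>\<^bsub>P\<^esub> spin_hecke_R n (i + 1) \<otimes>\<^bsub>P\<^esub> spin_hecke_R n i \<otimes>\<^bsub>P\<^esub> spin_hecke_R n (i + 1)
      \<ominus>\<^bsub>P\<^esub> (\<epsilon>\<^sup>2 \<odot>\<^bsub>P\<^esub> \<one>\<^bsub>P\<^esub>) \<otimes>\<^bsub>P\<^esub> (spin_hecke_R n (i + 1) \<ominus>\<^bsub>P\<^esub> spin_hecke_R n i)"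
    by (simp only: class_rules free_carrier_closed const_carrier gen[OF i] gen[OF i'])
  ultimately show "spin_hecke_R n i \<otimes>\<^bsub>H\<^esub> spin_hecke_R n (i + 1) \<otimes>\<^bsub>H\<^esub> spin_hecke_R n i
      \<ominus>\<^bsub>H\<^esub> spin_hecke_R n (i + 1) \<otimes>\<^bsub>H\<^esub> spin_hecke_R n i \<otimes>\<^bsub>H\<^esub> spin_hecke_R n (i + 1)
      \<ominus>\<^bsub>H\<^esub> (\<epsilon>\<^sup>2 \<odot>\<^bsub>H\<^esub> \<one>\<^bsub>H\<^esub>) \<otimes>\<^bsub>H\<^esub> (spin_hecke_R n (i + 1) \<ominus>\<^bsub>H\<^esub> spin_hecke_R n i) = \<zero>\<^bsub>H\<^esub>"
    unfolding H by simp
qed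

lemma cliff_spin_product: "super_tensor_product (clifford n) (spin_hecke n) cq_of_complex"
  by (simp add: super_tensor_product_def super_tensor_product_axioms_def superalgebra_clifford
      superalgebra_spin_hecke cq_of_complex_embedding)

lemma in_left_hom: "superalgebra_hom (clifford n) (restrict_scalars cq_of_complex (cliff_spin n)) (in_left n)"
  and in_right_hom: "superalgebra_hom (spin_hecke n) (cliff_spin n) (in_right n)"
  using super_tensor_product.superalgebra_hom_left[OF cliff_spin_product, of n]
    super_tensor_product.superalgebra_hom_right[OF cliff_spin_product, of n]
  by (simp_all add: cliff_spin_def in_left_def[abs_def] in_right_def[abs_def])

lemma superalgebra_cliff_spin: "superalgebra (cliff_spin n)"
  using in_right_hom by (simp add: superalgebra_hom_def)

text \<open>The relations among the \<open>c\<^sub>i\<close> and among the \<open>R\<^sub>i\<close> come from the two factors; the \<open>R\<^sub>i\<close>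
anticommute with the \<open>c\<^sub>j\<close> by the sign rule of the tensor product.\<close>

lemma cliff_spin_generators:
  "clifford_spin_family (cliff_spin n) n (cs_c n) (cs_R n)"
proof -
  let ?B = "cliff_spin n"
  interpret super_tensor_product "clifford n" "spin_hecke n" cq_of_complex by (rule cliff_spin_product)
  interpret l: superalgebra_homomorphism "clifford n" "restrict_scalars cq_of_complex (cliff_spin n)" "in_left n"
    using in_left_hom by auto
  interpret r: superalgebra_homomorphism "spin_hecke n" "cliff_spin n" "in_right n"
    using in_right_hom by auto
  interpret D: cq_superalgebra "cliff_spin n"
    using superalgebra_cliff_spin by (simp add: cq_superalgebra_def)
  note crules = clifford_c_rules[of _ n] and Rrules = spin_hecke_R_rules[of _ n]
  have ccl: "clifford_c n i \<in> carrier (clifford n)" if "i \<in> {1..n}" for i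
    using A.homog_in_carrier[OF crules(1)[OF that]] .
  have Rcl: "spin_hecke_R n i \<in> carrier (spin_hecke n)" if "i \<in> {1..<n}" for i
    using B.homog_in_carrier[OF Rrules(1)[OF that]] .
  have cs_ccl: "cs_c n i \<in> carrier ?B" if "i \<in> {1..n}" for i
    using l.closed[OF ccl[OF that]] by (simp add: cs_c_def)
  have cs_Rcl: "cs_R n i \<in> carrier ?B" if "i \<in> {1..<n}" for i
    using r.closed[OF Rcl[OF that]] by (simp add: cs_R_def)
  have neg: "in_left n (\<ominus>\<^bsub>clifford n\<^esub> x) = \<ominus>\<^bsub>?B\<^esub> in_left n x" if "x \<in> carrier (clifford n)" for x
  proof -
    have "in_left n (\<ominus>\<^bsub>clifford n\<^esub> x) \<oplus>\<^bsub>?B\<^esub> in_left n x = \<zero>\<^bsub>?B\<^esub>"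
      using l.add[of "\<ominus>\<^bsub>clifford n\<^esub> x" x] l.zero that by (simp add: A.l_neg)
    then show ?thesis using r.B.minus_equality[of "in_left n (\<ominus>\<^bsub>clifford n\<^esub> x)" "in_left n x"] l.closed that by simp
  qed
  show ?thesis
  proof unfold_locales
    show "cs_c n i \<in> homog ?B 1" "cs_c n i \<otimes>\<^bsub>?B\<^esub> cs_c n i = \<one>\<^bsub>?B\<^esub>"
      if i: "i \<in> {1..n}" for i
      using l.homog[OF crules(1)[OF i]] l.mult[OF ccl[OF i] ccl[OF i]] crules(2)[OF i] l.one
      by (simp_all add: cs_c_def)
    show "cs_c n i \<otimes>\<^bsub>?B\<^esub> cs_c n j = \<ominus>\<^bsub>?B\<^esub> (cs_c n j \<otimes>\<^bsub>?B\<^esub> cs_c n i)"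
      if ij: "i \<in> {1..n}" "j \<in> {1..n}" "i \<noteq> j" for i j
    proof -
      have "in_left n (clifford_c n i \<otimes>\<^bsub>clifford n\<^esub> clifford_c n j) =
          \<ominus>\<^bsub>?B\<^esub> in_left n (clifford_c n j \<otimes>\<^bsub>clifford n\<^esub> clifford_c n i)"
        using crules(3)[OF ij] neg ccl[OF ij(1)] ccl[OF ij(2)] by simp
      then show ?thesis
        using l.mult[OF ccl[OF ij(1)] ccl[OF ij(2)]] l.mult[OF ccl[OF ij(2)] ccl[OF ij(1)]]
        by (simp add: cs_c_def)
    qed
    show "cs_R n i \<in> homog ?B 1" if i: "i \<in> {1..<n}" for i
      using r.homog[OF Rrules(1)[OF i]] by (simp add: cs_R_def)
    show "cs_R n i \<otimes>\<^bsub>?B\<^esub> cs_R n i =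
        \<ominus>\<^bsub>?B\<^esub> (D.eps \<otimes>\<^bsub>?B\<^esub> D.eps) \<ominus>\<^bsub>?B\<^esub> (\<one>\<^bsub>?B\<^esub> \<oplus>\<^bsub>?B\<^esub> \<one>\<^bsub>?B\<^esub>)"
      if i: "i \<in> {1..<n}" for i
    proof -
      have "cs_R n i \<otimes>\<^bsub>?B\<^esub> cs_R n i = (- \<epsilon>\<^sup>2 - 2) \<odot>\<^bsub>?B\<^esub> \<one>\<^bsub>?B\<^esub>"
        unfolding cs_R_def r.mult[OF Rcl[OF i] Rcl[OF i], symmetric] Rrules(2)[OF i]
        by (simp only: r.scale[OF B.one_closed] r.one)
      then show ?thesis by (simp only: D.spin_scalars)
    qed
    show "cs_R n i \<otimes>\<^bsub>?B\<^esub> cs_R n (i + 1) \<otimes>\<^bsub>?B\<^esub> cs_R n i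
        \<ominus>\<^bsub>?B\<^esub> cs_R n (i + 1) \<otimes>\<^bsub>?B\<^esub> cs_R n i \<otimes>\<^bsub>?B\<^esub> cs_R n (i + 1)
        \<ominus>\<^bsub>?B\<^esub> (D.eps \<otimes>\<^bsub>?B\<^esub> D.eps) \<otimes>\<^bsub>?B\<^esub> (cs_R n (i + 1) \<ominus>\<^bsub>?B\<^esub> cs_R n i)
        = \<zero>\<^bsub>?B\<^esub>"
      if i: "i \<in> {1..<n}" "i + 1 \<in> {1..<n}" for i
      unfolding D.spin_scalars(2)[symmetric]
      using arg_cong[OF Rrules(4)[OF i], of "in_right n"] Rcl[OF i(1)] Rcl[OF i(2)]
      by (simp add: r.mult r.minus r.zero r.scale r.one cs_R_def)
    show "cs_R n i \<otimes>\<^bsub>?B\<^esub> cs_R n j = \<ominus>\<^bsub>?B\<^esub> (cs_R n j \<otimes>\<^bsub>?B\<^esub> cs_R n i)"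
      if ij: "i \<in> {1..<n}" "j \<in> {1..<n}" "\<bar>int i - int j\<bar> > 1" for i j
      using arg_cong[OF Rrules(3)[OF ij], of "in_right n"] Rcl[OF ij(1)] Rcl[OF ij(2)]
      by (simp add: r.mult r.uminus cs_R_def)
    show "cs_R n i \<otimes>\<^bsub>?B\<^esub> cs_c n j = \<ominus>\<^bsub>?B\<^esub> (cs_c n j \<otimes>\<^bsub>?B\<^esub> cs_R n i)"
      if i: "i \<in> {1..<n}" and j: "j \<in> {1..n}" for i j
      using pure_supercommute[OF crules(1)[OF j] Rrules(1)[OF i]] cs_ccl[OF j] cs_Rcl[OF i]
      by (simp add: cs_R_def cs_c_def in_left_def in_right_def cliff_spin_def)
  qed
qed

section \<open>The isomorphism\<close>

text \<open>Substituting letters and projecting is the same as evaluating at the \<open>c\<^sub>i\<close> of the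
  Hecke-Clifford algebra.\<close>

lemma hc_class_sum:
  assumes "finite K" "\<And>w. w \<in> K \<Longrightarrow> set w \<subseteq> {1..n}"
  shows "hc_class n (\<Sum>w\<in>K. Poly_Mapping.single (map HC w) (cq_of_complex (l w))) =
    finsum (hecke_clifford n) (\<lambda>w. cq_of_complex (l w) \<odot>\<^bsub>hecke_clifford n\<^esub> word_eval (hecke_clifford n) (hc_c n) w) K"
proof -
  interpret presentation "hc_gens n" hc_parity "hc_rels n" by (rule hc_presentation)
  have H: "hecke_clifford n = P" and c: "hc_class n = cl"
    by (simp_all add: hecke_clifford_def hc_class_def fun_eq_iff)
  have hc_c: "hc_c n i = cl (gen (HC i))" for i by (simp add: hc_c_def c)
  have g: "hc_c n \<in> {1..n} \<rightarrow> carrier P"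
    using class_gen_homog[of "HC _"] P.homog_in_carrier unfolding hc_c by auto
  have word: "cl (Poly_Mapping.single (map HC w) 1) = word_eval P (hc_c n) w \<and>
      Poly_Mapping.single (map HC w) 1 \<in> carrier F" if "set w \<subseteq> {1..n}" for w
    using that
  proof (induction w)
    case Nil
    then show ?case using class_rules(5) by (simp add: one_eq_single_Nil carrier_free)
  next
    case (Cons i w)
    have mem: "gen (HC i) \<in> carrier F" using Cons.prems by simp
    have eq: "Poly_Mapping.single (map HC (i # w)) 1 = gen (HC i) * Poly_Mapping.single (map HC w) 1"
      by (simp add: gen_def mult_single plus_list_def)
    have IH: "cl (Poly_Mapping.single (map HC w) 1) = word_eval P (hc_c n) w"
      "Poly_Mapping.single (map HC w) 1 \<in> carrier F" using Cons by simp_all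
    show ?case
      unfolding eq P.word_eval_simps class_rules(1)[OF mem IH(2)] IH(1) hc_c[of i]
      using free_carrier_closed(2)[OF mem IH(2)] by simp
  qed
  have single: "cl (Poly_Mapping.single (map HC w) k) = k \<odot>\<^bsub>P\<^esub> word_eval P (hc_c n) w"
    "Poly_Mapping.single (map HC w) k \<in> carrier F" if "set w \<subseteq> {1..n}" for w k
    using word[OF that] cl.scale[of "Poly_Mapping.single (map HC w) 1" k] by (simp_all add: carrier_free)
  have we: "word_eval P (hc_c n) w \<in> carrier P" if "set w \<subseteq> {1..n}" for w
    by (rule P.word_eval_closed[OF g that])
  have "(\<Sum>w\<in>K. Poly_Mapping.single (map HC w) (cq_of_complex (l w))) \<in> carrier F \<and>
      cl (\<Sum>w\<in>K. Poly_Mapping.single (map HC w) (cq_of_complex (l w))) =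
      finsum P (\<lambda>w. cq_of_complex (l w) \<odot>\<^bsub>P\<^esub> word_eval P (hc_c n) w) K"
    using assms
  proof (induction K rule: finite_induct)
    case empty
    then show ?case using cl.zero by (simp add: carrier_free)
  next
    case (insert w K)
    then show ?case
      using we by (subst P.finsum_insert) (auto simp: single class_rules(2))
  qed
  then show ?thesis unfolding H c by simp
qed

lemma finsum_restrict_scalars: "finsum (restrict_scalars j A) = finsum A"
  by (intro ext) (simp add: finsum_def finprod_def restrict_scalars_def)

text \<open>The canonical map from the Clifford algebra to the Hecke-Clifford algebra is the homomorphism
given by the universal property of the Clifford algebra: on a representative \<open>f\<close> both are the
evaluation of \<open>f\<close>. In particular the set in the definition of \<^const>\<open>clifford_to_hc\<close> is a
singleton.\<close>

lemma clifford_to_hc_hom: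
  obtains \<iota> where
    "superalgebra_hom (clifford n) (restrict_scalars cq_of_complex (hecke_clifford n)) \<iota>"
    "\<And>x. x \<in> carrier (clifford n) \<Longrightarrow> \<iota> x = clifford_to_hc n x"
    "\<And>i. i \<in> {1..n} \<Longrightarrow> \<iota> (clifford_c n i) = hc_c n i"
proof -
  interpret C: presentation "clifford_gens n" "\<lambda>_. 1" "clifford_rels n" by (rule clifford_presentation)
  interpret H: hecke_clifford_family "hecke_clifford n" n "hc_c n" "hc_T n"
    by (rule hecke_clifford_generators)
  let ?E = "restrict_scalars cq_of_complex (hecke_clifford n)"
  interpret E: superalgebra ?E
    by (rule superalgebra_restrict_scalars[OF H.superalgebra_axioms cq_of_complex_embedding])
  have C: "clifford n = C.P" by (simp add: clifford_def)
  obtain \<iota> where \<iota>: "superalgebra_hom C.P ?E \<iota>"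
    "\<And>f. f \<in> carrier C.F \<Longrightarrow> \<iota> (C.cl f) = free_eval ?E (hc_c n) f"
  proof (rule C.presented_hom_exists[of ?E "hc_c n"])
    show "hc_c n i \<in> homog ?E 1" if "i \<in> clifford_gens n" for i
      using H.c_homog that by (simp add: clifford_gens_def)
    show "free_eval ?E (hc_c n) r = \<zero>\<^bsub>?E\<^esub>" if "r \<in> clifford_rels n" for r
      using clifford_rels_vanish[OF H.clifford_family_axioms that] by simp
  qed (use E.superalgebra_axioms in auto)
  have eval: "hc_class n (clifford_poly_to_hc f) = \<iota> (C.cl f)" if f: "f \<in> carrier C.F" for f
  proof -
    have "hc_class n (clifford_poly_to_hc f) = finsum (hecke_clifford n) (\<lambda>w. cq_of_complex (Poly_Mapping.lookup f w)
        \<odot>\<^bsub>hecke_clifford n\<^esub> word_eval (hecke_clifford n) (hc_c n) w) (Poly_Mapping.keys f)"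
      unfolding clifford_poly_to_hc_def
      by (rule hc_class_sum) (use f in \<open>auto simp: carrier_free clifford_gens_def\<close>)
    also have "\<dots> = free_eval ?E (hc_c n) f"
      by (simp add: free_eval_def lin_ext_def finsum_restrict_scalars word_eval_def)
    finally show ?thesis using \<iota>(2)[OF f] by simp
  qed
  show ?thesis
  proof (rule that[of \<iota>])
    show "superalgebra_hom (clifford n) ?E \<iota>" using \<iota>(1) by (simp add: C)
    show "\<iota> x = clifford_to_hc n x" if "x \<in> carrier (clifford n)" for x
    proof -
      from that obtain f where f: "f \<in> carrier C.F" "x = C.cl f"
        by (auto simp: C C.carrier_presented)
      have "hc_class n (clifford_poly_to_hc g) = \<iota> x" if g: "g \<in> x" for g
      proof -
        have gf: "g - f \<in> C.I" using g f C.class_mem by simp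
        then have "g - f \<in> carrier C.F" by (rule C.Q.N_carrier)
        then have "g \<in> carrier C.F" using free_carrier_closed(1)[OF _ f(1), of "g - f"] by simp
        moreover have "C.cl g = x" using gf f C.class_eq_iff by simp
        ultimately show ?thesis using eval by simp
      qed
      moreover have "f \<in> x" using f C.class_mem[of f f] C.Q.N_zero by simp
      ultimately have "(\<lambda>g. hc_class n (clifford_poly_to_hc g)) ` x = {\<iota> x}" by (auto intro!: image_eqI)
      then show ?thesis by (simp add: clifford_to_hc_def)
    qed
    show "\<iota> (clifford_c n i) = hc_c n i" if "i \<in> {1..n}" for i
      using \<iota>(2)[of "gen i"] that E.free_eval_gen[of "hc_c n" i] H.c_closed[OF that]
      by (simp add: clifford_c_def clifford_gens_def)
  qed
qed

lemma cq_of_complex_bit_sign: "cq_of_complex (bit_sign s) = bit_sign s"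
proof -
  have "cq_of_complex (- 1) = - 1" by (simp add: cq_of_complex_def One_fract_def one_pCons)
  moreover have "cq_of_complex 1 = 1"
    using cq_of_complex_embedding by (simp add: field_embedding_def)
  ultimately show ?thesis by (simp add: bit_sign_def)
qed

lemma superalgebra_hom_restrict_scalars:
  assumes "superalgebra_hom A B h" "field_embedding j"
  shows "superalgebra_hom (restrict_scalars j A) (restrict_scalars j B) h"
proof -
  interpret h: superalgebra_homomorphism A B h using assms(1) by auto
  show ?thesis
    by (rule superalgebra_homI)
      (simp_all add: superalgebra_restrict_scalars h.A.superalgebra_axioms h.B.superalgebra_axioms assms(2)
        h.mult h.add h.one h.scale h.homog)
qed

lemma hecke_generator_hom:
  assumes "superalgebra_hom D D' h" "S i \<in> carrier D" "c i \<in> carrier D" "c (i + 1) \<in> carrier D"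
  shows "h (hecke_generator D c S i) = hecke_generator D' (\<lambda>i. h (c i)) (\<lambda>i. h (S i)) i"
proof -
  interpret h: superalgebra_homomorphism D D' h using assms(1) by auto
  show ?thesis
    using assms(2-4) unfolding hecke_generator_def
    by (simp add: h.mult h.add h.minus h.one h.scale del: h.A.vsp.scale_minus_left h.B.vsp.scale_minus_left)
qed

lemma spin_generator_hom:
  assumes "superalgebra_hom D D' h" "T i \<in> carrier D" "c i \<in> carrier D" "c (i + 1) \<in> carrier D"
  shows "h (spin_generator D c T i) = spin_generator D' (\<lambda>i. h (c i)) (\<lambda>i. h (T i)) i"
proof -
  interpret h: superalgebra_homomorphism D D' h using assms(1) by auto
  show ?thesis
    using assms(2-4) unfolding spin_generator_def by (simp add: h.mult h.add h.minus h.scale)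
qed

theorem theorem3p1:
  fixes n :: nat
  assumes "n \<ge> 1"
  shows "\<exists>\<Phi> \<Psi>.
    superalgebra_iso (hecke_clifford n) (cliff_spin n) \<Phi> \<and>
    (\<forall>x\<in>carrier (clifford n). \<Phi> (clifford_to_hc n x) = in_left n x) \<and>
    (\<forall>i\<in>{1..n-1}. \<Phi> (hc_T n i) =
       (- (1/2)) \<odot>\<^bsub>cliff_spin n\<^esub>
           (cs_R n i \<otimes>\<^bsub>cliff_spin n\<^esub> (cs_c n i \<ominus>\<^bsub>cliff_spin n\<^esub> cs_c n (i+1)))
       \<oplus>\<^bsub>cliff_spin n\<^esub>
       (\<epsilon>/2) \<odot>\<^bsub>cliff_spin n\<^esub>
           (\<one>\<^bsub>cliff_spin n\<^esub> \<ominus>\<^bsub>cliff_spin n\<^esub> cs_c n i \<otimes>\<^bsub>cliff_spin n\<^esub> cs_c n (i+1))) \<and>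
    superalgebra_iso (cliff_spin n) (hecke_clifford n) \<Psi> \<and>
    (\<forall>x\<in>carrier (hecke_clifford n). \<Psi> (\<Phi> x) = x) \<and>
    (\<forall>y\<in>carrier (cliff_spin n). \<Phi> (\<Psi> y) = y) \<and>
    (\<forall>x\<in>carrier (clifford n). \<Psi> (in_left n x) = clifford_to_hc n x) \<and>
    (\<forall>i\<in>{1..n-1}. \<Psi> (cs_R n i) =
       (hc_c n i \<ominus>\<^bsub>hecke_clifford n\<^esub> hc_c n (i+1)) \<otimes>\<^bsub>hecke_clifford n\<^esub> hc_T n i
       \<oplus>\<^bsub>hecke_clifford n\<^esub> \<epsilon> \<odot>\<^bsub>hecke_clifford n\<^esub> hc_c n (i+1))"
proof -
  let ?H = "hecke_clifford n" and ?B = "cliff_spin n"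
  interpret H: hecke_clifford_family ?H n "hc_c n" "hc_T n" by (rule hecke_clifford_generators)
  interpret B: clifford_spin_family ?B n "cs_c n" "cs_R n" by (rule cliff_spin_generators)
  interpret Hp: presentation "hc_gens n" hc_parity "hc_rels n" by (rule hc_presentation)
  interpret Cp: presentation "clifford_gens n" "\<lambda>_. 1" "clifford_rels n" by (rule clifford_presentation)
  interpret Sp: presentation "spin_hecke_gens n" "\<lambda>_. 1" "spin_hecke_rels n" by (rule spin_hecke_presentation)
  interpret t: super_tensor_product "clifford n" "spin_hecke n" cq_of_complex by (rule cliff_spin_product)
  note P = hecke_clifford_def[of n] clifford_def[of n] spin_hecke_def[of n]
  let ?S = "spin_generator ?H (hc_c n) (hc_T n)" and ?T = "hecke_generator ?B (cs_c n) (cs_R n)"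
  interpret HS: clifford_spin_family ?H n "hc_c n" ?S by (rule H.clifford_spin_family_spin_generator)
  interpret BT: hecke_clifford_family ?B n "cs_c n" ?T by (rule B.hecke_clifford_family_hecke_generator)
  have Tcl: "hc_T n i \<in> carrier ?H" if "i \<in> {1..<n}" for i using H.T_homog[OF that] by simp

  \<comment> \<open>The prescribed images form a Hecke-Clifford family in the tensor product, so they define
    \<open>\<Phi>\<close> by the universal property of the presentation.\<close>
  obtain \<Phi> where \<Phi>: "superalgebra_hom Hp.P ?B \<Phi>"
    "\<And>f. f \<in> carrier Hp.F \<Longrightarrow> \<Phi> (Hp.cl f) = free_eval ?B (hc_letter_value (cs_c n) ?T) f"
  proof (rule Hp.presented_hom_exists[of ?B "hc_letter_value (cs_c n) ?T"])
    show "hc_letter_value (cs_c n) ?T x \<in> homog ?B (hc_parity x)" if "x \<in> hc_gens n" for x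
      using that BT.T_homog B.c_homog by (cases x) simp_all
    show "free_eval ?B (hc_letter_value (cs_c n) ?T) r = \<zero>\<^bsub>?B\<^esub>" if "r \<in> hc_rels n" for r
      using hecke_clifford_family_iff[of ?B n ?T "cs_c n", OF B.superalgebra_axioms BT.T_homog B.c_homog]
        BT.hecke_clifford_family_axioms that by blast
  qed (use B.superalgebra_axioms in auto)
  interpret \<Phi>: superalgebra_homomorphism ?H ?B \<Phi> using \<Phi>(1) by (auto simp: P)
  have \<Phi>_T: "\<Phi> (hc_T n i) = ?T i" if "i \<in> {1..<n}" for i
    using \<Phi>(2)[of "gen (HT i)"] that B.free_eval_gen[of "hc_letter_value (cs_c n) ?T" "HT i"] BT.T_homog[OF that]
    by (simp add: hc_T_def hc_class_def)
  have \<Phi>_c: "\<Phi> (hc_c n i) = cs_c n i" if "i \<in> {1..n}" for i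
    using \<Phi>(2)[of "gen (HC i)"] that B.free_eval_gen[of "hc_letter_value (cs_c n) ?T" "HC i"] B.c_closed[OF that]
    by (simp add: hc_c_def hc_class_def)

  \<comment> \<open>The map \<open>\<Psi>\<close> combines the canonical map \<open>\<iota>\<close> on the Clifford factor with a map
    \<open>\<psi>\<close> on the spin Hecke factor.\<close>
  obtain \<iota> where \<iota>: "superalgebra_hom (clifford n) (restrict_scalars cq_of_complex ?H) \<iota>"
    "\<And>x. x \<in> carrier (clifford n) \<Longrightarrow> \<iota> x = clifford_to_hc n x"
    "\<And>i. i \<in> {1..n} \<Longrightarrow> \<iota> (clifford_c n i) = hc_c n i"
    using clifford_to_hc_hom[of n] by metis
  obtain \<psi> where \<psi>: "superalgebra_hom Sp.P ?H \<psi>"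
    "\<And>f. f \<in> carrier Sp.F \<Longrightarrow> \<psi> (Sp.cl f) = free_eval ?H ?S f"
  proof (rule Sp.presented_hom_exists[of ?H ?S])
    show "?S i \<in> homog ?H 1" if "i \<in> spin_hecke_gens n" for i
      using that HS.S_homog by (simp add: spin_hecke_gens_def)
    show "free_eval ?H ?S r = \<zero>\<^bsub>?H\<^esub>" if "r \<in> spin_hecke_rels n" for r
      by (rule spin_hecke_rels_vanish[OF HS.clifford_spin_family_axioms that])
  qed (use H.superalgebra_axioms in auto)
  interpret \<iota>: superalgebra_homomorphism "clifford n" "restrict_scalars cq_of_complex ?H" \<iota> using \<iota>(1) by auto
  interpret \<psi>: superalgebra_homomorphism "spin_hecke n" ?H \<psi> using \<psi>(1) by (auto simp: P)
  have \<psi>_R: "\<psi> (spin_hecke_R n i) = ?S i" if "i \<in> {1..<n}" for i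
    using \<psi>(2)[of "gen i"] that H.free_eval_gen[of ?S i] HS.S_closed[OF that]
    by (simp add: spin_hecke_R_def spin_hecke_gens_def)
  \<comment> \<open>The images of the two factors supercommute: first each \<open>c\<^sub>i\<close> with all \<open>\<psi> b\<close>, because
    it anticommutes with the \<open>\<psi> R\<^sub>k\<close>, and then each \<open>\<psi> b\<close> with all \<open>\<iota> a\<close>.\<close>
  have comm: "\<psi> b \<otimes>\<^bsub>?H\<^esub> \<iota> a = bit_sign (t * s) \<odot>\<^bsub>?H\<^esub> (\<iota> a \<otimes>\<^bsub>?H\<^esub> \<psi> b)"
    if a: "a \<in> homog (clifford n) s" and b: "b \<in> homog (spin_hecke n) t" for a b s t
  proof -
    have \<psi>b: "\<psi> b \<in> carrier ?H" using \<psi>.homog[OF b] by simp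
    have gen: "\<psi> b \<otimes>\<^bsub>?H\<^esub> hc_c n i = bit_sign t \<odot>\<^bsub>?H\<^esub> (hc_c n i \<otimes>\<^bsub>?H\<^esub> \<psi> b)" if i: "i \<in> {1..n}" for i
    proof -
      have "hc_c n i \<otimes>\<^bsub>?H\<^esub> \<psi> b = bit_sign (1 * t) \<odot>\<^bsub>?H\<^esub> (\<psi> b \<otimes>\<^bsub>?H\<^esub> hc_c n i)"
      proof (rule Sp.presented_supercommute[OF \<psi>(1)])
        show "hc_c n i \<otimes>\<^bsub>?H\<^esub> \<psi> (Sp.cl (gen k)) = bit_sign (1 * 1) \<odot>\<^bsub>?H\<^esub> (\<psi> (Sp.cl (gen k)) \<otimes>\<^bsub>?H\<^esub> hc_c n i)"
          if k: "k \<in> spin_hecke_gens n" for k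
        proof -
          have k': "k \<in> {1..<n}" using k by (simp add: spin_hecke_gens_def)
          have "\<psi> (Sp.cl (gen k)) = ?S k" using \<psi>_R[OF k'] by (simp add: spin_hecke_R_def)
          then show ?thesis
            using HS.S_c[OF k' i] HS.S_closed[OF k'] H.c_closed[OF i] by simp
        qed
      qed (use H.c_closed[OF i] b in \<open>simp_all add: P(3)\<close>)
      then show ?thesis
        using \<psi>b H.c_closed[OF i] by (cases t) simp_all
    qed
    have "\<psi> b \<otimes>\<^bsub>restrict_scalars cq_of_complex ?H\<^esub> \<iota> a =
        bit_sign (t * s) \<odot>\<^bsub>restrict_scalars cq_of_complex ?H\<^esub> (\<iota> a \<otimes>\<^bsub>restrict_scalars cq_of_complex ?H\<^esub> \<psi> b)"
    proof (rule Cp.presented_supercommute)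
      show "superalgebra_hom Cp.P (restrict_scalars cq_of_complex ?H) \<iota>" using \<iota>(1) by (simp add: P)
      show "\<psi> b \<otimes>\<^bsub>restrict_scalars cq_of_complex ?H\<^esub> \<iota> (Cp.cl (gen k)) = bit_sign (t * 1)
          \<odot>\<^bsub>restrict_scalars cq_of_complex ?H\<^esub> (\<iota> (Cp.cl (gen k)) \<otimes>\<^bsub>restrict_scalars cq_of_complex ?H\<^esub> \<psi> b)"
        if "k \<in> clifford_gens n" for k
        using gen[of k] \<iota>(3)[of k] that
        by (simp add: clifford_gens_def clifford_c_def cq_of_complex_bit_sign)
    qed (use a \<psi>b in \<open>simp_all add: P(2)\<close>)
    then show ?thesis by (simp add: cq_of_complex_bit_sign)
  qed
  obtain \<Psi> where \<Psi>: "superalgebra_hom ?B ?H \<Psi>"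
    "\<And>a b. \<lbrakk>a \<in> carrier (clifford n); b \<in> carrier (spin_hecke n)\<rbrakk> \<Longrightarrow> \<Psi> (t.pure a b) = \<iota> a \<otimes>\<^bsub>?H\<^esub> \<psi> b"
  proof (rule t.super_tensor_hom_exists[of ?H \<iota> \<psi>])
    fix h assume "superalgebra_hom t.AB ?H h"
      "\<And>a b. \<lbrakk>a \<in> carrier (clifford n); b \<in> carrier (spin_hecke n)\<rbrakk> \<Longrightarrow> h (t.pure a b) = \<iota> a \<otimes>\<^bsub>?H\<^esub> \<psi> b"
    then show thesis by (intro that) (simp_all add: cliff_spin_def)
  qed (use H.superalgebra_axioms \<iota>.hom \<psi>.hom comm in blast)+
  interpret \<Psi>: superalgebra_homomorphism ?B ?H \<Psi> using \<Psi>(1) by auto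
  have \<Psi>_left: "\<Psi> (in_left n x) = \<iota> x" if "x \<in> carrier (clifford n)" for x
    using \<Psi>(2)[OF that t.B.one_closed] \<psi>.one \<iota>.closed[OF that] by (simp add: in_left_def)
  have \<Psi>_right: "\<Psi> (in_right n y) = \<psi> y" if "y \<in> carrier (spin_hecke n)" for y
    using \<Psi>(2)[OF t.A.one_closed that] \<iota>.one \<psi>.closed[OF that] by (simp add: in_right_def)
  have ccl: "clifford_c n i \<in> carrier (clifford n)" if "i \<in> {1..n}" for i
    using clifford_c_rules(1)[OF that] by simp
  have \<Psi>_c: "\<Psi> (cs_c n i) = hc_c n i" if "i \<in> {1..n}" for i
    using \<Psi>_left[OF ccl[OF that]] \<iota>(3)[OF that] by (simp add: cs_c_def)
  have \<Psi>_R: "\<Psi> (cs_R n i) = ?S i" if "i \<in> {1..<n}" for i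
    using \<Psi>_right[of "spin_hecke_R n i"] spin_hecke_R_rules(1)[OF that] \<psi>_R[OF that] by (simp add: cs_R_def)

  have \<Phi>_\<iota>: "\<Phi> (\<iota> x) = in_left n x" if "x \<in> carrier (clifford n)" for x
  proof (rule Cp.presented_hom_unique[of "restrict_scalars cq_of_complex ?B" "\<lambda>x. \<Phi> (\<iota> x)" "in_left n"])
    show "superalgebra_hom Cp.P (restrict_scalars cq_of_complex ?B) (\<lambda>x. \<Phi> (\<iota> x))"
      using superalgebra_hom_comp[OF \<iota>(1) superalgebra_hom_restrict_scalars[OF \<Phi>.hom cq_of_complex_embedding]]
      by (simp add: P)
    show "superalgebra_hom Cp.P (restrict_scalars cq_of_complex ?B) (in_left n)"
      using in_left_hom[of n] by (simp add: P)
    show "\<Phi> (\<iota> (Cp.cl (gen i))) = in_left n (Cp.cl (gen i))" if "i \<in> clifford_gens n" for i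
      using \<iota>(3)[of i] \<Phi>_c[of i] that by (simp add: clifford_gens_def clifford_c_def cs_c_def)
  qed (use that in \<open>simp add: P\<close>)

  \<comment> \<open>On \<open>T\<^sub>i\<close> the composite first substitutes the formula for \<open>T\<^sub>i\<close> and then that for
    \<open>R\<^sub>i\<close>; the two formulas are inverse to each other.\<close>
  have \<Psi>_\<Phi>: "\<Psi> (\<Phi> x) = x" if "x \<in> carrier ?H" for x
  proof (rule Hp.presented_hom_unique[of ?H "\<lambda>x. \<Psi> (\<Phi> x)" "\<lambda>x. x"])
    show "superalgebra_hom Hp.P ?H (\<lambda>x. \<Psi> (\<Phi> x))"
      using superalgebra_hom_comp[OF \<Phi>(1) \<Psi>.hom] .
    show "superalgebra_hom Hp.P ?H (\<lambda>x. x)"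
      using superalgebra_hom_id[OF H.superalgebra_axioms] by (simp add: P)
    show "\<Psi> (\<Phi> (Hp.cl (gen x))) = Hp.cl (gen x)" if "x \<in> hc_gens n" for x
    proof (cases x)
      case (HT i)
      then have i: "i \<in> {1..<n}" "i \<in> {1..n}" "i + 1 \<in> {1..n}" using that by auto
      have "\<Psi> (\<Phi> (hc_T n i)) = hecke_generator ?H (\<lambda>k. \<Psi> (cs_c n k)) (\<lambda>k. \<Psi> (cs_R n k)) i"
        unfolding \<Phi>_T[OF i(1)]
        by (rule hecke_generator_hom[OF \<Psi>.hom]) (use i B.S_closed B.c_closed in blast)+
      also have "\<dots> = hecke_generator ?H (hc_c n) ?S i"
        unfolding hecke_generator_def \<Psi>_c[OF i(2)] \<Psi>_c[OF i(3)] \<Psi>_R[OF i(1)] ..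
      also have "\<dots> = hc_T n i" by (rule H.hecke_generator_spin_generator[OF i(1)])
      finally show ?thesis using HT by (simp add: hc_T_def hc_class_def)
    next
      case (HC i)
      then have "\<Psi> (\<Phi> (hc_c n i)) = hc_c n i" using that \<Phi>_c[of i] \<Psi>_c[of i] by simp
      then show ?thesis using HC by (simp add: hc_c_def hc_class_def)
    qed
  qed (use that in \<open>simp add: P\<close>)
  have \<Phi>_\<psi>: "\<Phi> (\<psi> y) = in_right n y" if "y \<in> carrier (spin_hecke n)" for y
  proof (rule Sp.presented_hom_unique[of ?B "\<lambda>y. \<Phi> (\<psi> y)" "in_right n"])
    show "superalgebra_hom Sp.P ?B (\<lambda>y. \<Phi> (\<psi> y))"
      using superalgebra_hom_comp[OF \<psi>(1) \<Phi>.hom] .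
    show "superalgebra_hom Sp.P ?B (in_right n)" using in_right_hom[of n] by (simp add: P)
    show "\<Phi> (\<psi> (Sp.cl (gen i))) = in_right n (Sp.cl (gen i))" if "i \<in> spin_hecke_gens n" for i
    proof -
      have i: "i \<in> {1..<n}" "i \<in> {1..n}" "i + 1 \<in> {1..n}" using that by (auto simp: spin_hecke_gens_def)
      have "\<Phi> (\<psi> (spin_hecke_R n i)) = spin_generator ?B (\<lambda>k. \<Phi> (hc_c n k)) (\<lambda>k. \<Phi> (hc_T n k)) i"
        unfolding \<psi>_R[OF i(1)]
        by (rule spin_generator_hom[OF \<Phi>.hom]) (use i Tcl H.c_closed in blast)+
      also have "\<dots> = spin_generator ?B (cs_c n) ?T i"
        unfolding spin_generator_def \<Phi>_c[OF i(2)] \<Phi>_c[OF i(3)] \<Phi>_T[OF i(1)] ..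
      also have "\<dots> = cs_R n i" by (rule B.spin_generator_hecke_generator[OF i(1)])
      finally show ?thesis by (simp add: spin_hecke_R_def cs_R_def)
    qed
  qed (use that in \<open>simp add: P\<close>)
  have \<Phi>_\<Psi>: "\<Phi> (\<Psi> y) = y" if "y \<in> carrier ?B" for y
  proof (rule t.super_tensor_hom_unique[of ?B "\<lambda>y. \<Phi> (\<Psi> y)" "\<lambda>y. y"])
    show "superalgebra_hom t.AB ?B (\<lambda>y. \<Phi> (\<Psi> y))"
      using superalgebra_hom_comp[OF \<Psi>.hom \<Phi>.hom] by (simp add: cliff_spin_def)
    show "superalgebra_hom t.AB ?B (\<lambda>y. y)"
      using superalgebra_hom_id[OF B.superalgebra_axioms] by (simp add: cliff_spin_def)
    show "\<Phi> (\<Psi> (t.pure a \<one>\<^bsub>spin_hecke n\<^esub>)) = t.pure a \<one>\<^bsub>spin_hecke n\<^esub>" if "a \<in> carrier (clifford n)" for a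
      using \<Psi>_left[OF that] \<Phi>_\<iota>[OF that] by (simp add: in_left_def)
    show "\<Phi> (\<Psi> (t.pure \<one>\<^bsub>clifford n\<^esub> b)) = t.pure \<one>\<^bsub>clifford n\<^esub> b" if "b \<in> carrier (spin_hecke n)" for b
      using \<Psi>_right[OF that] \<Phi>_\<psi>[OF that] by (simp add: in_right_def)
  qed (use that in \<open>simp add: cliff_spin_def\<close>)

  have range: "{1..n-1} = {1..<n}" by auto
  show ?thesis
    unfolding range
  proof (intro exI[of _ \<Phi>] exI[of _ \<Psi>] conjI ballI)
    show "superalgebra_iso ?H ?B \<Phi>"
      by (rule superalgebra_isoI[OF \<Phi>.hom \<Psi>.hom \<Psi>_\<Phi> \<Phi>_\<Psi>])
    show "superalgebra_iso ?B ?H \<Psi>"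
      by (rule superalgebra_isoI[OF \<Psi>.hom \<Phi>.hom \<Phi>_\<Psi> \<Psi>_\<Phi>])
  qed (use \<Psi>_\<Phi> \<Phi>_\<Psi> \<Phi>_\<iota> \<Psi>_left \<iota>(2) \<Phi>_T \<Psi>_R in
      \<open>simp_all add: hecke_generator_def spin_generator_def\<close>)
qed

end
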